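(* Let $\Omega\subset\mathbb{R}^2$ be open, let $\gamma>0$, let $i\in\{0,1\}$, and let $A_i=\partial\Phi_i$ be the subdifferential in $L^2(\Omega)$ of the functional $\Phi_i$ (defined in the context). Suppose $u_0\in L^2(\Omega)$. Then there exists a unique solution $u$ to $$\frac{d^+u}{dt}+A_i(u(t))\ni 0,\qquad u(0)=u_0.$$ Moreover, for all $t>0$ one has $u(t)\in D(A_i)$, and $$\frac{d^+u}{dt}(t)+A_i^o(u(t))=0.$$
   Context: For $u\in L^2(\Omega)$ put $$\int_\Omega(|u_{x_1}|+|u_{x_2}|):=\sup\left\{\int_\Omega u\,\mathrm{div}\,z\,dx:\ z\in C^1_0(\Omega;\mathbb{R}^2),\ \max(|z_1|,|z_2|)\le 1 \text{ in }\Omega\right\}\in[0,\infty],$$ where $C^1_0$ denotes $C^1$ fields with compact support in $\Omega$. The functional $\Phi_0:L^2(\Omega)\to[0,\infty]$ is $\Phi_0(u)=\int_\Omega(|u_{x_1}|+|u_{x_2}|)$ if this quantity is finite, and $\Phi_0(u)=+\infty$ otherwise. The functional $\Phi_1:L^2(\Omega)\to[0,\infty]$ is $$\Phi_1(u)=\int_\Omega\Big(\frac{\gamma}{2}|\nabla u|^2+|u_{x_1}|+|u_{x_2}|\Big)dx\ \text{ if this is finite and } u\in H^1(\Omega),\qquad \Phi_1(u)=+\infty\ \text{ otherwise.}$$ $A_i=\partial\Phi_i$ is the (possibly multivalued) subdifferential: $w\in A_i(u)$ iff $\Phi_i(u)<\infty$ and $\Phi_i(v)\ge\Phi_i(u)+(w,v-u)_{L^2(\Omega)}$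 for all $v\in L^2(\Omega)$. $D(A_i)=\{u: A_i(u)\neq\emptyset\}$. For $u\in D(A_i)$, $A_i^o(u)$ is the minimal section, i.e. the element of minimal $L^2$-norm of $A_i(u)$. A solution is a function $u\in C([0,\infty);L^2(\Omega))$ which is Lipschitz continuous on $[\delta,\infty)$ for every $\delta>0$, has a right derivative $\frac{d^+u}{dt}$ in $L^2(\Omega)$ at every $t>0$, satisfies the inclusion for all $t>0$, and satisfies $u(0)=u_0$. *)

theory Defs
  imports "HOL-Analysis.Analysis"
begin

text \<open>
  Elements of \<open>L\<^sup>2(\<Omega>)\<close> are represented by functions on the whole plane, of which only the
  restriction to \<open>\<Omega>\<close> matters, and equality in \<open>L\<^sup>2(\<Omega>)\<close> is the relation \<open>L2_eq \<Omega>\<close>.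
\<close>

definition L2 :: "(real^2) set \<Rightarrow> (real^2 \<Rightarrow> real) set" where
  "L2 \<Omega> = {u. u \<in> borel_measurable (lebesgue_on \<Omega>) \<and>
               integrable (lebesgue_on \<Omega>) (\<lambda>x. (u x)\<^sup>2)}"

definition L2_eq :: "(real^2) set \<Rightarrow> (real^2 \<Rightarrow> real) \<Rightarrow> (real^2 \<Rightarrow> real) \<Rightarrow> bool" where
  "L2_eq \<Omega> u v \<longleftrightarrow> (AE x in lebesgue_on \<Omega>. u x = v x)"

definition L2_inner :: "(real^2) set \<Rightarrow> (real^2 \<Rightarrow> real) \<Rightarrow> (real^2 \<Rightarrow> real) \<Rightarrow> real" where
  "L2_inner \<Omega> u v = (\<integral>x. u x * v x \<partial>lebesgue_on \<Omega>)"

definition L2_norm :: "(real^2) set \<Rightarrow> (real^2 \<Rightarrow> real) \<Rightarrow> real" where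
  "L2_norm \<Omega> u = sqrt (L2_inner \<Omega> u u)"

text \<open>
  \<open>C\<^sup>1\<close> maps with compact support in \<open>\<Omega>\<close>, taken as already extended by zero to the whole plane.
\<close>

definition C1_0 :: "(real^2) set \<Rightarrow> (real^2 \<Rightarrow> 'b::real_normed_vector) set" where
  "C1_0 \<Omega> = {f. (\<exists>f' :: real^2 \<Rightarrow> ((real^2) \<Rightarrow>\<^sub>L 'b).
                   (\<forall>x. (f has_derivative blinfun_apply (f' x)) (at x)) \<and> continuous_on UNIV f') \<and>
                (\<exists>K. compact K \<and> K \<subseteq> \<Omega> \<and> (\<forall>x. x \<notin> K \<longrightarrow> f x = 0))}"

definition partial_deriv :: "2 \<Rightarrow> (real^2 \<Rightarrow> 'b::real_normed_vector) \<Rightarrow> real^2 \<Rightarrow> 'b" where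
  "partial_deriv k f x = frechet_derivative f (at x) (axis k 1)"

definition divergence :: "(real^2 \<Rightarrow> real^2) \<Rightarrow> real^2 \<Rightarrow> real" where
  "divergence z x = (\<Sum>k\<in>UNIV. partial_deriv k z x $ k)"

text \<open>The anisotropic total variation \<open>\<integral>\<^sub>\<Omega> (|u\<^sub>x\<^sub>1| + |u\<^sub>x\<^sub>2|)\<close>.\<close>

definition aniso_TV :: "(real^2) set \<Rightarrow> (real^2 \<Rightarrow> real) \<Rightarrow> ereal" where
  "aniso_TV \<Omega> u =
     (SUP z \<in> {z \<in> C1_0 \<Omega>. \<forall>x\<in>\<Omega>. max \<bar>z x $ 1\<bar> \<bar>z x $ 2\<bar> \<le> 1}.
        ereal (\<integral>x. u x * divergence z x \<partial>lebesgue_on \<Omega>))"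

definition is_weak_gradient :: "(real^2) set \<Rightarrow> (real^2 \<Rightarrow> real) \<Rightarrow> (real^2 \<Rightarrow> real^2) \<Rightarrow> bool" where
  "is_weak_gradient \<Omega> u g \<longleftrightarrow>
     (\<forall>k. (\<lambda>x. g x $ k) \<in> L2 \<Omega> \<and>
          (\<forall>\<phi>\<in>C1_0 \<Omega>. (\<integral>x. u x * partial_deriv k \<phi> x \<partial>lebesgue_on \<Omega>) =
                        - (\<integral>x. g x $ k * \<phi> x \<partial>lebesgue_on \<Omega>)))"

definition H1 :: "(real^2) set \<Rightarrow> (real^2 \<Rightarrow> real) set" where
  "H1 \<Omega> = {u \<in> L2 \<Omega>. \<exists>g. is_weak_gradient \<Omega> u g}"

text \<open>
  A weak gradient is determined up to a null set, so the choice of representative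
  does not affect any integral.
\<close>

definition weak_gradient :: "(real^2) set \<Rightarrow> (real^2 \<Rightarrow> real) \<Rightarrow> real^2 \<Rightarrow> real^2" where
  "weak_gradient \<Omega> u = (SOME g. is_weak_gradient \<Omega> u g)"

definition Phi0 :: "(real^2) set \<Rightarrow> (real^2 \<Rightarrow> real) \<Rightarrow> ereal" where
  "Phi0 \<Omega> u = (if aniso_TV \<Omega> u < \<infinity> then aniso_TV \<Omega> u else \<infinity>)"

text \<open>
  The nonnegative integral takes the value \<open>\<infinity>\<close> when the integrand is not integrable, which is possible
  for \<open>u \<in> H\<^sup>1(\<Omega>)\<close> if \<open>\<Omega>\<close> has infinite measure.
\<close>

definition Phi1 :: "(real^2) set \<Rightarrow> real \<Rightarrow> (real^2 \<Rightarrow> real) \<Rightarrow> ereal" where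
  "Phi1 \<Omega> \<gamma> u =
     (if u \<in> H1 \<Omega>
      then enn2ereal (\<integral>\<^sup>+x. ennreal (\<gamma> / 2 * (norm (weak_gradient \<Omega> u x))\<^sup>2
                                  + \<bar>weak_gradient \<Omega> u x $ 1\<bar> + \<bar>weak_gradient \<Omega> u x $ 2\<bar>)
                        \<partial>lebesgue_on \<Omega>)
      else \<infinity>)"

definition Phi :: "(real^2) set \<Rightarrow> real \<Rightarrow> nat \<Rightarrow> (real^2 \<Rightarrow> real) \<Rightarrow> ereal" where
  "Phi \<Omega> \<gamma> i = (if i = 0 then Phi0 \<Omega> else Phi1 \<Omega> \<gamma>)"

definition subdiff ::
  "(real^2) set \<Rightarrow> ((real^2 \<Rightarrow> real) \<Rightarrow> ereal) \<Rightarrow> (real^2 \<Rightarrow> real) \<Rightarrow> (real^2 \<Rightarrow> real) set" where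
  "subdiff \<Omega> F u =
     {w \<in> L2 \<Omega>. u \<in> L2 \<Omega> \<and> F u < \<infinity> \<and>
        (\<forall>v\<in>L2 \<Omega>. F v \<ge> F u + ereal (L2_inner \<Omega> w (\<lambda>x. v x - u x)))}"

definition op_domain ::
  "(real^2) set \<Rightarrow> ((real^2 \<Rightarrow> real) \<Rightarrow> (real^2 \<Rightarrow> real) set) \<Rightarrow> (real^2 \<Rightarrow> real) set" where
  "op_domain \<Omega> A = {u \<in> L2 \<Omega>. A u \<noteq> {}}"

text \<open>All representatives of the element of \<open>A u\<close> of minimal norm.\<close>

definition minimal_section ::
  "(real^2) set \<Rightarrow> ((real^2 \<Rightarrow> real) \<Rightarrow> (real^2 \<Rightarrow> real) set) \<Rightarrow> (real^2 \<Rightarrow> real) \<Rightarrow> (real^2 \<Rightarrow> real) set" where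
  "minimal_section \<Omega> A u = {w \<in> A u. \<forall>w'\<in>A u. L2_norm \<Omega> w \<le> L2_norm \<Omega> w'}"

definition has_right_deriv_L2 ::
  "(real^2) set \<Rightarrow> (real \<Rightarrow> real^2 \<Rightarrow> real) \<Rightarrow> (real^2 \<Rightarrow> real) \<Rightarrow> real \<Rightarrow> bool" where
  "has_right_deriv_L2 \<Omega> u d t \<longleftrightarrow>
     d \<in> L2 \<Omega> \<and>
     ((\<lambda>h. L2_norm \<Omega> (\<lambda>x. (u (t + h) x - u t x) / h - d x)) \<longlongrightarrow> 0) (at_right 0)"

definition is_solution ::
  "(real^2) set \<Rightarrow> ((real^2 \<Rightarrow> real) \<Rightarrow> (real^2 \<Rightarrow> real) set) \<Rightarrow> (real^2 \<Rightarrow> real) \<Rightarrow>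
   (real \<Rightarrow> real^2 \<Rightarrow> real) \<Rightarrow> bool" where
  "is_solution \<Omega> A u0 u \<longleftrightarrow>
     (\<forall>t\<ge>0. u t \<in> L2 \<Omega>) \<and>
     (\<forall>t\<ge>0. ((\<lambda>s. L2_norm \<Omega> (\<lambda>x. u s x - u t x)) \<longlongrightarrow> 0) (at t within {0..})) \<and>
     (\<forall>\<delta>>0. \<exists>L. \<forall>s\<ge>\<delta>. \<forall>t\<ge>\<delta>. L2_norm \<Omega> (\<lambda>x. u s x - u t x) \<le> L * \<bar>s - t\<bar>) \<and>
     (\<forall>t>0. \<exists>d. has_right_deriv_L2 \<Omega> u d t \<and>
                 (\<exists>a\<in>A (u t). L2_eq \<Omega> (\<lambda>x. d x + a x) (\<lambda>x. 0))) \<and>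
     L2_eq \<Omega> (u 0) u0"

end

theory Submission imports Defs begin

text \<open>
  The theorem is an instance of the generation theorem for gradient flows in a Hilbert space: a
  nonnegative convex functional with dense domain, whose proximal problems
  \<open>f v + \<parallel>v - x\<parallel>\<^sup>2 / (2 l) \<rightarrow> min\<close> are all solvable, has a maximal monotone subdifferential \<open>A\<close>,
  and \<open>-A\<close> generates a semigroup of contractions \<open>S t\<close> that maps every point into the domain of
  \<open>A\<close> at once. So there are two tasks: the abstract theorem, and the proximal problems and dense
  domains of \<open>\<Phi>\<^sub>0\<close> and \<open>\<Phi>\<^sub>1\<close>.

  The abstract theorem. Solving \<open>x \<in> y + l A y\<close> defines the resolvent \<open>J l x = y\<close>, a contraction, and
  the Yosida approximation \<open>Y l x = (x - J l x) / l \<in> A (J l x)\<close>. The implicit Euler scheme iterates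
  \<open>J l\<close>; the estimate of Kobayashi (\<open>kobayashi\<close>) compares two step sizes and makes the scheme
  converge. As \<open>l\<close> decreases to \<open>0\<close>, the norm of \<open>Y l x\<close> does not decrease, and monotonicity turns
  convergence of these norms into strong convergence of \<open>Y l x\<close> (\<open>norm_Y_diff\<close>). Hence if they stay
  bounded, \<open>x\<close> lies in the domain and the limit is the element \<open>a\<close> of minimal norm in \<open>A x\<close>
  (\<open>principal_exists\<close>). The difference quotient \<open>d\<close> of \<open>S\<close> at such a point, for a time increment
  \<open>h\<close>, satisfies \<open>\<parallel>d\<parallel> \<le> \<parallel>a\<parallel>\<close> and, by the discrete variational inequality tested with
  \<open>J (\<surd>h) x\<close>, almost \<open>\<langle>d, Y (\<surd>h) x\<rangle> \<le> - \<parallel>Y (\<surd>h) x\<parallel>\<^sup>2\<close>; together these force \<open>d \<rightarrow> - a\<close>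
  (\<open>S_right_derivative\<close>). For a subdifferential the energy decreases along the scheme, which bounds
  the discrete velocity at a positive time in terms of any one point \<open>v\<close> of the domain of \<open>f\<close>, by
  \<open>f v\<close> and the distance from \<open>v\<close> to the initial value (\<open>discrete_smoothing\<close>); so \<open>S t x\<close> lies in the domain for \<open>t > 0\<close>. Uniqueness holds
  because the squared distance of two solutions has a nonpositive right derivative.

  The Hilbert space. \<open>L\<^sup>2(\<Omega>)\<close> depends on \<open>\<Omega>\<close>, whereas a type cannot. The flow is therefore taken in
  \<open>L\<^sup>2\<close> of the whole plane, for the functional that looks only at the restriction to \<open>\<Omega>\<close>. Its
  subgradients vanish almost everywhere outside \<open>\<Omega>\<close>, nothing moves there, and restriction to \<open>\<Omega>\<close>
  gives the flow in \<open>L\<^sup>2(\<Omega>)\<close> (\<open>well_posed\<close>).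

  The functionals. \<open>\<Phi>\<^sub>0\<close> is a supremum of continuous linear functionals, so its sublevel sets are
  closed and convex and a minimising sequence of a proximal problem is Cauchy by the parallelogram
  law. For \<open>\<Phi>\<^sub>1\<close> the proximal problem is posed for pairs of a function and its weak gradient: it is
  uniformly convex in both, thanks to the Dirichlet term, so along a minimising sequence the
  gradients converge strongly too, and Fatou's lemma handles the remaining \<open>L\<^sup>1\<close> norm. Both
  functionals are finite on test functions, by integration by parts, and test functions are dense
  by the fundamental lemma of the calculus of variations. The same lemma makes weak gradients unique
  up to null sets, so \<open>\<Phi>\<^sub>1\<close> does not depend on the weak gradient chosen in its definition.
\<close>

section \<open>Maximal monotone operators and their resolvents\<close>

lemma half_norm_add:
  fixes p q :: "'h::real_inner"
  shows "(norm (p + q))\<^sup>2 / 2 - (norm q)\<^sup>2 / 2 = p \<bullet> q + (norm p)\<^sup>2 / 2"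
  by (simp add: power2_norm_eq_inner inner_add_left inner_add_right inner_commute add_divide_distrib)

text \<open>
  Requiring the solvability of \<open>x \<in> y + l A y\<close>, in the form \<open>(x - y) / l \<in> A y\<close>, is Minty's
  characterisation of maximality among monotone operators.
\<close>

locale maximal_monotone =
  fixes A :: "'h::{real_inner, complete_space} \<Rightarrow> 'h set"
  assumes monotone: "w \<in> A x \<Longrightarrow> w' \<in> A x' \<Longrightarrow> 0 \<le> (w - w') \<bullet> (x - x')"
    and range: "0 < l \<Longrightarrow> \<exists>y. (x - y) /\<^sub>R l \<in> A y"
begin

text \<open>
  \<open>J l\<close> is the resolvent of \<open>A\<close> and \<open>Y l\<close> its Yosida approximation.
\<close>

definition J :: "real \<Rightarrow> 'h \<Rightarrow> 'h" where
  "J l x = (SOME y. (x - y) /\<^sub>R l \<in> A y)"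

definition Y :: "real \<Rightarrow> 'h \<Rightarrow> 'h" where
  "Y l x = (x - J l x) /\<^sub>R l"

lemma Y_in: "0 < l \<Longrightarrow> Y l x \<in> A (J l x)"
  unfolding Y_def J_def by (rule someI_ex) (rule range)

lemma J_plus_Y: "0 < l \<Longrightarrow> J l x + l *\<^sub>R Y l x = x"
  by (simp add: Y_def)

lemma minus_J: "0 < l \<Longrightarrow> x - J l x = l *\<^sub>R Y l x"
  by (simp add: Y_def)

text \<open>
  Monotonicity says that adding a multiple of \<open>A\<close> to the identity can only push points apart. This
  makes the resolvent single-valued and a contraction.
\<close>

lemma expansive:
  assumes "w \<in> A y" "w' \<in> A y'" "0 \<le> l"
  shows "norm (y - y') \<le> norm ((y + l *\<^sub>R w) - (y' + l *\<^sub>R w'))"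
proof (cases "y = y'")
  case False
  have "norm (y - y') * norm (y - y') = (y - y') \<bullet> (y - y')"
    by (simp add: dot_square_norm power2_eq_square)
  also have "\<dots> \<le> (y - y') \<bullet> (y - y') + l * ((w - w') \<bullet> (y - y'))"
    using monotone[OF assms(1,2)] assms(3) by simp
  also have "\<dots> = ((y + l *\<^sub>R w) - (y' + l *\<^sub>R w')) \<bullet> (y - y')"
    by (simp add: algebra_simps)
  also have "\<dots> \<le> norm ((y + l *\<^sub>R w) - (y' + l *\<^sub>R w')) * norm (y - y')"
    by (rule norm_cauchy_schwarz)
  finally show ?thesis using False by simp
qed simp

lemma J_eqI:
  assumes "0 < l" "w \<in> A y"
  shows "J l (y + l *\<^sub>R w) = y"
  using expansive[OF Y_in[of l "y + l *\<^sub>R w"] assms(2), of l] assms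
  by (simp add: J_plus_Y)

lemma J_nonexpansive: "0 < l \<Longrightarrow> norm (J l x - J l y) \<le> norm (x - y)"
  using expansive[OF Y_in[of l x] Y_in[of l y], of l] by (simp add: J_plus_Y)

lemma resolvent_identity:
  assumes "0 < m" "m \<le> l"
  shows "J l x = J m ((m / l) *\<^sub>R x + (1 - m / l) *\<^sub>R J l x)"
proof -
  have l: "0 < l" using assms by simp
  have "(m / l) *\<^sub>R x + (1 - m / l) *\<^sub>R J l x = J l x + (m / l) *\<^sub>R (x - J l x)"
    by (simp add: algebra_simps)
  also have "\<dots> = J l x + m *\<^sub>R Y l x" using l by (simp add: minus_J)
  finally show ?thesis using J_eqI[OF assms(1) Y_in[OF l, of x]] by simp
qed

lemma norm_Y_le:
  assumes "0 < l" "w \<in> A x"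
  shows "norm (Y l x) \<le> norm w"
proof (cases "Y l x = 0")
  case False
  have "0 \<le> (w - Y l x) \<bullet> (l *\<^sub>R Y l x)"
    using monotone[OF assms(2) Y_in[OF assms(1)], of x] by (simp only: minus_J[OF assms(1)])
  then have "Y l x \<bullet> Y l x \<le> w \<bullet> Y l x"
    using assms(1) by (simp add: inner_diff_left zero_le_mult_iff)
  also have "\<dots> \<le> norm w * norm (Y l x)" by (rule norm_cauchy_schwarz)
  finally show ?thesis using False by (simp add: dot_square_norm power2_eq_square)
qed simp

text \<open>
  Monotonicity at \<open>J l x\<close> and \<open>J m x\<close> gives \<open>\<parallel>Y l x\<parallel>\<^sup>2 \<le> \<langle>Y l x, Y m x\<rangle>\<close>; expanding the square of the
  difference then yields the claim. It upgrades convergence of the norms to strong convergence.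
\<close>

lemma norm_Y_diff:
  assumes "0 < m" "m \<le> l"
  shows "(norm (Y l x - Y m x))\<^sup>2 \<le> (norm (Y m x))\<^sup>2 - (norm (Y l x))\<^sup>2"
proof (cases "m = l")
  case False
  define a b where "a = Y l x" and "b = Y m x"
  have l: "0 < l" using assms by simp
  have "J l x - J m x = m *\<^sub>R b - l *\<^sub>R a"
    using minus_J[OF l, of x] minus_J[OF assms(1), of x] by (simp add: a_def b_def algebra_simps)
  then have "0 \<le> (a - b) \<bullet> (m *\<^sub>R b - l *\<^sub>R a)"
    using monotone[OF Y_in[OF l, of x] Y_in[OF assms(1), of x]] by (simp add: a_def b_def)
  also have "\<dots> = (l - m) * (a \<bullet> b - a \<bullet> a) - m * ((a - b) \<bullet> (a - b))"
    by (simp add: algebra_simps inner_commute)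
  finally have "0 \<le> (l - m) * (a \<bullet> b - a \<bullet> a)"
    using assms(1) by (smt (verit) inner_ge_zero mult_nonneg_nonneg)
  then have "a \<bullet> a \<le> a \<bullet> b" using assms False by (simp add: zero_le_mult_iff)
  then show ?thesis unfolding a_def[symmetric] b_def[symmetric]
    by (simp add: power2_norm_eq_inner algebra_simps inner_commute)
qed simp

lemma norm_Y_antimono: "0 < m \<Longrightarrow> m \<le> l \<Longrightarrow> norm (Y l x) \<le> norm (Y m x)"
  using norm_Y_diff[of m l x] by (smt (verit) norm_ge_zero power2_le_imp_le zero_le_power2)

text \<open>
  The limit \<open>a\<close> is compared with the resolvent of \<open>x + a\<close>: monotonicity forces that resolvent to
  be \<open>x\<close>.
\<close>

lemma A_closed:
  assumes "\<And>n. w n \<in> A (y n)" "w \<longlonglongrightarrow> a" "y \<longlonglongrightarrow> x"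
  shows "a \<in> A x"
proof -
  \<comment> \<open>the only candidate: if \<open>a\<close> is in \<open>A x\<close>, then \<open>x + a\<close> has resolvent \<open>x\<close>\<close>
  define z where "z = J 1 (x + a)"
  have z: "x + a - z \<in> A z" using Y_in[of 1 "x + a"] by (simp add: z_def Y_def)
  have "(\<lambda>n. (w n - (x + a - z)) \<bullet> (y n - z)) \<longlonglongrightarrow> (a - (x + a - z)) \<bullet> (x - z)"
    by (intro tendsto_intros assms)
  then have "0 \<le> (a - (x + a - z)) \<bullet> (x - z)"
    by (rule LIMSEQ_le_const) (use monotone[OF assms(1) z] in auto)
  also have "a - (x + a - z) = - (x - z)" by simp
  finally have "(x - z) \<bullet> (x - z) \<le> 0" by (simp only: inner_minus_left neg_0_le_iff_le)
  then have "z = x" using inner_ge_zero[of "x - z"] by (simp add: inner_eq_zero_iff)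
  with z show ?thesis by simp
qed

text \<open>
  Elements of minimal norm, recorded together with the fact that the Yosida approximation finds
  them.
\<close>

definition principal :: "'h \<Rightarrow> 'h \<Rightarrow> bool" where
  "principal x a \<longleftrightarrow> a \<in> A x \<and> (\<forall>w\<in>A x. norm a \<le> norm w) \<and> ((\<lambda>l. Y l x) \<longlongrightarrow> a) (at_right 0)"

text \<open>
  The norms of the Yosida approximations increase as the parameter decreases, and being bounded
  they converge, so by \<open>norm_Y_diff\<close> the approximations form a Cauchy sequence. The limit has norm
  at most that of any element of \<open>A x\<close>, because each approximation has.
\<close>

lemma principal_exists:
  assumes bd: "\<And>l. 0 < l \<Longrightarrow> norm (Y l x) \<le> C"
  shows "\<exists>a. principal x a \<and> norm a \<le> C"
proof -
  define r where "r n = inverse (real (Suc n))" for n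
  have r0: "r \<longlonglongrightarrow> 0" unfolding r_def by (rule LIMSEQ_inverse_real_of_nat)
  have rpos: "0 < r n" for n by (simp add: r_def)
  have rmono: "n \<le> m \<Longrightarrow> r m \<le> r n" for n m by (simp add: r_def field_simps)
  define q where "q n = (norm (Y (r n) x))\<^sup>2" for n
  have "incseq q"
    unfolding incseq_def q_def by (auto intro!: power_mono norm_Y_antimono rpos rmono)
  moreover have "q n \<le> C\<^sup>2" for n
    unfolding q_def by (auto intro!: power_mono bd rpos)
  ultimately obtain L where "q \<longlonglongrightarrow> L" using incseq_convergent by metis
  then have qC: "Cauchy q" by (rule LIMSEQ_imp_Cauchy)
  have "Cauchy (\<lambda>n. Y (r n) x)"
  proof (rule metric_CauchyI)
    fix e :: real assume "0 < e"
    then obtain M where M: "\<And>m n. m \<ge> M \<Longrightarrow> n \<ge> M \<Longrightarrow> dist (q m) (q n) < e\<^sup>2"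
      using metric_CauchyD[OF qC, of "e\<^sup>2"] by auto
    have *: "dist (Y (r n) x) (Y (r m) x) < e" if "M \<le> n" "n \<le> m" for m n
    proof -
      have "(norm (Y (r n) x - Y (r m) x))\<^sup>2 \<le> q m - q n"
        unfolding q_def by (rule norm_Y_diff) (use that rpos rmono in auto)
      also have "\<dots> < e\<^sup>2" using M[of m n] that by (simp add: dist_real_def)
      finally show ?thesis using \<open>0 < e\<close> by (simp add: dist_norm power2_less_imp_less)
    qed
    show "\<exists>M. \<forall>m\<ge>M. \<forall>n\<ge>M. dist (Y (r m) x) (Y (r n) x) < e"
      by (rule exI[of _ M]) (metis * dist_commute nle_le)
  qed
  then obtain a where a: "(\<lambda>n. Y (r n) x) \<longlonglongrightarrow> a" using Cauchy_convergent_iff convergent_def by blast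
  have "(\<lambda>n. x - r n *\<^sub>R Y (r n) x) \<longlonglongrightarrow> x - 0 *\<^sub>R a"
    by (intro tendsto_intros r0 a)
  moreover have "x - r n *\<^sub>R Y (r n) x = J (r n) x" for n
    using J_plus_Y[OF rpos, of n x] by (metis add_diff_cancel_right')
  ultimately have Jx: "(\<lambda>n. J (r n) x) \<longlonglongrightarrow> x" by simp
  have "a \<in> A x"
    by (rule A_closed[OF Y_in[OF rpos] a Jx])
  moreover have min: "norm a \<le> c" if "\<And>l. 0 < l \<Longrightarrow> norm (Y l x) \<le> c" for c
    by (rule LIMSEQ_le_const2[OF tendsto_norm[OF a]]) (use that rpos in auto)
  moreover have "((\<lambda>l. Y l x) \<longlongrightarrow> a) (at_right 0)"
  proof (rule tendstoI)
    fix e :: real assume "0 < e"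
    have "(\<lambda>n. norm (Y (r n) x - a)) \<longlonglongrightarrow> norm (a - a)"
      by (intro tendsto_intros a)
    moreover have qa: "q \<longlonglongrightarrow> (norm a)\<^sup>2" unfolding q_def by (intro tendsto_intros a)
    ultimately have "\<forall>\<^sub>F n in sequentially. (norm a)\<^sup>2 - e\<^sup>2 < q n"
      using order_tendstoD(1)[OF qa, of "(norm a)\<^sup>2 - e\<^sup>2"] \<open>0 < e\<close> by simp
    then obtain n where n: "(norm a)\<^sup>2 - e\<^sup>2 < q n" by (auto simp: eventually_sequentially)
    have "dist (Y l x) a < e" if "0 < l" "l < r n" for l
    proof -
      have ev: "\<forall>\<^sub>F k in sequentially. (norm (Y l x - Y (r k) x))\<^sup>2 \<le> q k - (norm (Y l x))\<^sup>2"
        using order_tendstoD(2)[OF r0 that(1)]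
        by eventually_elim (auto simp: q_def intro!: norm_Y_diff rpos)
      have "(\<lambda>k. (norm (Y l x - Y (r k) x))\<^sup>2) \<longlonglongrightarrow> (norm (Y l x - a))\<^sup>2"
        by (intro tendsto_intros a)
      moreover have "(\<lambda>k. q k - (norm (Y l x))\<^sup>2) \<longlonglongrightarrow> (norm a)\<^sup>2 - (norm (Y l x))\<^sup>2"
        by (intro tendsto_intros qa)
      ultimately have "(norm (Y l x - a))\<^sup>2 \<le> (norm a)\<^sup>2 - (norm (Y l x))\<^sup>2"
        using ev by (intro tendsto_le[OF trivial_limit_sequentially])
      also have "\<dots> \<le> (norm a)\<^sup>2 - q n"
        unfolding q_def using that by (auto intro!: power_mono norm_Y_antimono)
      also have "\<dots> < e\<^sup>2" using n by simp
      finally show ?thesis using \<open>0 < e\<close> by (simp add: dist_norm power2_less_imp_less)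
    qed
    then show "\<forall>\<^sub>F l in at_right 0. dist (Y l x) a < e"
      unfolding eventually_at_right_field using rpos[of n] by auto
  qed
  ultimately show ?thesis
    unfolding principal_def using norm_Y_le bd by blast
qed

lemma principal_of_mem: "w \<in> A x \<Longrightarrow> \<exists>a. principal x a"
  using principal_exists[of x "norm w"] norm_Y_le by blast

lemma iter_nonexpansive: "0 < l \<Longrightarrow> norm ((J l ^^ n) x - (J l ^^ n) y) \<le> norm (x - y)"
proof (induction n)
  case (Suc n)
  then show ?case using J_nonexpansive[of l "(J l ^^ n) x" "(J l ^^ n) y"] by simp
qed simp

lemma iter_step:
  assumes "0 < l" "w \<in> A x"
  shows "norm ((J l ^^ Suc n) x - (J l ^^ n) x) \<le> l * norm w"
proof -
  have "norm ((J l ^^ n) (J l x) - (J l ^^ n) x) \<le> norm (J l x - x)"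
    by (rule iter_nonexpansive[OF assms(1)])
  also have "\<dots> = l * norm (Y l x)"
    using minus_J[OF assms(1), of x] assms(1) by (metis abs_of_pos norm_minus_commute norm_scaleR)
  also have "\<dots> \<le> l * norm w" using norm_Y_le[OF assms] assms(1) by simp
  finally show ?thesis by (simp only: funpow_Suc_right o_apply)
qed

lemma iter_dist:
  assumes "0 < l" "w \<in> A x" "m \<le> n"
  shows "norm ((J l ^^ n) x - (J l ^^ m) x) \<le> (real n - real m) * l * norm w"
  using assms(3)
proof (induction n rule: dec_induct)
  case (step n)
  have "norm ((J l ^^ Suc n) x - (J l ^^ m) x)
      \<le> norm ((J l ^^ Suc n) x - (J l ^^ n) x) + norm ((J l ^^ n) x - (J l ^^ m) x)"
    by (metis norm_triangle_ineq diff_add_cancel add_diff_eq)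
  also have "\<dots> \<le> l * norm w + (real n - real m) * l * norm w"
    by (intro add_mono iter_step assms step.IH)
  finally show ?case by (simp add: algebra_simps)
qed simp

lemma iter_dist0:
  assumes "0 < l" "w \<in> A x"
  shows "norm ((J l ^^ n) x - x) \<le> real n * l * norm w"
  using iter_dist[OF assms, of 0 n] by simp

text \<open>
  Kobayashi's estimate. By the resolvent identity, the error after \<open>(n + 1, j + 1)\<close> steps is at most
  a convex combination, with weights \<open>m / l\<close> and \<open>1 - m / l\<close>, of the errors after \<open>(n, j)\<close> and
  \<open>(n, j + 1)\<close> steps. The square of the right-hand side obeys the same recursion up to a nonpositive
  term, and the square root is concave.
\<close>

lemma kobayashi:
  assumes "0 < m" "m \<le> l" "w \<in> A x"
  shows "norm ((J m ^^ n) x - (J l ^^ k) x)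
    \<le> norm w * sqrt ((real n * m - real k * l)\<^sup>2 + real n * m\<^sup>2 + real k * l\<^sup>2)"
proof (induction n arbitrary: k)
  case 0
  have "norm (x - (J l ^^ k) x) \<le> norm w * (real k * l)"
    using iter_dist0[of l w x k] assms by (simp add: norm_minus_commute mult_ac)
  also have "\<dots> \<le> norm w * sqrt ((real k * l)\<^sup>2 + real k * l\<^sup>2)"
    by (intro mult_left_mono real_le_rsqrt) auto
  finally show ?case by simp
next
  case (Suc n)
  note IH = this
  show ?case
  proof (cases k)
    case 0
    have "norm ((J m ^^ Suc n) x - x) \<le> norm w * (real (Suc n) * m)"
      using iter_dist0[of m w x "Suc n"] assms by (simp add: mult_ac del: funpow.simps)
    also have "\<dots> \<le> norm w * sqrt ((real (Suc n) * m)\<^sup>2 + real (Suc n) * m\<^sup>2)"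
      by (intro mult_left_mono real_le_rsqrt) auto
    finally show ?thesis using 0 by simp
  next
    case (Suc j)
    define u v where "u = (J m ^^ n) x" and "v = (J l ^^ j) x"
    define \<alpha> where "\<alpha> = m / l"
    have l: "0 < l" using assms by simp
    have \<alpha>: "0 \<le> \<alpha>" "\<alpha> \<le> 1" "\<alpha> * l = m" using assms by (auto simp: \<alpha>_def)
    define P where "P = (real n * m - real j * l)\<^sup>2 + real n * m\<^sup>2 + real j * l\<^sup>2"
    define Q where "Q = (real n * m - real (Suc j) * l)\<^sup>2 + real n * m\<^sup>2 + real (Suc j) * l\<^sup>2"
    define R where "R = (real (Suc n) * m - real (Suc j) * l)\<^sup>2 + real (Suc n) * m\<^sup>2 + real (Suc j) * l\<^sup>2"
    have PQ: "0 \<le> P" "0 \<le> Q" by (auto simp: P_def Q_def)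
    \<comment> \<open>the recursion for the squares, with the nonpositive surplus \<open>- 2 m\<^sup>2\<close>\<close>
    have R: "\<alpha> * P + (1 - \<alpha>) * Q = R - 2 * m\<^sup>2"
      unfolding P_def Q_def R_def \<alpha>(3)[symmetric]
      by (simp add: power2_eq_square algebra_simps)
    have "norm (J m u - J l v) = norm (J m u - J m (\<alpha> *\<^sub>R v + (1 - \<alpha>) *\<^sub>R J l v))"
      using resolvent_identity[OF assms(1,2), of v] by (simp add: \<alpha>_def)
    also have "\<dots> \<le> norm (u - (\<alpha> *\<^sub>R v + (1 - \<alpha>) *\<^sub>R J l v))"
      by (rule J_nonexpansive[OF assms(1)])
    also have "u - (\<alpha> *\<^sub>R v + (1 - \<alpha>) *\<^sub>R J l v) = \<alpha> *\<^sub>R (u - v) + (1 - \<alpha>) *\<^sub>R (u - J l v)"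
      by (simp add: algebra_simps)
    also have "norm \<dots> \<le> \<alpha> * norm (u - v) + (1 - \<alpha>) * norm (u - J l v)"
      using \<alpha> norm_triangle_ineq[of "\<alpha> *\<^sub>R (u - v)" "(1 - \<alpha>) *\<^sub>R (u - J l v)"] by simp
    also have "\<dots> \<le> \<alpha> * (norm w * sqrt P) + (1 - \<alpha>) * (norm w * sqrt Q)"
      using IH[of j] IH[of "Suc j"] \<alpha>
      by (intro add_mono mult_left_mono) (auto simp: P_def Q_def u_def v_def)
    also have "\<dots> = norm w * (\<alpha> * sqrt P + (1 - \<alpha>) * sqrt Q)" by (simp add: algebra_simps)
    also have "\<dots> \<le> norm w * sqrt R"
    proof (intro mult_left_mono real_le_rsqrt)
      have "0 \<le> \<alpha> * (1 - \<alpha>) * (sqrt P - sqrt Q)\<^sup>2" using \<alpha> by simp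
      also have "\<dots> = \<alpha> * (sqrt P)\<^sup>2 + (1 - \<alpha>) * (sqrt Q)\<^sup>2 - (\<alpha> * sqrt P + (1 - \<alpha>) * sqrt Q)\<^sup>2"
        by (simp add: power2_eq_square algebra_simps)
      finally show "(\<alpha> * sqrt P + (1 - \<alpha>) * sqrt Q)\<^sup>2 \<le> R"
        using R PQ by (smt (verit) real_sqrt_pow2 zero_le_power2)
    qed simp
    finally show ?thesis by (simp add: R_def u_def v_def Suc)
  qed
qed

end

section \<open>The semigroup as limit of the implicit Euler scheme\<close>

text \<open>
  The scheme is run with the step sizes \<open>1 / (k + 1)\<close>; up to the time \<open>t\<close> it takes
  \<open>\<lfloor>t (k + 1)\<rfloor>\<close> steps.
\<close>

definition step_size :: "nat \<Rightarrow> real" where "step_size k = inverse (real (Suc k))"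
definition step_count :: "nat \<Rightarrow> real \<Rightarrow> nat" where "step_count k t = nat \<lfloor>t * real (Suc k)\<rfloor>"

lemma step_size_pos: "0 < step_size k" by (simp add: step_size_def)
lemma step_size_tendsto: "step_size \<longlonglongrightarrow> 0" unfolding step_size_def by (rule LIMSEQ_inverse_real_of_nat)
lemma step_size_antimono: "j \<le> k \<Longrightarrow> step_size k \<le> step_size j" by (simp add: step_size_def field_simps)

lemma step_count_size:
  assumes "0 \<le> t"
  shows "real (step_count k t) * step_size k \<le> t" "t - step_size k \<le> real (step_count k t) * step_size k"
proof -
  have "real (step_count k t) = of_int \<lfloor>t * real (Suc k)\<rfloor>"
    using assms by (simp add: step_count_def)
  then have "real (step_count k t) \<le> t * real (Suc k)" "t * real (Suc k) - 1 \<le> real (step_count k t)"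
    by linarith+
  then have "real (step_count k t) * step_size k \<le> t * real (Suc k) * step_size k"
    "(t * real (Suc k) - 1) * step_size k \<le> real (step_count k t) * step_size k"
    using step_size_pos[of k] by (intro mult_right_mono; simp)+
  moreover have "real (Suc k) * step_size k = 1" by (simp add: step_size_def)
  ultimately show "real (step_count k t) * step_size k \<le> t" "t - step_size k \<le> real (step_count k t) * step_size k"
    by (simp_all only: mult.assoc left_diff_distrib mult_1_right mult_1_left)
qed

lemma step_count_size_tendsto:
  assumes "0 \<le> t"
  shows "(\<lambda>k. real (step_count k t) * step_size k) \<longlonglongrightarrow> t"
proof (rule real_tendsto_sandwich)
  show "(\<lambda>k. t - step_size k) \<longlonglongrightarrow> t" using tendsto_diff[OF tendsto_const[of t] step_size_tendsto] by simp
qed (use step_count_size[OF assms] in auto)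

context maximal_monotone
begin

definition euler :: "nat \<Rightarrow> real \<Rightarrow> 'h \<Rightarrow> 'h" where
  "euler k t = J (step_size k) ^^ step_count k t"

definition S :: "real \<Rightarrow> 'h \<Rightarrow> 'h" where
  "S t x = lim (\<lambda>k. euler k t x)"

lemma euler_nonexpansive: "norm (euler k t x - euler k t y) \<le> norm (x - y)"
  unfolding euler_def by (rule iter_nonexpansive[OF step_size_pos])

lemma euler_dist:
  assumes "w \<in> A x" "0 \<le> t" "M \<le> j" "j \<le> k"
  shows "norm (euler k t x - euler j t x) \<le> norm w * sqrt ((step_size M)\<^sup>2 + 2 * t * step_size M)"
proof -
  define n i where "n = step_count k t" and "i = step_count j t"
  have le: "step_size k \<le> step_size j" "step_size j \<le> step_size M" "step_size k \<le> step_size M"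
    using assms step_size_antimono by auto
  have n: "real n * step_size k \<le> t" "t - step_size k \<le> real n * step_size k"
    and i: "real i * step_size j \<le> t" "t - step_size j \<le> real i * step_size j"
    unfolding n_def i_def by (intro step_count_size assms)+
  have "(real n * step_size k - real i * step_size j)\<^sup>2 \<le> (step_size M)\<^sup>2"
    unfolding abs_le_square_iff[symmetric] using n i le step_size_pos[of M] by auto
  moreover have "real n * (step_size k)\<^sup>2 \<le> t * step_size M"
    using mult_mono[OF n(1) le(3)] assms(2) step_size_pos[of k] by (simp add: power2_eq_square mult_ac)
  moreover have "real i * (step_size j)\<^sup>2 \<le> t * step_size M"
    using mult_mono[OF i(1) le(2)] assms(2) step_size_pos[of j] by (simp add: power2_eq_square mult_ac)
  ultimately have "sqrt ((real n * step_size k - real i * step_size j)\<^sup>2 + real n * (step_size k)\<^sup>2 + real i * (step_size j)\<^sup>2)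
      \<le> sqrt ((step_size M)\<^sup>2 + 2 * t * step_size M)"
    by (intro real_sqrt_le_mono) simp
  then have "norm w * sqrt ((real n * step_size k - real i * step_size j)\<^sup>2 + real n * (step_size k)\<^sup>2 + real i * (step_size j)\<^sup>2)
      \<le> norm w * sqrt ((step_size M)\<^sup>2 + 2 * t * step_size M)"
    by (intro mult_left_mono) auto
  with kobayashi[OF step_size_pos le(1) assms(1), of n i] show ?thesis
    by (simp add: euler_def n_def i_def)
qed

lemma euler_Cauchy_dom:
  assumes "w \<in> A x" "0 \<le> t"
  shows "Cauchy (\<lambda>k. euler k t x)"
proof (rule metric_CauchyI)
  fix e :: real assume "0 < e"
  have "(\<lambda>M. norm w * sqrt ((step_size M)\<^sup>2 + 2 * t * step_size M)) \<longlonglongrightarrow> norm w * sqrt (0\<^sup>2 + 2 * t * 0)"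
    by (intro tendsto_intros step_size_tendsto)
  then have "\<forall>\<^sub>F M in sequentially. norm w * sqrt ((step_size M)\<^sup>2 + 2 * t * step_size M) < e"
    using order_tendstoD(2) \<open>0 < e\<close> by fastforce
  then obtain M where M: "norm w * sqrt ((step_size M)\<^sup>2 + 2 * t * step_size M) < e"
    by (auto simp: eventually_sequentially)
  have "dist (euler k t x) (euler j t x) < e" if "M \<le> j" "j \<le> k" for j k
    using euler_dist[OF assms that] M by (simp add: dist_norm)
  then show "\<exists>M. \<forall>m\<ge>M. \<forall>n\<ge>M. dist (euler m t x) (euler n t x) < e"
    by (metis dist_commute nle_le)
qed

end

locale densely_defined_maximal_monotone = maximal_monotone +
  assumes dense: "closure {x. A x \<noteq> {}} = UNIV"
begin

lemma dense_approx: "0 < e \<Longrightarrow> \<exists>y w. w \<in> A y \<and> norm (x - y) < e"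
  using dense closure_approachable[of x "{x. A x \<noteq> {}}"]
  by (simp add: dist_norm norm_minus_commute) (metis ex_in_conv)

lemma euler_Cauchy:
  assumes "0 \<le> t"
  shows "Cauchy (\<lambda>k. euler k t x)"
proof (rule metric_CauchyI)
  fix e :: real assume "0 < e"
  then obtain y w where y: "w \<in> A y" "norm (x - y) < e / 3"
    using dense_approx[of "e/3" x] by auto
  obtain M where M: "\<And>m n. M \<le> m \<Longrightarrow> M \<le> n \<Longrightarrow> dist (euler m t y) (euler n t y) < e / 3"
    using metric_CauchyD[OF euler_Cauchy_dom[OF y(1) assms], of "e / 3"] \<open>0 < e\<close> by auto
  have "dist (euler m t x) (euler n t x) < e" if "M \<le> m" "M \<le> n" for m n
  proof -
    have "dist (euler m t x) (euler n t x) \<le> dist (euler m t x) (euler m t y)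
        + dist (euler m t y) (euler n t y) + dist (euler n t x) (euler n t y)"
      using dist_triangle[of "euler m t x" "euler n t x" "euler m t y"]
        dist_triangle[of "euler m t y" "euler n t x" "euler n t y"]
      by (simp add: dist_commute)
    moreover have "dist (euler m t x) (euler m t y) \<le> norm (x - y)" "dist (euler n t x) (euler n t y) \<le> norm (x - y)"
      unfolding dist_norm by (rule euler_nonexpansive)+
    ultimately show ?thesis using M[OF that] y(2) by simp
  qed
  then show "\<exists>M. \<forall>m\<ge>M. \<forall>n\<ge>M. dist (euler m t x) (euler n t x) < e" by blast
qed

lemma euler_tendsto: "0 \<le> t \<Longrightarrow> (\<lambda>k. euler k t x) \<longlonglongrightarrow> S t x"
  unfolding S_def using euler_Cauchy Cauchy_convergent_iff convergent_LIMSEQ_iff by blast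

lemma S_0: "S 0 x = x"
  unfolding S_def euler_def step_count_def by simp

lemma S_nonexpansive:
  assumes "0 \<le> t" shows "norm (S t x - S t y) \<le> norm (x - y)"
  by (rule LIMSEQ_le_const2[OF tendsto_norm[OF tendsto_diff[OF euler_tendsto[OF assms] euler_tendsto[OF assms]]]])
     (use euler_nonexpansive in auto)

lemma S_lipschitz:
  assumes "w \<in> A x" "0 \<le> s" "0 \<le> t"
  shows "norm (S t x - S s x) \<le> norm w * \<bar>t - s\<bar>"
proof (rule LIMSEQ_le)
  show "(\<lambda>k. norm (euler k t x - euler k s x)) \<longlonglongrightarrow> norm (S t x - S s x)"
    by (intro tendsto_intros euler_tendsto assms)
  show "(\<lambda>k. norm w * \<bar>real (step_count k t) * step_size k - real (step_count k s) * step_size k\<bar>) \<longlonglongrightarrow> norm w * \<bar>t - s\<bar>"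
    by (intro tendsto_intros step_count_size_tendsto assms)
  have "norm ((J (step_size k) ^^ m) x - (J (step_size k) ^^ n) x)
      \<le> norm w * \<bar>real m * step_size k - real n * step_size k\<bar>" for k m n
  proof (induction m n rule: linorder_wlog)
    case (le m n)
    then show ?case using iter_dist[OF step_size_pos[of k] assms(1) le] step_size_pos[of k]
      by (simp add: norm_minus_commute left_diff_distrib[symmetric] abs_mult mult_ac)
  next
    case (sym m n)
    then show ?case by (metis norm_minus_commute abs_minus_commute)
  qed
  then show "\<exists>N. \<forall>n\<ge>N. norm (euler n t x - euler n s x)
      \<le> norm w * \<bar>real (step_count n t) * step_size n - real (step_count n s) * step_size n\<bar>"
    by (auto simp: euler_def)
qed

text \<open>
  The numbers of steps for \<open>t\<close> and \<open>s\<close> add up to that for \<open>t + s\<close> with an error of at most one step,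
  and one step moves a point of the domain by at most a multiple of the step size.
\<close>

lemma S_add_dom:
  assumes "w \<in> A x" "0 \<le> s" "0 \<le> t"
  shows "S (t + s) x = S t (S s x)"
proof -
  have bound: "norm (euler k (t + s) x - euler k t (euler k s x)) \<le> step_size k * norm w" for k
  proof -
    have "step_count k (t + s) = step_count k t + step_count k s \<or> step_count k (t + s) = Suc (step_count k t + step_count k s)"
    proof -
      have "0 \<le> t * real (Suc k)" "0 \<le> s * real (Suc k)" using assms by auto
      then show ?thesis unfolding step_count_def distrib_right by linarith
    qed
    moreover have "euler k t (euler k s x) = (J (step_size k) ^^ (step_count k t + step_count k s)) x"
      by (simp add: euler_def funpow_add)
    ultimately show ?thesis
      using iter_step[OF step_size_pos[of k] assms(1), of "step_count k t + step_count k s"] step_size_pos[of k]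
      by (auto simp: euler_def simp del: funpow.simps)
  qed
  have "(\<lambda>k. euler k (t + s) x - euler k t (euler k s x)) \<longlonglongrightarrow> 0"
    by (rule Lim_null_comparison[of _ "\<lambda>k. step_size k * norm w"])
       (use bound tendsto_mult_left_zero[OF step_size_tendsto] in auto)
  moreover have "(\<lambda>k. euler k t (euler k s x) - euler k t (S s x)) \<longlonglongrightarrow> 0"
  proof (rule Lim_null_comparison)
    show "(\<lambda>k. norm (euler k s x - S s x)) \<longlonglongrightarrow> 0"
      using euler_tendsto[OF assms(2), of x] by (simp add: tendsto_norm_zero LIM_zero)
  qed (use euler_nonexpansive in auto)
  ultimately have "(\<lambda>k. (euler k (t + s) x - euler k t (euler k s x))
      + (euler k t (euler k s x) - euler k t (S s x)) + euler k t (S s x)) \<longlonglongrightarrow> 0 + 0 + S t (S s x)"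
    by (intro tendsto_intros euler_tendsto assms)
  then have "(\<lambda>k. euler k (t + s) x) \<longlonglongrightarrow> S t (S s x)" by simp
  moreover have "(\<lambda>k. euler k (t + s) x) \<longlonglongrightarrow> S (t + s) x"
    by (intro euler_tendsto) (use assms in auto)
  ultimately show ?thesis using LIMSEQ_unique by blast
qed

lemma S_add:
  assumes "0 \<le> s" "0 \<le> t"
  shows "S (t + s) x = S t (S s x)"
proof (rule ccontr)
  assume "S (t + s) x \<noteq> S t (S s x)"
  then obtain y w where y: "w \<in> A y" "norm (x - y) < norm (S (t + s) x - S t (S s x)) / 2"
    using dense_approx[of "norm (S (t + s) x - S t (S s x)) / 2" x] by auto
  have "norm (S (t + s) x - S t (S s x)) \<le> norm (S (t + s) x - S (t + s) y) + norm (S t (S s x) - S t (S s y))"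
    unfolding S_add_dom[OF y(1) assms]
    by (metis dist_norm dist_commute dist_triangle)
  also have "\<dots> \<le> norm (x - y) + norm (S s x - S s y)"
    by (intro add_mono S_nonexpansive) (use assms in auto)
  also have "\<dots> \<le> norm (x - y) + norm (x - y)"
    by (intro add_left_mono S_nonexpansive assms)
  finally show False using y(2) by simp
qed

lemma S_continuous: "continuous_on {0..} (\<lambda>t. S t x)"
  unfolding continuous_on_iff
proof (intro ballI allI impI)
  fix t e :: real assume t: "t \<in> {0..}" and "0 < e"
  then obtain y w where y: "w \<in> A y" "norm (x - y) < e / 3"
    using dense_approx[of "e/3" x] by auto
  define d where "d = e / (3 * (norm w + 1))"
  have "0 < d" using \<open>0 < e\<close> by (auto simp: d_def intro!: divide_pos_pos add_nonneg_pos)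
  moreover have "dist (S s x) (S t x) < e" if "s \<in> {0..}" "dist s t < d" for s
  proof -
    have "norm w * \<bar>s - t\<bar> \<le> norm w * d"
      using that by (intro mult_left_mono) (auto simp: dist_real_def)
    also have "\<dots> \<le> (norm w + 1) * d" using \<open>0 < d\<close> by simp
    also have "\<dots> = e / 3"
    proof -
      have "norm w + 1 \<noteq> 0" using norm_ge_zero[of w] by linarith
      then show ?thesis by (simp add: d_def divide_simps)
    qed
    finally have "dist (S s y) (S t y) \<le> e / 3"
      using S_lipschitz[OF y(1), of t s] that t by (simp add: dist_norm)
    moreover have "dist (S s x) (S s y) < e / 3" "dist (S t x) (S t y) < e / 3"
      using S_nonexpansive[of s x y] S_nonexpansive[of t x y] that t y(2) by (auto simp: dist_norm)
    moreover have "dist (S s x) (S t x) \<le> dist (S s x) (S s y) + dist (S s y) (S t y) + dist (S t x) (S t y)"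
      using dist_triangle[of "S s x" "S t x" "S s y"] dist_triangle[of "S s y" "S t x" "S t y"]
      by (simp add: dist_commute)
    ultimately show ?thesis by simp
  qed
  ultimately show "\<exists>d>0. \<forall>s\<in>{0..}. dist s t < d \<longrightarrow> dist (S s x) (S t x) < e" by blast
qed

text \<open>
  The discrete form of \<open>d/dt \<parallel>u - y\<parallel>\<^sup>2 / 2 \<le> \<langle>w, y - u\<rangle>\<close>, which is monotonicity against \<open>w \<in> A y\<close>.
  The iterates on the right-hand side are replaced by \<open>x\<close>, at the cost of the quadratic term.
\<close>

lemma iter_variational:
  assumes "0 < l" "w \<in> A y" "a \<in> A x"
  shows "(norm ((J l ^^ n) x - y))\<^sup>2 / 2 - (norm (x - y))\<^sup>2 / 2
    \<le> (real n * l) * (w \<bullet> (y - x)) + (real n * l)\<^sup>2 * (norm w * norm a)"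
proof (induction n)
  case (Suc n)
  define u v where "u = (J l ^^ n) x" and "v = J l u"
  have v: "v = (J l ^^ Suc n) x" by (simp add: u_def v_def)
  have "(norm (v - y))\<^sup>2 / 2 - (norm (u - y))\<^sup>2 / 2 = (v - u) \<bullet> (v - y) - (norm (v - u))\<^sup>2 / 2"
    by (simp add: power2_norm_eq_inner algebra_simps inner_commute add_divide_distrib diff_divide_distrib)
  also have "\<dots> \<le> (v - u) \<bullet> (v - y)" by simp
  also have "v - u = - (l *\<^sub>R Y l u)" using minus_J[OF assms(1), of u] by (simp add: v_def algebra_simps)
  also have "- (l *\<^sub>R Y l u) \<bullet> (v - y) = - l * ((Y l u - w) \<bullet> (v - y)) - l * (w \<bullet> (v - y))"
    by (simp add: algebra_simps)
  also have "\<dots> \<le> - l * (w \<bullet> (v - y))"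
    using monotone[OF Y_in[OF assms(1), of u] assms(2)] assms(1) by (simp add: v_def)
  also have "\<dots> = l * (w \<bullet> (y - x)) + l * (w \<bullet> (x - v))"
    by (simp add: algebra_simps)
  also have "\<dots> \<le> l * (w \<bullet> (y - x)) + l * (norm w * (real (Suc n) * l * norm a))"
  proof -
    have "norm (x - v) \<le> real (Suc n) * l * norm a"
      using iter_dist0[OF assms(1,3), of "Suc n"] v by (simp add: norm_minus_commute)
    then have "norm w * norm (x - v) \<le> norm w * (real (Suc n) * l * norm a)"
      by (rule mult_left_mono) simp
    then have "w \<bullet> (x - v) \<le> norm w * (real (Suc n) * l * norm a)"
      using norm_cauchy_schwarz[of w "x - v"] by linarith
    then show ?thesis using assms(1) by simp
  qed
  finally have "(norm (v - y))\<^sup>2 / 2 - (norm (u - y))\<^sup>2 / 2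
      \<le> l * (w \<bullet> (y - x)) + l * (norm w * (real (Suc n) * l * norm a))" .
  with Suc.IH have "(norm (v - y))\<^sup>2 / 2 - (norm (x - y))\<^sup>2 / 2
      \<le> l * (w \<bullet> (y - x)) + l * (norm w * (real (Suc n) * l * norm a))
        + ((real n * l) * (w \<bullet> (y - x)) + (real n * l)\<^sup>2 * (norm w * norm a))"
    by (simp add: u_def)
  also have "\<dots> = (real (Suc n) * l) * (w \<bullet> (y - x)) + ((real n * l)\<^sup>2 + real (Suc n) * l\<^sup>2) * (norm w * norm a)"
    by (simp add: algebra_simps power2_eq_square)
  also have "\<dots> \<le> (real (Suc n) * l) * (w \<bullet> (y - x)) + (real (Suc n) * l)\<^sup>2 * (norm w * norm a)"
    by (intro add_left_mono mult_right_mono) (use assms(1) in \<open>auto simp: algebra_simps power2_eq_square\<close>)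
  finally show ?case by (simp add: v)
qed simp

lemma S_variational:
  assumes "0 \<le> h" "w \<in> A y" "a \<in> A x"
  shows "(norm (S h x - y))\<^sup>2 / 2 - (norm (x - y))\<^sup>2 / 2 \<le> h * (w \<bullet> (y - x)) + h\<^sup>2 * (norm w * norm a)"
proof (rule LIMSEQ_le)
  show "(\<lambda>k. (norm (euler k h x - y))\<^sup>2 / 2 - (norm (x - y))\<^sup>2 / 2)
      \<longlonglongrightarrow> (norm (S h x - y))\<^sup>2 / 2 - (norm (x - y))\<^sup>2 / 2"
    by (intro tendsto_intros euler_tendsto assms) simp
  show "(\<lambda>k. (real (step_count k h) * step_size k) * (w \<bullet> (y - x)) + (real (step_count k h) * step_size k)\<^sup>2 * (norm w * norm a))
      \<longlonglongrightarrow> h * (w \<bullet> (y - x)) + h\<^sup>2 * (norm w * norm a)"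
    by (intro tendsto_intros step_count_size_tendsto assms)
  show "\<exists>N. \<forall>k\<ge>N. (norm (euler k h x - y))\<^sup>2 / 2 - (norm (x - y))\<^sup>2 / 2
      \<le> (real (step_count k h) * step_size k) * (w \<bullet> (y - x)) + (real (step_count k h) * step_size k)\<^sup>2 * (norm w * norm a)"
    unfolding euler_def using iter_variational[OF step_size_pos assms(2,3)] by blast
qed

text \<open>
  With the difference quotient \<open>d\<close> over a time \<open>h\<close> and \<open>y = Y l x\<close>, the variational inequality at the
  point \<open>J l x = x - l y\<close> reads \<open>\<langle>d, y\<rangle> + \<parallel>y\<parallel>\<^sup>2 \<le> (h / l) \<parallel>a\<parallel>\<^sup>2\<close>. Since \<open>\<parallel>d\<parallel> \<le> \<parallel>a\<parallel>\<close>, this bounds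
  \<open>\<parallel>d + y\<parallel>\<^sup>2\<close> by \<open>\<parallel>a\<parallel>\<^sup>2 - \<parallel>y\<parallel>\<^sup>2 + 2 (h / l) \<parallel>a\<parallel>\<^sup>2\<close>. Both parts of the bound vanish for \<open>l = \<surd>h\<close>.
\<close>

lemma S_right_derivative:
  assumes p: "principal x a"
  shows "((\<lambda>h. (S h x - x) /\<^sub>R h) \<longlongrightarrow> - a) (at_right 0)"
proof -
  have a: "a \<in> A x" using p by (simp add: principal_def)
  have Ya: "((\<lambda>l. Y l x) \<longlongrightarrow> a) (at_right 0)" using p by (simp add: principal_def)
  \<comment> \<open>the parameter of the Yosida approximation is coupled to the time increment\<close>
  have sq: "filterlim sqrt (at_right 0) (at_right (0::real))"
    unfolding filterlim_at
    by (auto simp: eventually_at_right_field intro!: tendsto_eq_intros exI[of _ 1])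
  have Ys: "((\<lambda>h. Y (sqrt h) x) \<longlongrightarrow> a) (at_right 0)"
    by (rule filterlim_compose[OF Ya sq])
  define B where "B h = sqrt ((norm a)\<^sup>2 - (norm (Y (sqrt h) x))\<^sup>2 + 2 * sqrt h * (norm a)\<^sup>2)" for h
  have B: "(B \<longlongrightarrow> sqrt ((norm a)\<^sup>2 - (norm a)\<^sup>2 + 2 * sqrt 0 * (norm a)\<^sup>2)) (at_right 0)"
    unfolding B_def by (intro tendsto_intros Ys)
  have bound: "norm ((S h x - x) /\<^sub>R h + Y (sqrt h) x) \<le> B h" if h: "0 < h" for h
  proof -
    define d l y where "d = (S h x - x) /\<^sub>R h" and "l = sqrt h" and "y = Y l x"
    have l: "0 < l" "l\<^sup>2 = h" using h by (auto simp: l_def)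
    have Sx: "S h x = x + h *\<^sub>R d" using h by (simp add: d_def)
    have ya: "norm y \<le> norm a" using norm_Y_le[OF l(1) a] by (simp add: y_def)
    have da: "norm d \<le> norm a"
    proof -
      have "norm (S h x - S 0 x) \<le> norm a * h" using S_lipschitz[OF a, of 0 h] h by simp
      moreover have "norm d = norm (S h x - x) / h"
        using h by (simp add: d_def divide_inverse mult.commute)
      ultimately show ?thesis unfolding S_0 using h by (metis pos_divide_le_eq)
    qed
    have "h * (d \<bullet> (l *\<^sub>R y)) \<le> (norm (h *\<^sub>R d + l *\<^sub>R y))\<^sup>2 / 2 - (norm (l *\<^sub>R y))\<^sup>2 / 2"
    proof -
      from half_norm_add[of "h *\<^sub>R d" "l *\<^sub>R y"] show ?thesis
        using zero_le_power2[of "norm (h *\<^sub>R d)"] by (simp only: inner_scaleR_left)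
    qed
    also have "h *\<^sub>R d + l *\<^sub>R y = S h x - J l x"
      unfolding Sx y_def minus_J[OF l(1), symmetric] by simp
    also have "l *\<^sub>R y = x - J l x" using minus_J[OF l(1), of x] by (simp add: y_def)
    also have "(norm (S h x - J l x))\<^sup>2 / 2 - (norm (x - J l x))\<^sup>2 / 2
        \<le> h * (y \<bullet> (J l x - x)) + h\<^sup>2 * (norm y * norm a)"
      using S_variational[OF _ Y_in[OF l(1), of x] a, of h] h by (simp add: y_def)
    also have "J l x - x = - (l *\<^sub>R y)" unfolding y_def minus_J[OF l(1), symmetric] by simp
    also have "h * (y \<bullet> - (l *\<^sub>R y)) + h\<^sup>2 * (norm y * norm a)
        \<le> h * (y \<bullet> - (l *\<^sub>R y)) + h\<^sup>2 * (norm a * norm a)"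
      using ya by (intro add_left_mono mult_left_mono mult_right_mono) auto
    finally have "h * (d \<bullet> (x - J l x)) \<le> h * (y \<bullet> - (l *\<^sub>R y)) + h\<^sup>2 * (norm a * norm a)" .
    then have "h * l * (d \<bullet> y + y \<bullet> y) \<le> h * l * (l * (norm a)\<^sup>2)"
      unfolding minus_J[OF l(1)] y_def[symmetric] l(2)[symmetric]
      by (simp add: algebra_simps power2_eq_square)
    then have *: "d \<bullet> y + y \<bullet> y \<le> l * (norm a)\<^sup>2" using h l by simp
    have "(norm (d + y))\<^sup>2 = (norm d)\<^sup>2 + 2 * (d \<bullet> y + y \<bullet> y) - (norm y)\<^sup>2"
      by (simp add: power2_norm_eq_inner algebra_simps inner_commute)
    also have "\<dots> \<le> (norm a)\<^sup>2 + 2 * (l * (norm a)\<^sup>2) - (norm y)\<^sup>2"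
      using * power_mono[OF da norm_ge_zero, of 2]
      by (intro diff_right_mono add_mono mult_left_mono) auto
    finally show ?thesis unfolding B_def d_def[symmetric] l_def[symmetric] y_def[symmetric]
      by (intro real_le_rsqrt) linarith
  qed
  have "((\<lambda>h. (S h x - x) /\<^sub>R h + Y (sqrt h) x) \<longlongrightarrow> 0) (at_right 0)"
  proof (rule Lim_null_comparison)
    show "\<forall>\<^sub>F h in at_right 0. norm ((S h x - x) /\<^sub>R h + Y (sqrt h) x) \<le> B h"
      unfolding eventually_at_right_field using bound by (auto intro!: exI[of _ 1])
    show "(B \<longlongrightarrow> 0) (at_right 0)" using B by simp
  qed
  from tendsto_diff[OF this Ys] show ?thesis by simp
qed

text \<open>
  Once the semigroup enters the domain immediately, shifting time by \<open>\<delta>\<close> gives the Lipschitz bound,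
  and shifting it by \<open>t\<close> reduces the right derivative at \<open>t\<close> to the one at \<open>0\<close>.
\<close>

theorem generation:
  assumes smoothing: "\<And>x t. 0 < t \<Longrightarrow> A (S t x) \<noteq> {}"
  shows "\<exists>u. u 0 = x \<and> continuous_on {0..} u \<and>
    (\<forall>\<delta>>0. \<exists>L. \<forall>s\<ge>\<delta>. \<forall>t\<ge>\<delta>. norm (u s - u t) \<le> L * \<bar>s - t\<bar>) \<and>
    (\<forall>t>0. \<exists>a\<in>A (u t). (\<forall>w\<in>A (u t). norm a \<le> norm w) \<and>
       ((\<lambda>h. (u (t + h) - u t) /\<^sub>R h) \<longlongrightarrow> - a) (at_right 0))"
proof (intro exI[of _ "\<lambda>t. S t x"] conjI allI impI)
  show "S 0 x = x" by (rule S_0)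
  show "continuous_on {0..} (\<lambda>t. S t x)" by (rule S_continuous)
  have shift: "S t x = S (t - \<delta>) (S \<delta> x)" if "0 < \<delta>" "\<delta> \<le> t" for t \<delta>
    using S_add[of \<delta> "t - \<delta>" x] that by simp
  show "\<exists>L. \<forall>s\<ge>\<delta>. \<forall>t\<ge>\<delta>. norm (S s x - S t x) \<le> L * \<bar>s - t\<bar>" if \<delta>: "0 < \<delta>" for \<delta>
  proof -
    obtain w where w: "w \<in> A (S \<delta> x)" using smoothing[OF \<delta>] by blast
    have "norm (S s x - S t x) \<le> norm w * \<bar>s - t\<bar>" if "\<delta> \<le> s" "\<delta> \<le> t" for s t
      using S_lipschitz[OF w, of "t - \<delta>" "s - \<delta>"] shift[OF \<delta>, of s] shift[OF \<delta>, of t] that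
      by simp
    then show ?thesis by blast
  qed
  show "\<exists>a\<in>A (S t x). (\<forall>w\<in>A (S t x). norm a \<le> norm w) \<and>
       ((\<lambda>h. (S (t + h) x - S t x) /\<^sub>R h) \<longlongrightarrow> - a) (at_right 0)" if t: "0 < t" for t
  proof -
    obtain a where a: "principal (S t x) a" using smoothing[OF t] principal_of_mem by blast
    have "\<forall>\<^sub>F h in at_right 0. (S h (S t x) - S t x) /\<^sub>R h = (S (t + h) x - S t x) /\<^sub>R h"
      unfolding eventually_at_right_field
      using S_add[of t _ x] t by (auto intro!: exI[of _ 1] simp: add.commute)
    with S_right_derivative[OF a]
    have "((\<lambda>h. (S (t + h) x - S t x) /\<^sub>R h) \<longlongrightarrow> - a) (at_right 0)"
      by (rule Lim_transform_eventually)
    then show ?thesis using a by (auto simp: principal_def)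
  qed
qed

end

section \<open>Uniqueness of the flow\<close>

text \<open>
  For a slope \<open>e > 0\<close>, the times up to \<open>b\<close> at which the graph has not risen above the line of slope
  \<open>e\<close> through its value at \<open>a\<close> have a last element, and the right derivative there would extend them
  beyond it unless it is \<open>b\<close>.
\<close>

lemma nonincreasing_of_right_derivative:
  fixes f :: "real \<Rightarrow> real"
  assumes cont: "continuous_on {0..} f"
    and deriv: "\<And>t. 0 < t \<Longrightarrow> \<exists>D\<le>0. ((\<lambda>h. (f (t + h) - f t) / h) \<longlongrightarrow> D) (at_right 0)"
    and "0 \<le> T"
  shows "f T \<le> f 0"
proof -
  have main: "f b \<le> f a + e * (b - a)" if ab: "0 < a" "a \<le> b" and e: "0 < e" for a b e
  proof -
    define X where "X = {a..b} \<inter> {s. f s \<le> f a + e * (s - a)}"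
    define s where "s = Sup X"
    have "closed ({a..b} \<inter> (\<lambda>s. f s - e * (s - a)) -` {..f a})"
      by (rule continuous_closed_preimage)
         (use ab in \<open>auto intro!: continuous_intros continuous_on_subset[OF cont]\<close>)
    moreover have "X = {a..b} \<inter> (\<lambda>s. f s - e * (s - a)) -` {..f a}" by (auto simp: X_def)
    ultimately have "closed X" by simp
    moreover have "a \<in> X" using ab by (simp add: X_def)
    moreover have "bdd_above X" by (rule bdd_aboveI[of _ b]) (simp add: X_def)
    ultimately have sX: "s \<in> X" unfolding s_def using closed_contains_Sup by blast
    have "s = b"
    proof (rule ccontr)
      assume "s \<noteq> b"
      then have "s < b" "0 < s" using sX ab by (auto simp: X_def)
      then obtain D where D: "D \<le> 0" "((\<lambda>h. (f (s + h) - f s) / h) \<longlongrightarrow> D) (at_right 0)"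
        using deriv by blast
      have "\<forall>\<^sub>F h in at_right 0. (f (s + h) - f s) / h < e"
        using order_tendstoD(2)[OF D(2)] D(1) e by simp
      then obtain r where r: "0 < r" "\<And>h. 0 < h \<Longrightarrow> h < r \<Longrightarrow> (f (s + h) - f s) / h < e"
        unfolding eventually_at_right_field by auto
      define h where "h = min (r / 2) (b - s)"
      have h: "0 < h" "h < r" "s + h \<le> b" using r(1) \<open>s < b\<close> by (auto simp: h_def)
      have "f (s + h) \<le> f s + e * h" using r(2)[OF h(1,2)] h(1) by (simp add: field_simps)
      then have "s + h \<in> X" using sX h by (auto simp: X_def algebra_simps)
      then have "s + h \<le> s" unfolding s_def using \<open>bdd_above X\<close> cSup_upper by blast
      then show False using h(1) by simp
    qed
    then show ?thesis using sX by (simp add: X_def)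
  qed
  have step: "f b \<le> f a" if ab: "0 < a" "a \<le> b" for a b
  proof (rule field_le_epsilon)
    fix e :: real assume "0 < e"
    then have "f b \<le> f a + e / (b - a + 1) * (b - a)" using ab by (intro main) auto
    also have "e / (b - a + 1) * (b - a) \<le> e" using ab \<open>0 < e\<close> by (simp add: field_simps)
    finally show "f b \<le> f a + e" by simp
  qed
  show ?thesis
  proof (cases "T = 0")
    case False
    then have T: "0 < T" using \<open>0 \<le> T\<close> by simp
    have "(f \<longlongrightarrow> f 0) (at_right 0)"
      using cont by (auto simp: continuous_on_def intro: tendsto_within_subset)
    moreover have "\<forall>\<^sub>F a in at_right 0. f T \<le> f a"
      unfolding eventually_at_right_field using T step by (auto intro!: exI[of _ T])
    ultimately show ?thesis by (intro tendsto_lowerbound) auto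
  qed simp
qed

lemma (in maximal_monotone) flow_unique:
  assumes u: "continuous_on {0..} u" and v: "continuous_on {0..} v" and "u 0 = v 0"
    and du: "\<And>t. 0 < t \<Longrightarrow> \<exists>a\<in>A (u t). ((\<lambda>h. (u (t + h) - u t) /\<^sub>R h) \<longlongrightarrow> - a) (at_right 0)"
    and dv: "\<And>t. 0 < t \<Longrightarrow> \<exists>a\<in>A (v t). ((\<lambda>h. (v (t + h) - v t) /\<^sub>R h) \<longlongrightarrow> - a) (at_right 0)"
    and "0 \<le> T"
  shows "u T = v T"
proof -
  define f where "f t = (norm (u t - v t))\<^sup>2" for t
  have "f T \<le> f 0"
  proof (rule nonincreasing_of_right_derivative)
    show "continuous_on {0..} f" unfolding f_def by (intro continuous_intros u v)
    show "\<exists>D\<le>0. ((\<lambda>h. (f (t + h) - f t) / h) \<longlongrightarrow> D) (at_right 0)" if t: "0 < t" for t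
    proof -
      obtain a b where a: "a \<in> A (u t)" "((\<lambda>h. (u (t + h) - u t) /\<^sub>R h) \<longlongrightarrow> - a) (at_right 0)"
        and b: "b \<in> A (v t)" "((\<lambda>h. (v (t + h) - v t) /\<^sub>R h) \<longlongrightarrow> - b) (at_right 0)"
        using du[OF t] dv[OF t] by blast
      define z where "z = u t - v t"
      define q where "q h = (u (t + h) - u t) /\<^sub>R h - (v (t + h) - v t) /\<^sub>R h" for h
      have q: "(q \<longlongrightarrow> - a - - b) (at_right 0)" unfolding q_def by (intro tendsto_intros a b)
      have id: "((\<lambda>h. h) \<longlongrightarrow> (0::real)) (at_right 0)" by (rule tendsto_ident_at)
      \<comment> \<open>the difference quotient of the squared distance, expanded at \<open>z\<close>\<close>
      have "((\<lambda>h. 2 * (q h \<bullet> z) + h * (q h \<bullet> q h)) \<longlongrightarrow> 2 * ((- a - - b) \<bullet> z) + 0 * ((- a - - b) \<bullet> (- a - - b)))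
          (at_right 0)"
        by (intro tendsto_intros q id)
      moreover have "\<forall>\<^sub>F h in at_right 0. 2 * (q h \<bullet> z) + h * (q h \<bullet> q h) = (f (t + h) - f t) / h"
        unfolding eventually_at_right_field
      proof (intro exI[of _ 1] conjI allI impI)
        fix h :: real assume h: "0 < h"
        have "u (t + h) - v (t + h) = z + h *\<^sub>R q h"
          using h by (simp add: z_def q_def algebra_simps)
        then show "2 * (q h \<bullet> z) + h * (q h \<bullet> q h) = (f (t + h) - f t) / h"
          using h unfolding f_def z_def[symmetric] power2_norm_eq_inner
          by (simp add: inner_add inner_commute field_simps)
      qed simp
      ultimately have "((\<lambda>h. (f (t + h) - f t) / h) \<longlongrightarrow> 2 * ((- a - - b) \<bullet> z)) (at_right 0)"
        by (auto intro: Lim_transform_eventually)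
      moreover have "2 * ((- a - - b) \<bullet> z) \<le> 0"
        using monotone[OF a(1) b(1)] by (simp add: z_def algebra_simps)
      ultimately show ?thesis by blast
    qed
  qed fact
  also have "f 0 = 0" using \<open>u 0 = v 0\<close> by (simp add: f_def)
  finally show ?thesis by (simp add: f_def)
qed

section \<open>Gradient flows of convex functionals\<close>

text \<open>
  The direct method for a uniformly convex functional: inserting the midpoint of two members of a
  minimising sequence shows that the sequence is Cauchy. The functional is split because \<open>Q\<close>, which
  carries the convexity, is continuous, while \<open>N\<close> is only lower semicontinuous.
\<close>

lemma minimiser_exists:
  fixes C :: "'k::{real_normed_vector, complete_space} set" and Q N :: "'k \<Rightarrow> real"
  assumes ne: "C \<noteq> {}"
    and mid: "\<And>x y. x \<in> C \<Longrightarrow> y \<in> C \<Longrightarrow> (1/2) *\<^sub>R (x + y) \<in> C"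
    and N_mid: "\<And>x y. x \<in> C \<Longrightarrow> y \<in> C \<Longrightarrow> N ((1/2) *\<^sub>R (x + y)) \<le> (N x + N y) / 2"
    and Q_mid: "\<And>x y. Q ((1/2) *\<^sub>R (x + y)) \<le> (Q x + Q y) / 2 - c * (norm (x - y))\<^sup>2"
    and c: "0 < c"
    and Q_cont: "continuous_on UNIV Q"
    and nonneg: "\<And>x. x \<in> C \<Longrightarrow> 0 \<le> N x" "\<And>x. 0 \<le> Q x"
    and cl: "\<And>r. closed {x \<in> C. N x \<le> r}"
  shows "\<exists>x\<in>C. \<forall>y\<in>C. Q x + N x \<le> Q y + N y"
proof -
  define F where "F x = Q x + N x" for x
  define m where "m = (INF x\<in>C. F x)"
  have bdd: "bdd_below (F ` C)"
    by (rule bdd_belowI[of _ 0]) (auto simp: F_def intro: nonneg add_nonneg_nonneg)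
  have m_le: "m \<le> F x" if "x \<in> C" for x
    unfolding m_def using bdd that by (rule cINF_lower)
  have "\<exists>x\<in>C. F x < m + inverse (real (Suc n))" for n
    using cINF_less_iff[OF ne bdd, of "m + inverse (real (Suc n))"] by (simp add: m_def)
  then obtain x where x: "\<And>n. x n \<in> C" "\<And>n. F (x n) < m + inverse (real (Suc n))" by metis
  have dist: "c * (norm (x n - x k))\<^sup>2 \<le> inverse (real (Suc M))" if "M \<le> n" "M \<le> k" for M n k
  proof -
    have "m \<le> F ((1/2) *\<^sub>R (x n + x k))" by (intro m_le mid x)
    also have "\<dots> \<le> (F (x n) + F (x k)) / 2 - c * (norm (x n - x k))\<^sup>2"
      using Q_mid[of "x n" "x k"] N_mid[OF x(1) x(1), of n k] by (simp add: F_def add_divide_distrib)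
    finally have "c * (norm (x n - x k))\<^sup>2 \<le> (F (x n) + F (x k)) / 2 - m" by simp
    moreover have "inverse (real (Suc n)) \<le> inverse (real (Suc M))" "inverse (real (Suc k)) \<le> inverse (real (Suc M))"
      using that by (auto intro!: le_imp_inverse_le)
    ultimately show ?thesis using x(2)[of n] x(2)[of k] by argo
  qed
  have "Cauchy x"
  proof (rule metric_CauchyI)
    fix e :: real assume e: "0 < e"
    obtain M where M: "inverse (real (Suc M)) < c * e\<^sup>2"
      using reals_Archimedean[of "c * e\<^sup>2"] c e by auto
    have "dist (x n) (x k) < e" if "M \<le> n" "M \<le> k" for n k
    proof -
      have "c * (norm (x n - x k))\<^sup>2 < c * e\<^sup>2" using dist[OF that] M by linarith
      then have "(norm (x n - x k))\<^sup>2 < e\<^sup>2" using c by simp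
      then show ?thesis using e by (simp add: dist_norm power2_less_imp_less)
    qed
    then show "\<exists>M. \<forall>m\<ge>M. \<forall>n\<ge>M. dist (x m) (x n) < e" by blast
  qed
  then obtain z where z: "x \<longlonglongrightarrow> z" using Cauchy_convergent_iff convergent_def by blast
  have Qz: "(\<lambda>n. Q (x n)) \<longlonglongrightarrow> Q z"
    using Q_cont z by (auto simp: continuous_on_def intro: tendsto_compose)
  have Fm: "(\<lambda>n. F (x n)) \<longlonglongrightarrow> m"
  proof (rule real_tendsto_sandwich[of "\<lambda>_. m"])
    show "(\<lambda>n. m + inverse (real (Suc n))) \<longlonglongrightarrow> m"
      using tendsto_add[OF tendsto_const[of m] LIMSEQ_inverse_real_of_nat] by simp
    show "\<forall>\<^sub>F n in sequentially. F (x n) \<le> m + inverse (real (Suc n))"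
      using x(2) less_imp_le by (intro always_eventually) blast
  qed (use m_le x(1) in auto)
  have "(\<lambda>n. F (x n) - Q (x n)) \<longlonglongrightarrow> m - Q z" by (intro tendsto_intros Fm Qz)
  then have Nm: "(\<lambda>n. N (x n)) \<longlonglongrightarrow> m - Q z" by (simp add: F_def)
  have Nz: "z \<in> C \<and> N z \<le> m - Q z + e" if e: "0 < e" for e
  proof -
    have "\<forall>\<^sub>F n in sequentially. x n \<in> {x \<in> C. N x \<le> m - Q z + e}"
      using order_tendstoD(2)[OF Nm, of "m - Q z + e"] e x(1) by (auto elim: eventually_mono)
    then have "z \<in> {x \<in> C. N x \<le> m - Q z + e}"
      by (intro Lim_in_closed_set[OF cl _ _ z]) auto
    then show ?thesis by simp
  qed
  then have "z \<in> C" using zero_less_one by blast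
  moreover have Nz': "N z \<le> m - Q z" by (rule field_le_epsilon) (use Nz in blast)
  have "Q z + N z \<le> F y" if "y \<in> C" for y
    using m_le[OF that] Nz' by linarith
  ultimately show ?thesis unfolding F_def by blast
qed

definition subgradients :: "'h::real_inner set \<Rightarrow> ('h \<Rightarrow> real) \<Rightarrow> 'h \<Rightarrow> 'h set" where
  "subgradients D f u = {w. u \<in> D \<and> (\<forall>v\<in>D. f u + w \<bullet> (v - u) \<le> f v)}"

lemma subgradients_monotone:
  assumes "w \<in> subgradients D f x" "w' \<in> subgradients D f x'"
  shows "0 \<le> (w - w') \<bullet> (x - x')"
proof -
  have "f x + w \<bullet> (x' - x) \<le> f x'" "f x' + w' \<bullet> (x - x') \<le> f x"
    using assms by (auto simp: subgradients_def)
  then show ?thesis by (simp add: algebra_simps)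
qed

text \<open>
  The minimiser \<open>y\<close> is compared with \<open>(1 - s) y + s v\<close>. After division by \<open>s\<close> the quadratic term
  contributes its first-order part and an error of order \<open>s\<close>.
\<close>

lemma subgradient_of_minimiser:
  assumes conv: "convex_on D f" and l: "0 < l" and y: "y \<in> D"
    and min: "\<And>v. v \<in> D \<Longrightarrow> f y + (norm (y - x))\<^sup>2 / (2 * l) \<le> f v + (norm (v - x))\<^sup>2 / (2 * l)"
  shows "(x - y) /\<^sub>R l \<in> subgradients D f y"
  unfolding subgradients_def
proof (intro CollectI conjI ballI y)
  fix v assume v: "v \<in> D"
  define K where "K = (norm (v - y))\<^sup>2 / (2 * l)"
  define g where "g = ((x - y) /\<^sub>R l) \<bullet> (v - y)"
  have ineq: "f y + g \<le> f v + s * K" if s: "0 < s" "s < 1" for s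
  proof -
    define p where "p = (1 - s) *\<^sub>R y + s *\<^sub>R v"
    have "p \<in> D" using conv y v s unfolding p_def convex_on_def by (auto intro: convexD_alt)
    then have "f y + (norm (y - x))\<^sup>2 / (2 * l) \<le> f p + (norm (p - x))\<^sup>2 / (2 * l)" by (rule min)
    moreover have "f p \<le> (1 - s) * f y + s * f v"
      unfolding p_def using conv y v s by (auto intro: convex_onD)
    moreover have "(norm (p - x))\<^sup>2 / (2 * l) = (norm (y - x))\<^sup>2 / (2 * l) - s * g + s * (s * K)"
    proof -
      have "p - x = (y - x) + s *\<^sub>R (v - y)" by (simp add: p_def algebra_simps)
      then have "(norm (p - x))\<^sup>2 = (norm (y - x + s *\<^sub>R (v - y)))\<^sup>2" by (simp only:)
      moreover have "(s *\<^sub>R (v - y)) \<bullet> (y - x) = - s * ((x - y) \<bullet> (v - y))"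
        by (simp add: inner_commute algebra_simps)
      moreover have "(norm (s *\<^sub>R (v - y)))\<^sup>2 = s\<^sup>2 * (norm (v - y))\<^sup>2"
        by (simp add: power_mult_distrib)
      ultimately have "(norm (p - x))\<^sup>2 = (norm (y - x))\<^sup>2 - 2 * s * ((x - y) \<bullet> (v - y)) + s\<^sup>2 * (norm (v - y))\<^sup>2"
        using half_norm_add[of "s *\<^sub>R (v - y)" "y - x"]
        unfolding add.commute[of "s *\<^sub>R (v - y)"] by argo
      moreover have "(x - y) \<bullet> (v - y) = g * l" unfolding g_def inner_scaleR_left using l by simp
      ultimately have "(norm (p - x))\<^sup>2 = (norm (y - x))\<^sup>2 - 2 * s * (g * l) + s\<^sup>2 * (norm (v - y))\<^sup>2"
        by (simp only:)
      then show ?thesis using l by (simp add: K_def add_divide_distrib diff_divide_distrib power2_eq_square)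
    qed
    ultimately have "s * (f y + g) \<le> s * (f v + s * K)" by (simp add: algebra_simps)
    then show ?thesis using s by simp
  qed
  have "((\<lambda>s. f v + s * K) \<longlongrightarrow> f v + 0 * K) (at_right 0)"
    by (intro tendsto_intros)
  moreover have "\<forall>\<^sub>F s in at_right 0. f y + g \<le> f v + s * K"
    unfolding eventually_at_right_field using ineq by (auto intro!: exI[of _ 1])
  ultimately have "f y + g \<le> f v + 0 * K" by (intro tendsto_lowerbound) auto
  then show "f y + ((x - y) /\<^sub>R l) \<bullet> (v - y) \<le> f v" by (simp add: g_def)
qed

text \<open>
  A convex functional with values in \<open>[0, \<infinity>]\<close>, given by its domain \<open>D\<close> and its finite values there.
  The solvability of the proximal problems takes the place of lower semicontinuity.
\<close>

locale convex_energy =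
  fixes D :: "'h::{real_inner, complete_space} set" and f :: "'h \<Rightarrow> real"
  assumes convex: "convex_on D f"
    and nonneg: "u \<in> D \<Longrightarrow> 0 \<le> f u"
    and dense_domain: "closure D = UNIV"
    and proximal: "0 < l \<Longrightarrow> \<exists>y\<in>D. \<forall>v\<in>D. f y + (norm (y - x))\<^sup>2 / (2 * l) \<le> f v + (norm (v - x))\<^sup>2 / (2 * l)"
begin

sublocale maximal_monotone "subgradients D f"
proof
  fix x :: 'h and l :: real assume l: "0 < l"
  obtain y where "y \<in> D" "\<forall>v\<in>D. f y + (norm (y - x))\<^sup>2 / (2 * l) \<le> f v + (norm (v - x))\<^sup>2 / (2 * l)"
    using proximal[OF l] by blast
  then show "\<exists>y. (x - y) /\<^sub>R l \<in> subgradients D f y"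
    using subgradient_of_minimiser[OF convex l, of y x] by blast
qed (rule subgradients_monotone)

lemma J_dom: "0 < l \<Longrightarrow> J l x \<in> D"
  using Y_in[of l x] by (simp add: subgradients_def)

lemma Y_subgradient: "0 < l \<Longrightarrow> v \<in> D \<Longrightarrow> f (J l x) + Y l x \<bullet> (v - J l x) \<le> f v"
  using Y_in[of l x] by (simp add: subgradients_def)

sublocale densely_defined_maximal_monotone "subgradients D f"
proof
  have "D \<subseteq> closure {x. subgradients D f x \<noteq> {}}"
  proof
    fix x assume x: "x \<in> D"
    show "x \<in> closure {x. subgradients D f x \<noteq> {}}"
      unfolding closure_approachable
    proof (intro allI impI)
      fix e :: real assume e: "0 < e"
      \<comment> \<open>chosen to make \<open>l f(x) < e\<^sup>2\<close>, as \<open>\<parallel>J l x - x\<parallel>\<^sup>2 \<le> l f(x)\<close>\<close>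
      define l where "l = e\<^sup>2 / 2 / (f x + 1)"
      have fx: "0 < f x + 1" using nonneg[OF x] by simp
      have l: "0 < l" using e fx by (auto simp: l_def)
      have "(norm (J l x - x))\<^sup>2 = l * (Y l x \<bullet> (x - J l x))"
        using minus_J[OF l, of x] by (metis inner_scaleR_left norm_minus_commute power2_norm_eq_inner)
      also have "\<dots> \<le> l * f x"
        using Y_subgradient[OF l x, of x] nonneg[OF J_dom[OF l, of x]] l by (intro mult_left_mono) auto
      also have "\<dots> \<le> l * (f x + 1)" using l by simp
      also have "\<dots> = e\<^sup>2 / 2" using fx unfolding l_def by (intro nonzero_divide_eq_eq[THEN iffD1, symmetric]) auto
      also have "\<dots> < e\<^sup>2" using e by simp
      finally have "norm (J l x - x) < e" using e by (simp add: power2_less_imp_less)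
      then show "\<exists>y\<in>{x. subgradients D f x \<noteq> {}}. dist y x < e"
        using Y_in[OF l, of x] by (auto simp: dist_norm)
    qed
  qed
  then have "closure D \<subseteq> closure {x. subgradients D f x \<noteq> {}}" by (simp add: closure_minimal)
  then show "closure {x. subgradients D f x \<noteq> {}} = UNIV" using dense_domain by auto
qed

text \<open>
  The discrete counterpart of the fact that
  \<open>t f(u) + t\<^sup>2 \<parallel>u'\<parallel>\<^sup>2 / 2 + \<parallel>u - v\<parallel>\<^sup>2 / 2 - t f(v)\<close> does not increase along the flow. In one step,
  the subgradient inequality towards \<open>v\<close> controls the distance to \<open>v\<close>, the one towards the previous
  point controls the decrease of the energy, and the velocities \<open>Y l\<close> decrease in norm.
\<close>

lemma discrete_smoothing:
  assumes l: "0 < l" and v: "v \<in> D"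
  shows "real n * l * f ((J l ^^ Suc n) x) + l\<^sup>2 * (real n * real (Suc n) / 2) * (norm (Y l ((J l ^^ n) x)))\<^sup>2
      + (norm ((J l ^^ n) x - v))\<^sup>2 / 2 \<le> real n * l * f v + (norm (x - v))\<^sup>2 / 2"
proof (induction n)
  case (Suc n)
  define u u' u'' w w' where "u = (J l ^^ n) x" and "u' = J l u" and "u'' = J l u'"
    and "w = Y l u" and "w' = Y l u'"
  have w: "w \<in> subgradients D f u'" unfolding w_def u'_def by (rule Y_in[OF l])
  have "norm w' \<le> norm w" unfolding w'_def by (rule norm_Y_le[OF l w])
  then have ww: "(norm w')\<^sup>2 \<le> (norm w)\<^sup>2" by (simp add: power_mono)
  have 1: "l * f u' + (norm (u' - v))\<^sup>2 / 2 \<le> l * f v + (norm (u - v))\<^sup>2 / 2"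
  proof -
    have "l * (f u' + w \<bullet> (v - u')) \<le> l * f v"
      using Y_subgradient[OF l v, of u] l by (intro mult_left_mono) (auto simp: w_def u'_def)
    moreover have "l * (w \<bullet> (v - u')) = (u - u') \<bullet> (v - u')"
      using minus_J[OF l, of u] by (simp add: w_def u'_def)
    moreover have "(norm (u - v))\<^sup>2 / 2 - (norm (u' - v))\<^sup>2 / 2 + (u - u') \<bullet> (v - u') = (norm (u - u'))\<^sup>2 / 2"
      using half_norm_add[of "u - u'" "u' - v"] by (simp add: inner_diff_left inner_diff_right)
    ultimately show ?thesis using zero_le_power2[of "norm (u - u')"] by (simp only: distrib_left)
  qed
  have 2: "f u'' + l * (norm w')\<^sup>2 \<le> f u'"
  proof -
    have "f u'' + w' \<bullet> (u' - u'') \<le> f u'"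
      using Y_subgradient[OF l J_dom[OF l, of u], of u'] by (simp add: w'_def u'_def u''_def)
    then show ?thesis using minus_J[OF l, of u'] by (simp add: w'_def u''_def power2_norm_eq_inner)
  qed
  have IH: "real n * l * f u' + l\<^sup>2 * (real n * real (Suc n) / 2) * (norm w)\<^sup>2 + (norm (u - v))\<^sup>2 / 2
      \<le> real n * l * f v + (norm (x - v))\<^sup>2 / 2"
    using Suc.IH by (simp add: u_def u'_def w_def)
  have "l\<^sup>2 * (real n * real (Suc n) / 2) * (norm w')\<^sup>2 \<le> l\<^sup>2 * (real n * real (Suc n) / 2) * (norm w)\<^sup>2"
    using ww by (intro mult_left_mono) auto
  moreover have "real (Suc n) * l * (f u'' + l * (norm w')\<^sup>2) \<le> real (Suc n) * l * f u'"
    using 2 l by (intro mult_left_mono) auto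
  moreover have "real (Suc n) * l * (f u'' + l * (norm w')\<^sup>2) + l\<^sup>2 * (real n * real (Suc n) / 2) * (norm w')\<^sup>2
      = real (Suc n) * l * f u'' + l\<^sup>2 * (real (Suc n) * real (Suc (Suc n)) / 2) * (norm w')\<^sup>2"
    by (simp add: field_simps power2_eq_square)
  moreover have "real (Suc n) * l * f u' = real n * l * f u' + l * f u'"
    "real (Suc n) * l * f v = real n * l * f v + l * f v"
    by (auto simp: algebra_simps)
  ultimately have "real (Suc n) * l * f u'' + l\<^sup>2 * (real (Suc n) * real (Suc (Suc n)) / 2) * (norm w')\<^sup>2
      + (norm (u' - v))\<^sup>2 / 2 \<le> real (Suc n) * l * f v + (norm (x - v))\<^sup>2 / 2"
    using 1 IH by argo
  then show ?case by (simp add: u_def u'_def u''_def w'_def)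
qed simp

lemma iterate_subgradient_bound:
  assumes l: "0 < l" and v: "v \<in> D"
  shows "(real n * l)\<^sup>2 * (norm (Y l ((J l ^^ n) x)))\<^sup>2 \<le> 2 * (real n * l) * f v + (norm (x - v))\<^sup>2"
proof -
  define W where "W = (norm (Y l ((J l ^^ n) x)))\<^sup>2"
  have "0 \<le> real n * l * f ((J l ^^ Suc n) x)"
    using nonneg[OF J_dom[OF l, of "(J l ^^ n) x"]] l by simp
  then have "l\<^sup>2 * (real n * real (Suc n) / 2) * W \<le> real n * l * f v + (norm (x - v))\<^sup>2 / 2"
    using discrete_smoothing[OF l v, of n x] zero_le_power2[of "norm ((J l ^^ n) x - v)"]
    unfolding W_def by argo
  moreover have "(real n * l)\<^sup>2 / 2 * W \<le> l\<^sup>2 * (real n * real (Suc n) / 2) * W"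
    unfolding W_def by (intro mult_right_mono) (use l in \<open>auto simp: power2_eq_square algebra_simps\<close>)
  ultimately show ?thesis unfolding W_def by argo
qed

text \<open>
  The iterates at time \<open>t\<close> carry subgradients bounded by a constant \<open>C\<close>, so their Yosida
  approximations are bounded by \<open>C\<close>; for a fixed parameter these depend continuously on the point,
  and the bound survives the limit.
\<close>

lemma S_in_domain:
  assumes t: "0 < t"
  shows "subgradients D f (S t x) \<noteq> {}"
proof -
  obtain v where v: "v \<in> D" using dense_domain by fastforce
  define C where "C = sqrt ((2 * t * f v + (norm (x - v))\<^sup>2) / (t / 2)\<^sup>2)"
  have bound: "norm (Y r (euler k t x)) \<le> C" if k: "step_size k < t / 4" and r: "0 < r" for k r
  proof -
    \<comment> \<open>the bound is for the velocity of the last step, which belongs to the final iterate\<close>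
    define n where "n = step_count k t - 1"
    have cnt: "real (step_count k t) * step_size k \<le> t" "t - step_size k \<le> real (step_count k t) * step_size k"
      using step_count_size[OF less_imp_le[OF t], of k] by blast+
    then have "0 < real (step_count k t) * step_size k" using k t by linarith
    then have n: "step_count k t = Suc n" using step_size_pos[of k] by (auto simp: n_def zero_less_mult_iff)
    have nl: "t / 2 \<le> real n * step_size k" "real n * step_size k \<le> t"
    proof -
      have "real (step_count k t) * step_size k = real n * step_size k + step_size k" by (simp add: n distrib_right)
      then show "t / 2 \<le> real n * step_size k" "real n * step_size k \<le> t"
        using cnt k step_size_pos[of k] t by linarith+
    qed
    define w where "w = Y (step_size k) ((J (step_size k) ^^ n) x)"
    have "w \<in> subgradients D f (euler k t x)"
      unfolding w_def euler_def n using Y_in[OF step_size_pos] by simp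
    then have "norm (Y r (euler k t x)) \<le> norm w" by (rule norm_Y_le[OF r])
    also have "norm w \<le> C" unfolding C_def
    proof (rule real_le_rsqrt)
      have "(t / 2)\<^sup>2 * (norm w)\<^sup>2 \<le> (real n * step_size k)\<^sup>2 * (norm w)\<^sup>2"
        using nl t by (intro mult_right_mono power_mono) auto
      also have "\<dots> \<le> 2 * (real n * step_size k) * f v + (norm (x - v))\<^sup>2"
        unfolding w_def by (rule iterate_subgradient_bound[OF step_size_pos v])
      also have "\<dots> \<le> 2 * t * f v + (norm (x - v))\<^sup>2"
        by (intro add_right_mono mult_right_mono mult_left_mono nl nonneg v) simp
      finally show "(norm w)\<^sup>2 \<le> (2 * t * f v + (norm (x - v))\<^sup>2) / (t / 2)\<^sup>2"
        using t by (subst pos_le_divide_eq) (auto simp only: mult.commute[of "(norm w)\<^sup>2"] zero_less_power half_gt_zero_iff)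
    qed
    finally show ?thesis .
  qed
  have "norm (Y r (S t x)) \<le> C" if r: "0 < r" for r
  proof -
    have "(\<lambda>k. J r (euler k t x)) \<longlonglongrightarrow> J r (S t x)"
    proof (rule LIM_zero_cancel, rule Lim_null_comparison)
      show "(\<lambda>k. norm (euler k t x - S t x)) \<longlonglongrightarrow> 0"
        using euler_tendsto[of t x] t by (simp add: tendsto_norm_zero LIM_zero)
    qed (use J_nonexpansive[OF r] in auto)
    then have "(\<lambda>k. norm (Y r (euler k t x))) \<longlonglongrightarrow> norm (Y r (S t x))"
      unfolding Y_def using euler_tendsto[of t x] t by (intro tendsto_intros) auto
    moreover have "\<forall>\<^sub>F k in sequentially. step_size k < t / 4"
      using order_tendstoD(2)[OF step_size_tendsto, of "t / 4"] t by simp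
    then have "\<forall>\<^sub>F k in sequentially. norm (Y r (euler k t x)) \<le> C"
      by eventually_elim (use bound r in auto)
    ultimately show ?thesis by (intro tendsto_upperbound) auto
  qed
  then obtain a where "principal (S t x) a" using principal_exists by blast
  then show ?thesis by (auto simp: principal_def)
qed

end

section \<open>The Hilbert space of square-integrable functions\<close>

definition sqint :: "('a::euclidean_space \<Rightarrow> real) \<Rightarrow> bool" where
  "sqint f \<longleftrightarrow> f \<in> borel_measurable lebesgue \<and> integrable lebesgue (\<lambda>x. (f x)\<^sup>2)"

lemma sqint_measurable: "sqint f \<Longrightarrow> f \<in> borel_measurable lebesgue"
  by (simp add: sqint_def)

lemma sqint_integrable: "sqint f \<Longrightarrow> integrable lebesgue (\<lambda>x. (f x)\<^sup>2)"
  by (simp add: sqint_def)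

lemma sqint_mult_integrable:
  assumes "sqint f" "sqint g"
  shows "integrable lebesgue (\<lambda>x. f x * g x)"
proof (rule Bochner_Integration.integrable_bound)
  show "integrable lebesgue (\<lambda>x. (f x)\<^sup>2 + (g x)\<^sup>2)"
    using assms by (simp add: sqint_def)
  show "(\<lambda>x. f x * g x) \<in> borel_measurable lebesgue"
    using assms by (intro borel_measurable_times sqint_measurable)
  have "\<bar>f x * g x\<bar> \<le> (f x)\<^sup>2 + (g x)\<^sup>2" for x
  proof -
    have "2 * (\<bar>f x\<bar> * \<bar>g x\<bar>) \<le> (f x)\<^sup>2 + (g x)\<^sup>2" using sum_squares_bound[of "\<bar>f x\<bar>" "\<bar>g x\<bar>"] by simp
    moreover have "0 \<le> \<bar>f x\<bar> * \<bar>g x\<bar>" by simp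
    ultimately show ?thesis unfolding abs_mult by linarith
  qed
  then show "AE x in lebesgue. norm (f x * g x) \<le> norm ((f x)\<^sup>2 + (g x)\<^sup>2)"
    by (intro AE_I2) (simp add: sum_power2_ge_zero)
qed

lemma sqint_zero: "sqint (\<lambda>_. 0)" by (simp add: sqint_def)

lemma sqint_add:
  assumes "sqint f" "sqint g"
  shows "sqint (\<lambda>x. f x + g x)"
proof -
  have "integrable lebesgue (\<lambda>x. (f x)\<^sup>2 + (g x)\<^sup>2 + 2 * (f x * g x))"
    using assms sqint_mult_integrable[OF assms] by (simp add: sqint_def)
  then show ?thesis using assms
    by (auto simp: sqint_def power2_sum mult.assoc intro!: borel_measurable_add)
qed

lemma sqint_scale: "sqint f \<Longrightarrow> sqint (\<lambda>x. c * f x)"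
  by (auto simp: sqint_def power_mult_distrib intro!: borel_measurable_times)

lemma sqint_minus: "sqint f \<Longrightarrow> sqint (\<lambda>x. - f x)"
  by (simp add: sqint_def)

lemma sqint_diff: "sqint f \<Longrightarrow> sqint g \<Longrightarrow> sqint (\<lambda>x. f x - g x)"
  using sqint_add[of f "\<lambda>x. - g x"] sqint_minus[of g] by simp

lemma sqint_abs: "sqint f \<Longrightarrow> sqint (\<lambda>x. \<bar>f x\<bar>)"
  by (auto simp: sqint_def intro!: borel_measurable_abs)

lemma sqint_AE_cong:
  assumes "sqint f" "g \<in> borel_measurable lebesgue" "AE x in lebesgue. f x = g x"
  shows "sqint g"
proof -
  have "integrable lebesgue (\<lambda>x. (g x)\<^sup>2) \<longleftrightarrow> integrable lebesgue (\<lambda>x. (f x)\<^sup>2)"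
    using assms by (intro integrable_cong_AE) (auto simp: sqint_def)
  then show ?thesis using assms by (simp add: sqint_def)
qed

text \<open>
  Classes of square-integrable functions modulo equality almost everywhere.
\<close>

quotient_type (overloaded) 'a lsq = "'a::euclidean_space \<Rightarrow> real" / partial:
  "\<lambda>f g. sqint f \<and> sqint g \<and> (AE x in lebesgue. f x = g x)"
proof (rule part_equivpI)
  show "\<exists>f::'a \<Rightarrow> real. sqint f \<and> sqint f \<and> (AE x in lebesgue. f x = f x)"
    by (rule exI[of _ "\<lambda>_. 0"]) (simp add: sqint_zero)
  show "symp (\<lambda>f g::'a \<Rightarrow> real. sqint f \<and> sqint g \<and> (AE x in lebesgue. f x = g x))"
    by (rule sympI) (auto elim: AE_mp)
  show "transp (\<lambda>f g::'a \<Rightarrow> real. sqint f \<and> sqint g \<and> (AE x in lebesgue. f x = g x))"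
  proof (rule transpI)
    fix f g h :: "'a \<Rightarrow> real"
    assume fgh: "sqint f \<and> sqint g \<and> (AE x in lebesgue. f x = g x)"
      "sqint g \<and> sqint h \<and> (AE x in lebesgue. g x = h x)"
    from fgh(1)[THEN conjunct2, THEN conjunct2] fgh(2)[THEN conjunct2, THEN conjunct2]
    have "AE x in lebesgue. f x = h x" by eventually_elim simp
    with fgh show "sqint f \<and> sqint h \<and> (AE x in lebesgue. f x = h x)" by simp
  qed
qed

instantiation lsq :: (euclidean_space) real_vector
begin

lift_definition zero_lsq :: "'a lsq" is "\<lambda>_. 0" by (simp add: sqint_zero)

lift_definition plus_lsq :: "'a lsq \<Rightarrow> 'a lsq \<Rightarrow> 'a lsq" is "\<lambda>f g x. f x + g x"
  by (auto intro: sqint_add)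

lift_definition minus_lsq :: "'a lsq \<Rightarrow> 'a lsq \<Rightarrow> 'a lsq" is "\<lambda>f g x. f x - g x"
  by (auto intro: sqint_diff)

lift_definition uminus_lsq :: "'a lsq \<Rightarrow> 'a lsq" is "\<lambda>f x. - f x"
  by (auto intro: sqint_minus)

lift_definition scaleR_lsq :: "real \<Rightarrow> 'a lsq \<Rightarrow> 'a lsq" is "\<lambda>c f x. c * f x"
  by (auto intro: sqint_scale)

instance
  by standard (transfer, auto simp: algebra_simps intro: sqint_add sqint_diff sqint_minus sqint_scale sqint_zero)+

end

instantiation lsq :: (euclidean_space) real_inner
begin

lift_definition inner_lsq :: "'a lsq \<Rightarrow> 'a lsq \<Rightarrow> real" is "\<lambda>f g. \<integral>x. f x * g x \<partial>lebesgue"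
  by (rule integral_cong_AE) (auto intro: borel_measurable_times sqint_measurable)

definition norm_lsq :: "'a lsq \<Rightarrow> real" where "norm_lsq U = sqrt (U \<bullet> U)"
definition dist_lsq :: "'a lsq \<Rightarrow> 'a lsq \<Rightarrow> real" where "dist_lsq U V = norm (U - V)"
definition sgn_lsq :: "'a lsq \<Rightarrow> 'a lsq" where "sgn_lsq U = U /\<^sub>R norm U"
definition uniformity_lsq :: "('a lsq \<times> 'a lsq) filter" where
  "uniformity_lsq = (INF e\<in>{0<..}. principal {(x, y). dist x y < e})"
definition open_lsq :: "'a lsq set \<Rightarrow> bool" where
  "open_lsq U = (\<forall>x\<in>U. \<forall>\<^sub>F (x', y) in uniformity. x' = x \<longrightarrow> y \<in> U)"

instance
proof
  fix U V W :: "'a lsq" and c :: real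
  show "U \<bullet> V = V \<bullet> U" by transfer (simp add: mult.commute)
  show "(U + V) \<bullet> W = U \<bullet> W + V \<bullet> W"
    by transfer (simp add: distrib_right sqint_mult_integrable)
  show "(c *\<^sub>R U) \<bullet> V = c * (U \<bullet> V)" by transfer (simp add: mult.assoc)
  show "0 \<le> U \<bullet> U" by transfer simp
  show "U \<bullet> U = 0 \<longleftrightarrow> U = 0"
  proof transfer
    fix f :: "'a \<Rightarrow> real" assume f: "sqint f \<and> sqint f \<and> (AE x in lebesgue. f x = f x)"
    then have "(\<integral>x. f x * f x \<partial>lebesgue) = 0 \<longleftrightarrow> (AE x in lebesgue. f x * f x = 0)"
      using sqint_mult_integrable[of f f] by (intro integral_nonneg_eq_0_iff_AE) auto
    then show "(\<integral>x. f x * f x \<partial>lebesgue) = 0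
        \<longleftrightarrow> sqint f \<and> sqint (\<lambda>_::'a. 0) \<and> (AE x in lebesgue. f x = 0)"
      using f by (simp add: sqint_zero)
  qed
qed (rule norm_lsq_def dist_lsq_def sgn_lsq_def uniformity_lsq_def open_lsq_def)+

end

lemma sqint_rep: "sqint (rep_lsq U)"
  using Quotient3_rep_reflp[OF Quotient3_lsq, of U] by simp

lemma abs_rep: "abs_lsq (rep_lsq U) = U"
  by (rule Quotient3_abs_rep[OF Quotient3_lsq])

lemma abs_eq_iff: "sqint f \<Longrightarrow> sqint g \<Longrightarrow> abs_lsq f = abs_lsq g \<longleftrightarrow> (AE x in lebesgue. f x = g x)"
  using Quotient3_rel[OF Quotient3_lsq, of f g] by auto

lemma rep_abs: "sqint f \<Longrightarrow> AE x in lebesgue. rep_lsq (abs_lsq f) x = f x"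
  using rep_abs_rsp_left[OF Quotient3_lsq, of f f] by auto

lemma abs_add: "sqint f \<Longrightarrow> sqint g \<Longrightarrow> abs_lsq f + abs_lsq g = abs_lsq (\<lambda>x. f x + g x)"
  by (simp add: plus_lsq.abs_eq)

lemma abs_diff: "sqint f \<Longrightarrow> sqint g \<Longrightarrow> abs_lsq f - abs_lsq g = abs_lsq (\<lambda>x. f x - g x)"
  by (simp add: minus_lsq.abs_eq)

lemma abs_scaleR: "sqint f \<Longrightarrow> c *\<^sub>R abs_lsq f = abs_lsq (\<lambda>x. c * f x)"
  by (simp add: scaleR_lsq.abs_eq)

lemma inner_abs: "sqint f \<Longrightarrow> sqint g \<Longrightarrow> abs_lsq f \<bullet> abs_lsq g = (\<integral>x. f x * g x \<partial>lebesgue)"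
  by (simp add: inner_lsq.abs_eq)

lemma rep_add: "AE x in lebesgue. rep_lsq (U + V) x = rep_lsq U x + rep_lsq V x"
  using rep_abs[OF sqint_add[OF sqint_rep sqint_rep], of U V]
  by (simp add: abs_add[OF sqint_rep sqint_rep, symmetric] abs_rep)

lemma rep_scaleR: "AE x in lebesgue. rep_lsq (c *\<^sub>R U) x = c * rep_lsq U x"
  using rep_abs[OF sqint_scale[OF sqint_rep], of c U]
  by (simp add: abs_scaleR[OF sqint_rep, symmetric] abs_rep)

lemma nn_integral_square:
  assumes "sqint f"
  shows "(\<integral>\<^sup>+x. ennreal ((f x)\<^sup>2) \<partial>lebesgue) = ennreal ((norm (abs_lsq f))\<^sup>2)"
  unfolding power2_norm_eq_inner inner_abs[OF assms assms]
  by (subst nn_integral_eq_integral[OF sqint_integrable[OF assms]]) (auto simp: power2_eq_square)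

lemma sqint_of_nn_integral:
  assumes "f \<in> borel_measurable lebesgue" "(\<integral>\<^sup>+x. ennreal ((f x)\<^sup>2) \<partial>lebesgue) \<le> ennreal C"
  shows "sqint f"
proof -
  have "(\<integral>\<^sup>+x. ennreal (norm ((f x)\<^sup>2)) \<partial>lebesgue) < \<infinity>"
    using order_le_less_trans[OF assms(2) ennreal_less_top] by simp
  then show ?thesis using assms(1) by (simp add: sqint_def integrable_iff_bounded)
qed

lemma norm_le_of_nn_integral:
  assumes "f \<in> borel_measurable lebesgue" "(\<integral>\<^sup>+x. ennreal ((f x)\<^sup>2) \<partial>lebesgue) \<le> ennreal (C\<^sup>2)" "0 \<le> C"
  shows "norm (abs_lsq f) \<le> C"
proof -
  have "ennreal ((norm (abs_lsq f))\<^sup>2) \<le> ennreal (C\<^sup>2)"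
    using assms nn_integral_square[OF sqint_of_nn_integral[OF assms(1,2)]] by simp
  then have "(norm (abs_lsq f))\<^sup>2 \<le> C\<^sup>2" by (simp only: ennreal_le_iff[OF zero_le_power2])
  then show ?thesis by (rule power2_le_imp_le[OF _ assms(3)])
qed

lemma norm_abs_abs: "sqint f \<Longrightarrow> norm (abs_lsq (\<lambda>x. \<bar>f x\<bar>)) = norm (abs_lsq f)"
  using inner_abs[of f f] inner_abs[OF sqint_abs sqint_abs, of f f] by (simp add: norm_eq_sqrt_inner)

text \<open>
  Riesz--Fischer: along a subsequence with increments below \<open>(1/2)^k\<close> the increments are absolutely
  summable almost everywhere, by monotone convergence; Fatou's lemma shows that the pointwise limit is
  the limit in norm.
\<close>

instance lsq :: (euclidean_space) complete_space
proof
  fix X :: "nat \<Rightarrow> 'a lsq" assume X: "Cauchy X"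
  have "\<exists>N. \<forall>m\<ge>N. \<forall>n\<ge>N. dist (X m) (X n) < (1/2)^k" for k
    using metric_CauchyD[OF X, of "(1/2)^k"] by simp
  then obtain N where N: "\<And>k m n. N k \<le> m \<Longrightarrow> N k \<le> n \<Longrightarrow> dist (X m) (X n) < (1/2)^k" by metis
  \<comment> \<open>a monotone choice of indices with \<open>r k \<ge> N k\<close>\<close>
  define r where "r k = sum N {..k}" for k
  have r: "N k \<le> r j" if "k \<le> j" for k j
    unfolding r_def using that by (intro member_le_sum) auto
  define f where "f k = rep_lsq (X (r k))" for k
  have f: "sqint (f k)" for k unfolding f_def by (rule sqint_rep)
  have f_diff: "norm (abs_lsq (\<lambda>x. f j x - f k x)) < (1/2)^k" if "k \<le> j" for j k
    using N[of k "r j" "r k"] r[OF that] r[of k k] unfolding f_def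
    by (simp add: abs_diff[OF sqint_rep sqint_rep, symmetric] abs_rep dist_norm)
  define d where "d k x = \<bar>f (Suc k) x - f k x\<bar>" for k x
  have d: "sqint (d k)" for k unfolding d_def by (intro sqint_abs sqint_diff f)
  have d_nonneg: "0 \<le> d k x" for k x by (simp add: d_def)
  define G where "G K x = (\<Sum>k<K. d k x)" for K x
  have G: "sqint (G K) \<and> norm (abs_lsq (G K)) \<le> (\<Sum>k<K. (1/2)^k)" for K
  proof (induction K)
    case 0
    then show ?case using abs_eq_iff[OF sqint_zero sqint_zero]
      by (simp add: G_def[abs_def] sqint_zero zero_lsq.abs_eq[symmetric])
  next
    case (Suc K)
    have *: "G (Suc K) = (\<lambda>x. G K x + d K x)" by (simp add: G_def fun_eq_iff)
    have "norm (abs_lsq (d K)) \<le> (1/2)^K"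
      unfolding d_def using f_diff[of K "Suc K"] norm_abs_abs[OF sqint_diff[OF f f]] by simp
    moreover have "abs_lsq (G (Suc K)) = abs_lsq (G K) + abs_lsq (d K)"
      unfolding * using Suc d by (simp add: abs_add)
    moreover have "sqint (G (Suc K))" unfolding * using Suc d by (auto intro: sqint_add)
    ultimately show ?case using Suc norm_triangle_ineq[of "abs_lsq (G K)" "abs_lsq (d K)"] by simp
  qed
  have G_bound: "norm (abs_lsq (G K)) \<le> 2" for K
  proof -
    have "(\<Sum>k<K. (1/2::real)^k) = 2 - 2 * (1/2)^K" by (induction K) auto
    then show ?thesis using G[of K] zero_le_power[of "1/2::real" K] by linarith
  qed
  have G_meas: "G K \<in> borel_measurable lebesgue" for K
    using G sqint_measurable by blast
  have f_meas: "f k \<in> borel_measurable lebesgue" for k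
    using f sqint_measurable by blast
  have G_mono: "G K x \<le> G (Suc K) x" "0 \<le> G K x" for K x
    using d_nonneg by (auto simp: G_def sum_nonneg)
  have "(\<integral>\<^sup>+x. (SUP K. ennreal ((G K x)\<^sup>2)) \<partial>lebesgue) = (SUP K. \<integral>\<^sup>+x. ennreal ((G K x)\<^sup>2) \<partial>lebesgue)"
  proof (rule nn_integral_monotone_convergence_SUP)
    show "incseq (\<lambda>K x. ennreal ((G K x)\<^sup>2))"
      by (rule incseq_SucI) (auto simp: le_fun_def intro!: ennreal_leI power_mono G_mono)
  qed (intro measurable_compose[OF _ measurable_ennreal] borel_measurable_power G_meas)
  also have "\<dots> \<le> ennreal 4"
  proof (rule SUP_least)
    fix K
    have "(norm (abs_lsq (G K)))\<^sup>2 \<le> 2\<^sup>2" by (intro power_mono G_bound) simp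
    then show "(\<integral>\<^sup>+x. ennreal ((G K x)\<^sup>2) \<partial>lebesgue) \<le> ennreal 4"
      unfolding nn_integral_square[OF conjunct1[OF G]] by (intro ennreal_leI) simp
  qed
  finally have "(\<integral>\<^sup>+x. (SUP K. ennreal ((G K x)\<^sup>2)) \<partial>lebesgue) \<noteq> \<infinity>"
    by (auto simp: top_unique)
  then have "AE x in lebesgue. (SUP K. ennreal ((G K x)\<^sup>2)) \<noteq> \<infinity>"
    by (intro nn_integral_PInf_AE borel_measurable_SUP measurable_compose[OF _ measurable_ennreal]
        borel_measurable_power G_meas) auto
  then have conv: "AE x in lebesgue. convergent (\<lambda>k. f k x)"
  proof eventually_elim
    case (elim x)
    then obtain c where c: "(SUP K. ennreal ((G K x)\<^sup>2)) = ennreal c" "0 \<le> c"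
      by (cases "SUP K. ennreal ((G K x)\<^sup>2)") auto
    have "G K x \<le> sqrt c" for K
    proof -
      have "ennreal ((G K x)\<^sup>2) \<le> ennreal c" unfolding c(1)[symmetric] by (rule SUP_upper) simp
      then show ?thesis using c(2) by (simp add: ennreal_le_iff real_le_rsqrt)
    qed
    then have "summable (\<lambda>k. d k x)"
      using d_nonneg by (intro summableI_nonneg_bounded[of _ "sqrt c"]) (auto simp: G_def)
    then have "summable (\<lambda>k. f (Suc k) x - f k x)"
      unfolding d_def by (rule summable_rabs_cancel)
    then have "convergent (\<lambda>n. (\<Sum>k<n. f (Suc k) x - f k x) + f 0 x)"
      unfolding summable_iff_convergent by (rule convergent_add[OF _ convergent_const])
    moreover have "(\<Sum>k<n. f (Suc k) x - f k x) + f 0 x = f n x" for n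
      using sum_lessThan_telescope[of "\<lambda>k. f k x" n] by simp
    ultimately show ?case by (simp only:)
  qed
  define g where "g x = lim (\<lambda>k. f k x)" for x
  have g_meas: "g \<in> borel_measurable lebesgue"
    unfolding g_def[abs_def] by (rule borel_measurable_lim_metric) (rule f_meas)
  have lim: "AE x in lebesgue. (\<lambda>k. f k x) \<longlonglongrightarrow> g x"
    using conv by eventually_elim (simp add: g_def convergent_LIMSEQ_iff)
  have close: "(\<integral>\<^sup>+x. ennreal ((g x - f k x)\<^sup>2) \<partial>lebesgue) \<le> ennreal (((1/2)^k)\<^sup>2)" for k
  proof -
    have "(\<integral>\<^sup>+x. ennreal ((g x - f k x)\<^sup>2) \<partial>lebesgue)
        = (\<integral>\<^sup>+x. liminf (\<lambda>j. ennreal ((f j x - f k x)\<^sup>2)) \<partial>lebesgue)"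
    proof (rule nn_integral_cong_AE)
      show "AE x in lebesgue. ennreal ((g x - f k x)\<^sup>2) = liminf (\<lambda>j. ennreal ((f j x - f k x)\<^sup>2))"
        using lim
      proof eventually_elim
        case (elim x)
        have "(\<lambda>j. ennreal ((f j x - f k x)\<^sup>2)) \<longlonglongrightarrow> ennreal ((g x - f k x)\<^sup>2)"
          by (intro tendsto_ennrealI tendsto_intros elim)
        then show ?case by (rule lim_imp_Liminf[OF trivial_limit_sequentially, symmetric])
      qed
    qed
    also have "\<dots> \<le> liminf (\<lambda>j. \<integral>\<^sup>+x. ennreal ((f j x - f k x)\<^sup>2) \<partial>lebesgue)"
      by (rule nn_integral_liminf) (intro measurable_compose[OF _ measurable_ennreal]
          borel_measurable_power borel_measurable_diff f_meas)
    also have "\<dots> \<le> ennreal (((1/2)^k)\<^sup>2)"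
    proof (rule order_trans[OF Liminf_le_Limsup], simp, rule Limsup_bounded)
      show "\<forall>\<^sub>F j in sequentially. (\<integral>\<^sup>+x. ennreal ((f j x - f k x)\<^sup>2) \<partial>lebesgue) \<le> ennreal (((1/2)^k)\<^sup>2)"
        using eventually_ge_at_top[of k]
      proof eventually_elim
        case (elim j)
        show ?case
          unfolding nn_integral_square[OF sqint_diff[OF f f]]
          using f_diff[OF elim] by (intro ennreal_leI power_mono) auto
      qed
    qed
    finally show ?thesis .
  qed
  have gf: "sqint (\<lambda>x. g x - f k x)" for k
    by (rule sqint_of_nn_integral[OF _ close]) (intro borel_measurable_diff g_meas f_meas)
  have g: "sqint g" using sqint_add[OF gf[of 0] f[of 0]] by simp
  have gX: "norm (abs_lsq g - X (r k)) \<le> (1/2)^k" for k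
  proof -
    have "abs_lsq g - X (r k) = abs_lsq (\<lambda>x. g x - f k x)"
      using abs_diff[OF g f, of k] by (simp add: f_def abs_rep)
    then show ?thesis using norm_le_of_nn_integral[OF sqint_measurable[OF gf] close, of k] by simp
  qed
  have "X \<longlonglongrightarrow> abs_lsq g"
  proof (rule metric_LIMSEQ_I)
    fix e :: real assume "0 < e"
    then obtain k where k: "(1/2)^k < e / 2" using real_arch_pow_inv[of "e/2" "1/2"] by auto
    have "dist (X n) (abs_lsq g) < e" if "N k \<le> n" for n
    proof -
      have "dist (X n) (abs_lsq g) \<le> dist (X n) (X (r k)) + dist (abs_lsq g) (X (r k))"
        by (metis dist_commute dist_triangle)
      also have "\<dots> < e" using N[OF that r[OF order_refl]] gX[of k] k by (simp add: dist_norm)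
      finally show ?thesis .
    qed
    then show "\<exists>no. \<forall>n\<ge>no. dist (X n) (abs_lsq g) < e" by blast
  qed
  then show "convergent X" by (auto simp: convergent_def)
qed

lemma tendsto_AE_subseq:
  fixes X :: "nat \<Rightarrow> 'a::euclidean_space lsq"
  assumes "X \<longlonglongrightarrow> U"
  shows "\<exists>r. strict_mono r \<and> (AE x in lebesgue. (\<lambda>n. rep_lsq (X (r n)) x) \<longlonglongrightarrow> rep_lsq U x)"
proof -
  define h where "h n x = (rep_lsq (X n) x - rep_lsq U x)\<^sup>2" for n x
  have sq: "sqint (\<lambda>x. rep_lsq (X n) x - rep_lsq U x)" for n
    by (intro sqint_diff sqint_rep)
  have int: "integrable lebesgue (h n)" for n
    unfolding h_def by (rule sqint_integrable[OF sq])
  have "(\<integral>x. norm (h n x) \<partial>lebesgue) = (norm (X n - U))\<^sup>2" for n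
  proof -
    have "X n - U = abs_lsq (\<lambda>x. rep_lsq (X n) x - rep_lsq U x)"
      using abs_diff[OF sqint_rep sqint_rep, of "X n" U] by (simp add: abs_rep)
    then show ?thesis unfolding power2_norm_eq_inner
      using inner_abs[OF sq sq, of n n] by (simp add: h_def power2_eq_square)
  qed
  moreover have "(\<lambda>n. (norm (X n - U))\<^sup>2) \<longlonglongrightarrow> (norm (U - U))\<^sup>2"
    by (intro tendsto_intros assms)
  ultimately have "(\<lambda>n. \<integral>x. norm (h n x) \<partial>lebesgue) \<longlonglongrightarrow> 0" by simp
  from tendsto_L1_AE_subseq[OF int this]
  obtain r where r: "strict_mono r" "AE x in lebesgue. (\<lambda>n. h (r n) x) \<longlonglongrightarrow> 0" by blast
  have "AE x in lebesgue. (\<lambda>n. rep_lsq (X (r n)) x) \<longlonglongrightarrow> rep_lsq U x"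
    using r(2)
  proof eventually_elim
    case (elim x)
    have "(\<lambda>n. sqrt (h (r n) x)) \<longlonglongrightarrow> sqrt 0" by (intro tendsto_intros elim)
    then have "(\<lambda>n. \<bar>rep_lsq (X (r n)) x - rep_lsq U x\<bar>) \<longlonglongrightarrow> 0" by (simp add: h_def)
    then show ?case by (simp add: tendsto_rabs_zero_iff LIM_zero_iff)
  qed
  with r(1) show ?thesis by blast
qed

section \<open>Test functions\<close>

text \<open>
  Membership in \<open>C1_0\<close> is split into smoothness and support, which behave differently under products
  and compositions.
\<close>

definition C1 :: "(real^2 \<Rightarrow> 'b::real_normed_vector) \<Rightarrow> bool" where
  "C1 f \<longleftrightarrow> (\<exists>f' :: real^2 \<Rightarrow> ((real^2) \<Rightarrow>\<^sub>L 'b).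
     (\<forall>x. (f has_derivative blinfun_apply (f' x)) (at x)) \<and> continuous_on UNIV f')"

definition supported_in :: "(real^2) set \<Rightarrow> (real^2 \<Rightarrow> 'b::zero) \<Rightarrow> bool" where
  "supported_in \<Omega> f \<longleftrightarrow> (\<exists>K. compact K \<and> K \<subseteq> \<Omega> \<and> (\<forall>x. x \<notin> K \<longrightarrow> f x = 0))"

lemma C1_0_iff: "f \<in> C1_0 \<Omega> \<longleftrightarrow> C1 f \<and> supported_in \<Omega> f"
  by (simp add: C1_0_def C1_def supported_in_def)

lemma C1_I:
  assumes "\<And>x. (f has_derivative blinfun_apply (f' x)) (at x)" "continuous_on UNIV f'"
  shows "C1 f"
  using assms unfolding C1_def by blast

lemma C1_E:
  assumes "C1 f"
  obtains f' where "\<And>x. (f has_derivative blinfun_apply (f' x)) (at x)" "continuous_on UNIV f'"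
  using assms unfolding C1_def by blast

lemma C1_continuous: "C1 f \<Longrightarrow> continuous_on UNIV f"
  by (elim C1_E) (auto intro!: continuous_at_imp_continuous_on has_derivative_continuous)

lemma C1_const: "C1 (\<lambda>_. c)"
  by (rule C1_I[of _ "\<lambda>_. 0"]) (auto simp: zero_blinfun.rep_eq intro: has_derivative_const)

lemma C1_add:
  assumes "C1 f" "C1 g" shows "C1 (\<lambda>x. f x + g x)"
proof -
  obtain f' g' where "\<And>x. (f has_derivative blinfun_apply (f' x)) (at x)" "continuous_on UNIV f'"
    "\<And>x. (g has_derivative blinfun_apply (g' x)) (at x)" "continuous_on UNIV g'"
    using assms by (auto elim!: C1_E)
  then show ?thesis
    by (intro C1_I[of _ "\<lambda>x. f' x + g' x"])
       (auto simp: plus_blinfun.rep_eq intro!: has_derivative_add continuous_intros)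
qed

lemma C1_linear:
  assumes L: "bounded_linear L" and "C1 f" shows "C1 (\<lambda>x. L (f x))"
proof -
  obtain f' where f': "\<And>x. (f has_derivative blinfun_apply (f' x)) (at x)" "continuous_on UNIV f'"
    using assms by (auto elim!: C1_E)
  have "((\<lambda>x. L (f x)) has_derivative blinfun_apply (Blinfun L o\<^sub>L f' x)) (at x)" for x
    using bounded_linear.has_derivative[OF L f'(1)[of x]] L
    by (simp add: o_def blinfun_compose.rep_eq bounded_linear_Blinfun_apply)
  then show ?thesis using f'(2)
    by (intro C1_I[of _ "\<lambda>x. Blinfun L o\<^sub>L f' x"]) (auto intro!: continuous_intros)
qed

lemma C1_scaleR: "C1 f \<Longrightarrow> C1 (\<lambda>x. c *\<^sub>R f x)"
  by (rule C1_linear[OF bounded_linear_scaleR_right])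

lemma C1_coordinate: "C1 (\<lambda>x. x $ k - c)"
proof -
  have "C1 (\<lambda>x::real^2. x)"
    by (rule C1_I[of _ "\<lambda>_. id_blinfun"]) (auto simp: id_blinfun.rep_eq id_def)
  then have "C1 (\<lambda>x::real^2. x $ k)" by (rule C1_linear[OF bounded_linear_vec_nth])
  from C1_add[OF this C1_const[of "- c"]] show ?thesis by simp
qed

lemma C1_mult:
  fixes f g :: "real^2 \<Rightarrow> real"
  assumes "C1 f" "C1 g" shows "C1 (\<lambda>x. f x * g x)"
proof -
  obtain f' g' where *: "\<And>x. (f has_derivative blinfun_apply (f' x)) (at x)" "continuous_on UNIV f'"
    "\<And>x. (g has_derivative blinfun_apply (g' x)) (at x)" "continuous_on UNIV g'"
    using assms by (auto elim!: C1_E)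
  have "((\<lambda>x. f x * g x) has_derivative blinfun_apply (f x *\<^sub>R g' x + g x *\<^sub>R f' x)) (at x)" for x
    by (rule has_derivative_eq_rhs[OF has_derivative_mult[OF *(1,3)]])
       (auto simp: blinfun.add_left blinfun.scaleR_left fun_eq_iff)
  then show ?thesis
    using *(2,4) C1_continuous[OF assms(1)] C1_continuous[OF assms(2)]
    by (intro C1_I[of _ "\<lambda>x. f x *\<^sub>R g' x + g x *\<^sub>R f' x"]) (auto intro!: continuous_intros)
qed

lemma C1_compose_real:
  fixes f :: "real^2 \<Rightarrow> real" and h :: "real \<Rightarrow> real"
  assumes "C1 f" "\<And>s. (h has_real_derivative h' s) (at s)" "continuous_on UNIV h'"
  shows "C1 (\<lambda>x. h (f x))"
proof -
  obtain f' where f': "\<And>x. (f has_derivative blinfun_apply (f' x)) (at x)" "continuous_on UNIV f'"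
    using assms(1) by (auto elim!: C1_E)
  have "((\<lambda>x. h (f x)) has_derivative blinfun_apply (h' (f x) *\<^sub>R f' x)) (at x)" for x
  proof -
    have "(h has_derivative (*) (h' (f x))) (at (f x))"
      using assms(2) by (simp add: has_field_derivative_def)
    from has_derivative_compose[OF f'(1) this] show ?thesis
      by (simp add: blinfun.scaleR_left[abs_def] scaleR_blinfun.rep_eq)
  qed
  moreover have "continuous_on UNIV (\<lambda>x. h' (f x))"
    using continuous_on_compose2[OF assms(3) C1_continuous[OF assms(1)]] by simp
  ultimately show ?thesis using f'(2)
    by (intro C1_I[of _ "\<lambda>x. h' (f x) *\<^sub>R f' x"]) (auto intro!: continuous_intros)
qed

lemma supported_in_cong:
  assumes "supported_in \<Omega> f" "\<And>x. f x = 0 \<Longrightarrow> g x = 0" shows "supported_in \<Omega> g"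
  using assms unfolding supported_in_def by metis

lemma supported_in_add:
  fixes f g :: "real^2 \<Rightarrow> 'b::real_normed_vector"
  assumes "supported_in \<Omega> f" "supported_in \<Omega> g" shows "supported_in \<Omega> (\<lambda>x. f x + g x)"
proof -
  obtain K L where "compact K" "K \<subseteq> \<Omega>" "\<forall>x. x \<notin> K \<longrightarrow> f x = 0"
    "compact L" "L \<subseteq> \<Omega>" "\<forall>x. x \<notin> L \<longrightarrow> g x = 0"
    using assms unfolding supported_in_def by blast
  then show ?thesis unfolding supported_in_def by (intro exI[of _ "K \<union> L"]) auto
qed

lemma supported_in_outside: "supported_in \<Omega> f \<Longrightarrow> x \<notin> \<Omega> \<Longrightarrow> f x = 0"
  unfolding supported_in_def by blast

lemma C1_0_add: "f \<in> C1_0 \<Omega> \<Longrightarrow> g \<in> C1_0 \<Omega> \<Longrightarrow> (\<lambda>x. f x + g x) \<in> C1_0 \<Omega>"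
  by (simp add: C1_0_iff C1_add supported_in_add)

lemma C1_0_scaleR: "f \<in> C1_0 \<Omega> \<Longrightarrow> (\<lambda>x. c *\<^sub>R f x) \<in> C1_0 \<Omega>"
  by (auto simp: C1_0_iff C1_scaleR intro: supported_in_cong)

lemma C1_0_zero: "(\<lambda>_. 0) \<in> C1_0 \<Omega>"
  by (auto simp: C1_0_iff C1_const supported_in_def intro!: exI[of _ "{}"])

lemma C1_0_mult:
  fixes f g :: "real^2 \<Rightarrow> real"
  shows "f \<in> C1_0 \<Omega> \<Longrightarrow> g \<in> C1_0 \<Omega>' \<Longrightarrow> (\<lambda>x. f x * g x) \<in> C1_0 \<Omega>"
  by (auto simp: C1_0_iff C1_mult intro: supported_in_cong)

lemma C1_0_component: "z \<in> C1_0 \<Omega> \<Longrightarrow> (\<lambda>x. z x $ k) \<in> C1_0 \<Omega>"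
  by (auto simp: C1_0_iff intro: C1_linear[OF bounded_linear_vec_nth] supported_in_cong)

lemma partial_deriv_eq:
  "(f has_derivative f') (at x) \<Longrightarrow> partial_deriv k f x = f' (axis k 1)"
  unfolding partial_deriv_def by (metis frechet_derivative_at)

lemma C1_has_derivative: "C1 f \<Longrightarrow> \<exists>f'. (f has_derivative f') (at x)"
  unfolding C1_def by blast

lemma partial_deriv_component:
  assumes "C1 z" shows "partial_deriv k (\<lambda>x. z x $ j) x = partial_deriv k z x $ j"
proof -
  obtain z' where z': "(z has_derivative z') (at x)" using C1_has_derivative[OF assms] by blast
  show ?thesis
    using partial_deriv_eq[OF z'] partial_deriv_eq[OF bounded_linear.has_derivative[OF bounded_linear_vec_nth z']]
    by simp
qed

lemma partial_deriv_mult: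
  fixes f g :: "real^2 \<Rightarrow> real"
  assumes "C1 f" "C1 g"
  shows "partial_deriv k (\<lambda>x. f x * g x) x = f x * partial_deriv k g x + partial_deriv k f x * g x"
proof -
  obtain f' g' where *: "(f has_derivative f') (at x)" "(g has_derivative g') (at x)"
    using C1_has_derivative assms by meson
  show ?thesis using partial_deriv_eq[OF has_derivative_mult[OF *]] *[THEN partial_deriv_eq] by simp
qed

lemma partial_deriv_continuous:
  assumes "C1 f" shows "continuous_on UNIV (partial_deriv k f)"
proof -
  obtain f' where f': "\<And>x. (f has_derivative blinfun_apply (f' x)) (at x)" "continuous_on UNIV f'"
    using assms by (auto elim!: C1_E)
  have "partial_deriv k f = (\<lambda>x. blinfun_apply (f' x) (axis k 1))"
    using partial_deriv_eq[OF f'(1)] by auto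
  then show ?thesis using f'(2) by (auto intro!: continuous_intros)
qed

lemma supported_in_partial_deriv:
  assumes "supported_in \<Omega> f" shows "supported_in \<Omega> (partial_deriv k f)"
proof -
  obtain K where K: "compact K" "K \<subseteq> \<Omega>" "\<forall>x. x \<notin> K \<longrightarrow> f x = 0"
    using assms unfolding supported_in_def by blast
  have "partial_deriv k f x = 0" if "x \<notin> K" for x
  proof -
    have "(f has_derivative (\<lambda>_. 0)) (at x)"
    proof (rule has_derivative_transform_within_open)
      show "((\<lambda>_. 0) has_derivative (\<lambda>_. 0)) (at x)" by (rule has_derivative_const)
      show "open (- K)" using K(1) by (simp add: compact_imp_closed open_Compl)
    qed (use that K(3) in auto)
    then show ?thesis using partial_deriv_eq by fastforce
  qed
  then show ?thesis using K unfolding supported_in_def by blast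
qed

lemma supported_continuous_sqint:
  fixes g :: "real^2 \<Rightarrow> real"
  assumes "continuous_on UNIV g" "supported_in \<Omega> g"
  shows "sqint g" "integrable lebesgue g" "\<exists>B. \<forall>x. \<bar>g x\<bar> \<le> B"
proof -
  obtain K where K: "compact K" "\<forall>x. x \<notin> K \<longrightarrow> g x = 0"
    using assms(2) unfolding supported_in_def by blast
  have gm: "g \<in> borel_measurable borel" by (rule borel_measurable_continuous_onI[OF assms(1)])
  have *: "integrable lebesgue h" if "continuous_on UNIV h" "\<forall>x. x \<notin> K \<longrightarrow> h x = 0" for h :: "real^2 \<Rightarrow> real"
  proof -
    have "integrable lborel (\<lambda>x. indicator K x *\<^sub>R h x)"
      by (rule borel_integrable_compact[OF K(1)]) (use that continuous_on_subset in blast)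
    moreover have "(\<lambda>x. indicator K x *\<^sub>R h x) = h" using that(2) by (intro ext) (auto simp: indicator_def)
    ultimately show ?thesis
      using that borel_measurable_continuous_onI[of h] by (simp add: integrable_completion)
  qed
  show "integrable lebesgue g" by (rule *[OF assms(1) K(2)])
  have "integrable lebesgue (\<lambda>x. (g x)\<^sup>2)"
    by (rule *) (use K assms(1) in \<open>auto intro!: continuous_intros\<close>)
  then show "sqint g" unfolding sqint_def using gm by (simp add: measurable_completion)
  have "bounded (g ` K)"
    by (rule compact_imp_bounded[OF compact_continuous_image[OF _ K(1)]])
       (use assms(1) continuous_on_subset in blast)
  then obtain B where "\<And>x. x \<in> K \<Longrightarrow> \<bar>g x\<bar> \<le> B" by (auto simp: bounded_iff)
  then have "\<bar>g x\<bar> \<le> max B 0" for x using K(2) by (cases "x \<in> K") (auto simp: max_def, force)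
  then show "\<exists>B. \<forall>x. \<bar>g x\<bar> \<le> B" by blast
qed

lemma C1_0_sqint: "f \<in> C1_0 \<Omega> \<Longrightarrow> sqint f" for f :: "real^2 \<Rightarrow> real"
  using supported_continuous_sqint(1)[of f \<Omega>] by (simp add: C1_0_iff C1_continuous)

lemma partial_deriv_supported:
  "f \<in> C1_0 \<Omega> \<Longrightarrow> continuous_on UNIV (partial_deriv k f) \<and> supported_in \<Omega> (partial_deriv k f)"
  by (simp add: C1_0_iff partial_deriv_continuous supported_in_partial_deriv)

lemma partial_deriv_sqint: "f \<in> C1_0 \<Omega> \<Longrightarrow> sqint (partial_deriv k f)" for f :: "real^2 \<Rightarrow> real"
  using supported_continuous_sqint(1) partial_deriv_supported by blast

section \<open>Integration by parts\<close>

lemma integral_lebesgue_shift: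
  fixes g :: "real^2 \<Rightarrow> real"
  assumes "g \<in> borel_measurable borel"
  shows "(\<integral>x. g (v + x) \<partial>lebesgue) = (\<integral>x. g x \<partial>lebesgue)"
proof -
  have "(\<integral>x. g (v + x) \<partial>lebesgue) = (\<integral>x. g (v + x) \<partial>lborel)"
    using assms by (intro integral_completion) simp
  also have "\<dots> = (\<integral>x. g x \<partial>distr lborel borel ((+) v))"
    using assms by (subst integral_distr) auto
  also have "\<dots> = (\<integral>x. g x \<partial>lebesgue)"
    unfolding lborel_distr_plus using assms by (intro integral_completion[symmetric]) simp
  finally show ?thesis .
qed

text \<open>
  The difference quotients of \<open>g\<close> have integral \<open>0\<close> by translation invariance. They are bounded by
  the maximum of the derivative and vanish outside the points at distance at most \<open>1\<close> from the
  support, so dominated convergence applies.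
\<close>

lemma integral_partial_deriv:
  fixes g :: "real^2 \<Rightarrow> real"
  assumes g: "g \<in> C1_0 \<Omega>"
  shows "(\<integral>x. partial_deriv k g x \<partial>lebesgue) = 0"
proof -
  define e :: "real^2" where "e = axis k 1"
  have C: "C1 g" "supported_in \<Omega> g" using g by (auto simp: C1_0_iff)
  obtain g' where g': "\<And>x. (g has_derivative blinfun_apply (g' x)) (at x)"
    using C(1) by (auto elim!: C1_E)
  obtain B where B: "\<And>x. \<bar>partial_deriv k g x\<bar> \<le> B"
    using supported_continuous_sqint(3) partial_deriv_supported[OF g] by blast
  obtain K where K: "compact K" "\<And>x. x \<notin> K \<Longrightarrow> g x = 0"
    using C(2) unfolding supported_in_def by blast
  \<comment> \<open>contains the supports of all difference quotients, as the increments are at most \<open>1\<close>\<close>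
  define K' where "K' = {x + y |x y. x \<in> K \<and> y \<in> cball 0 1}"
  have K': "compact K'" unfolding K'_def by (rule compact_sums[OF K(1) compact_cball])
  have gm: "g \<in> borel_measurable borel"
    by (rule borel_measurable_continuous_onI[OF C1_continuous[OF C(1)]])
  have g_int: "integrable lebesgue g"
    using supported_continuous_sqint(2)[OF C1_continuous[OF C(1)] C(2)] .
  have line: "((\<lambda>t. g (t *\<^sub>R e + x)) has_real_derivative partial_deriv k g (t *\<^sub>R e + x)) (at t)" for t x
  proof -
    have "((\<lambda>t. t *\<^sub>R e + x) has_derivative (\<lambda>t. t *\<^sub>R e)) (at t)"
      by (auto intro!: derivative_eq_intros)
    from has_derivative_compose[OF this g']
    have "((\<lambda>t. g (t *\<^sub>R e + x)) has_derivative (\<lambda>h. blinfun_apply (g' (t *\<^sub>R e + x)) (h *\<^sub>R e))) (at t)" .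
    moreover have "(\<lambda>h. blinfun_apply (g' (t *\<^sub>R e + x)) (h *\<^sub>R e)) = (*) (partial_deriv k g (t *\<^sub>R e + x))"
      by (auto simp: fun_eq_iff partial_deriv_eq[OF g'] e_def blinfun.scaleR_right)
    ultimately show ?thesis by (simp add: has_field_derivative_def)
  qed
  define q where "q n x = (g (inverse (real (Suc n)) *\<^sub>R e + x) - g x) / inverse (real (Suc n))" for n x
  have qm: "q n \<in> borel_measurable borel" for n unfolding q_def using gm by measurable
  have q_bound: "\<bar>q n x\<bar> \<le> B * indicator K' x" for n x
  proof -
    define t where "t = inverse (real (Suc n))"
    have t: "0 < t" "t \<le> 1" by (auto simp: t_def inverse_le_1_iff)
    have e1: "norm e = 1" by (simp add: e_def norm_axis_1)
    show ?thesis
    proof (cases "x \<in> K'")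
      case True
      obtain s where s: "g (t *\<^sub>R e + x) - g (0 *\<^sub>R e + x) = (t - 0) * partial_deriv k g (s *\<^sub>R e + x)"
        using MVT2[OF t(1), of "\<lambda>t. g (t *\<^sub>R e + x)" "\<lambda>t. partial_deriv k g (t *\<^sub>R e + x)"] line by blast
      have "q n x = partial_deriv k g (s *\<^sub>R e + x)"
        using s t(1) unfolding q_def t_def[symmetric] by simp
      then show ?thesis using B True by simp
    next
      case False
      have "x \<notin> K"
        using False unfolding K'_def by (metis (mono_tags, lifting) add.right_neutral centre_in_cball
            mem_Collect_eq zero_le_one)
      moreover have "t *\<^sub>R e + x \<notin> K"
      proof
        assume "t *\<^sub>R e + x \<in> K"
        moreover have "- (t *\<^sub>R e) \<in> cball 0 1" using t e1 by simp
        ultimately have "(t *\<^sub>R e + x) + - (t *\<^sub>R e) \<in> K'" unfolding K'_def by blast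
        then show False using False by simp
      qed
      ultimately show ?thesis using False K(2) by (simp add: q_def t_def)
    qed
  qed
  have q_int: "(\<integral>x. q n x \<partial>lebesgue) = 0" for n
  proof -
    have gs: "integrable lebesgue (\<lambda>x. g (v + x))" for v
    proof -
      have "integrable lborel g" using g_int gm by (simp add: integrable_completion)
      then have "integrable (distr lborel borel ((+) v)) g" by (simp add: lborel_distr_plus)
      then have "integrable lborel (\<lambda>x. g (v + x))" using gm by (subst (asm) integrable_distr_eq) auto
      then show ?thesis using gm by (subst integrable_completion) auto
    qed
    show ?thesis unfolding q_def
      using gs g_int integral_lebesgue_shift[OF gm] by simp
  qed
  have "(\<lambda>n. \<integral>x. q n x \<partial>lebesgue) \<longlonglongrightarrow> (\<integral>x. partial_deriv k g x \<partial>lebesgue)"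
  proof (rule integral_dominated_convergence)
    show "partial_deriv k g \<in> borel_measurable lebesgue"
      by (rule sqint_measurable[OF partial_deriv_sqint[OF g]])
    show "q n \<in> borel_measurable lebesgue" for n using qm by (simp add: measurable_completion)
    have "integrable lborel (\<lambda>x. indicator K' x *\<^sub>R B)"
      by (rule borel_integrable_compact[OF K']) (rule continuous_on_const)
    then have "integrable lebesgue (\<lambda>x. indicator K' x *\<^sub>R B)"
      by (subst integrable_completion) (auto simp: borel_measurable_integrable)
    then show "integrable lebesgue (\<lambda>x. B * indicator K' x)" by (simp add: mult.commute)
    show "AE x in lebesgue. norm (q n x) \<le> B * indicator K' x" for n using q_bound by simp
    show "AE x in lebesgue. (\<lambda>n. q n x) \<longlonglongrightarrow> partial_deriv k g x"
    proof (rule AE_I2)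
      fix x
      have "((\<lambda>h. (g ((0 + h) *\<^sub>R e + x) - g (0 *\<^sub>R e + x)) / h) \<longlongrightarrow> partial_deriv k g x) (at 0)"
        using line[of x 0] by (simp add: DERIV_def)
      moreover have "filterlim (\<lambda>n. inverse (real (Suc n))) (at 0) sequentially"
        unfolding filterlim_at using LIMSEQ_inverse_real_of_nat by simp
      ultimately have "(\<lambda>n. (g ((0 + inverse (real (Suc n))) *\<^sub>R e + x) - g (0 *\<^sub>R e + x)) / inverse (real (Suc n)))
          \<longlonglongrightarrow> partial_deriv k g x"
        by (rule filterlim_compose)
      then show "(\<lambda>n. q n x) \<longlonglongrightarrow> partial_deriv k g x" by (simp add: q_def)
    qed
  qed
  then show ?thesis using q_int by (simp add: LIMSEQ_const_iff)
qed

lemma integration_by_parts: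
  fixes f g :: "real^2 \<Rightarrow> real"
  assumes f: "f \<in> C1_0 \<Omega>" and g: "g \<in> C1_0 \<Omega>'"
  shows "(\<integral>x. f x * partial_deriv k g x \<partial>lebesgue) = - (\<integral>x. partial_deriv k f x * g x \<partial>lebesgue)"
proof -
  have "(\<integral>x. f x * partial_deriv k g x + partial_deriv k f x * g x \<partial>lebesgue) = 0"
    using integral_partial_deriv[OF C1_0_mult[OF f g], of k] f g
    by (simp add: partial_deriv_mult C1_0_iff)
  moreover have "integrable lebesgue (\<lambda>x. f x * partial_deriv k g x)"
    "integrable lebesgue (\<lambda>x. partial_deriv k f x * g x)"
    using C1_0_sqint[OF f] C1_0_sqint[OF g] partial_deriv_sqint[OF f] partial_deriv_sqint[OF g]
    by (auto intro: sqint_mult_integrable)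
  ultimately show ?thesis by simp
qed

section \<open>The fundamental lemma of the calculus of variations\<close>

text \<open>
  The positive and the negative part of \<open>g\<close> are densities of finite measures that agree on boxes,
  and boxes form an intersection-stable generator of the Borel sets.
\<close>

lemma AE_zero_if_integral_boxes_zero:
  fixes g :: "'a::euclidean_space \<Rightarrow> real"
  assumes g: "integrable lborel g"
    and zero: "\<And>a b. (\<integral>x. indicator (box a b) x * g x \<partial>lborel) = 0"
  shows "AE x in lborel. g x = 0"
proof -
  define M1 M2 where "M1 = density lborel (\<lambda>x. ennreal (g x))" and "M2 = density lborel (\<lambda>x. ennreal (- g x))"
  have gm: "g \<in> borel_measurable lborel" using g by simp
  have fin: "(\<integral>\<^sup>+x. ennreal (g x) * indicator X x \<partial>lborel) < \<infinity>"
    "(\<integral>\<^sup>+x. ennreal (- g x) * indicator X x \<partial>lborel) < \<infinity>" for X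
  proof -
    have *: "(\<integral>\<^sup>+x. ennreal (norm (g x)) \<partial>lborel) < \<infinity>" using g by (simp add: integrable_iff_bounded)
    show "(\<integral>\<^sup>+x. ennreal (g x) * indicator X x \<partial>lborel) < \<infinity>"
      by (rule order_le_less_trans[OF nn_integral_mono *]) (auto simp: indicator_def intro!: ennreal_leI)
    show "(\<integral>\<^sup>+x. ennreal (- g x) * indicator X x \<partial>lborel) < \<infinity>"
      by (rule order_le_less_trans[OF nn_integral_mono *]) (auto simp: indicator_def intro!: ennreal_leI)
  qed
  have box_eq: "emeasure M1 (box a b) = emeasure M2 (box a b)" for a b
  proof -
    have "integrable lborel (\<lambda>x. indicator (box a b) x * g x)"
      using integrable_mult_indicator[OF _ g, of "box a b"] by simp
    from real_lebesgue_integral_def[OF this] zero[of a b]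
    have "enn2real (\<integral>\<^sup>+x. ennreal (indicator (box a b) x * g x) \<partial>lborel)
        = enn2real (\<integral>\<^sup>+x. ennreal (- (indicator (box a b) x * g x)) \<partial>lborel)" by simp
    moreover have "(\<integral>\<^sup>+x. ennreal (indicator (box a b) x * g x) \<partial>lborel) = emeasure M1 (box a b)"
      unfolding M1_def using gm by (subst emeasure_density) (auto simp: indicator_def intro!: nn_integral_cong)
    moreover have "(\<integral>\<^sup>+x. ennreal (- (indicator (box a b) x * g x)) \<partial>lborel) = emeasure M2 (box a b)"
      unfolding M2_def using gm by (subst emeasure_density) (auto simp: indicator_def intro!: nn_integral_cong)
    moreover have "emeasure M1 (box a b) < \<infinity>" "emeasure M2 (box a b) < \<infinity>"
      unfolding M1_def M2_def using gm fin by (auto simp: emeasure_density)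
    ultimately show ?thesis by (metis ennreal_enn2real infinity_ennreal_def)
  qed
  have "M1 = M2"
  proof (rule measure_eqI_generator_eq)
    let ?E = "range (\<lambda>(a, b). box a b :: 'a set)"
    show "Int_stable ?E" by (auto simp: Int_stable_def box_Int_box)
    show "?E \<subseteq> Pow UNIV" by simp
    show "emeasure M1 X = emeasure M2 X" if "X \<in> ?E" for X using that box_eq by auto
    show "sets M1 = sigma_sets UNIV ?E" "sets M2 = sigma_sets UNIV ?E"
      unfolding M1_def M2_def by (simp_all add: borel_eq_box)
    let ?A = "\<lambda>n::nat. box (- (real n *\<^sub>R One)) (real n *\<^sub>R One) :: 'a set"
    show "range ?A \<subseteq> ?E" by auto
    show "(\<Union>n. ?A n) = UNIV" unfolding UN_box_eq_UNIV by simp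
    show "emeasure M1 (?A n) \<noteq> \<infinity>" for n
      unfolding M1_def using gm fin(1)[of "?A n"] by (auto simp: emeasure_density)
  qed
  then have "AE x in lborel. ennreal (g x) = ennreal (- g x)"
    unfolding M1_def M2_def using gm by (subst (asm) sigma_finite_measure.density_unique_iff[OF lborel.sigma_finite_measure_axioms]) auto
  then show ?thesis
    by eventually_elim (metis ennreal_eq_0_iff ennreal_inj linorder_le_cases neg_0_le_iff_le neg_le_0_iff_le
        le_zero_eq add.inverse_neutral order_antisym)
qed

text \<open>
  A continuously differentiable function that vanishes on the negative axis and tends, as \<open>n\<close> grows,
  to the indicator of the positive axis.
\<close>

definition ramp :: "real \<Rightarrow> real \<Rightarrow> real" where
  "ramp n s = n * (max 0 s)\<^sup>2 / (1 + n * (max 0 s)\<^sup>2)"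

text \<open>
  The remainder of the linear approximation is at most \<open>(t - s)\<^sup>2\<close>; at \<open>s = 0\<close> the two branches of the
  function meet.
\<close>

lemma max0_sq_derivative: "((\<lambda>s::real. (max 0 s)\<^sup>2) has_real_derivative 2 * max 0 s) (at s)"
  unfolding has_field_derivative_iff
proof (rule LIM_zero_cancel, rule Lim_null_comparison)
  have "\<bar>((max 0 t)\<^sup>2 - (max 0 s)\<^sup>2) / (t - s) - 2 * max 0 s\<bar> \<le> \<bar>t - s\<bar>" if "t \<noteq> s" for t
  proof -
    have "\<bar>(max 0 t)\<^sup>2 - (max 0 s)\<^sup>2 - 2 * max 0 s * (t - s)\<bar> \<le> (t - s)\<^sup>2"
    proof -
      have st: "s * t \<le> 0" if "(0 \<le> s) \<noteq> (0 \<le> t)"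
        using that by (auto simp: mult_nonneg_nonpos mult_nonpos_nonneg)
      have sq: "0 \<le> s * s" "0 \<le> t * t" by auto
      have e2: "(t - s)\<^sup>2 = s * s - 2 * (s * t) + t * t" by (simp add: power2_eq_square algebra_simps)
      consider "0 \<le> s" "0 \<le> t" | "s < 0" "t < 0" | "0 \<le> s" "t < 0" | "s < 0" "0 \<le> t" by linarith
      then show ?thesis
      proof cases
        case 3
        have e1: "(max 0 t)\<^sup>2 - (max 0 s)\<^sup>2 - 2 * max 0 s * (t - s) = s * s - 2 * (s * t)"
          using 3 by (simp add: power2_eq_square algebra_simps)
        have "s * t \<le> 0" using st 3 by simp
        then have "\<bar>s * s - 2 * (s * t)\<bar> = s * s - 2 * (s * t)" using sq by (intro abs_of_nonneg) linarith
        then show ?thesis unfolding e1 e2 using sq by linarith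
      next
        case 4
        have e1: "(max 0 t)\<^sup>2 - (max 0 s)\<^sup>2 - 2 * max 0 s * (t - s) = t * t"
          using 4 by (simp add: power2_eq_square)
        have "s * t \<le> 0" using st 4 by simp
        then show ?thesis unfolding e1 e2 abs_of_nonneg[OF sq(2)] using sq by linarith
      next
        case 1
        then have "(max 0 t)\<^sup>2 - (max 0 s)\<^sup>2 - 2 * max 0 s * (t - s) = (t - s)\<^sup>2"
          by (simp add: power2_eq_square algebra_simps)
        then show ?thesis by simp
      qed simp
    qed
    moreover have "((max 0 t)\<^sup>2 - (max 0 s)\<^sup>2) / (t - s) - 2 * max 0 s
        = ((max 0 t)\<^sup>2 - (max 0 s)\<^sup>2 - 2 * max 0 s * (t - s)) / (t - s)"
      using that by (simp add: field_simps)
    moreover have "(t - s)\<^sup>2 = \<bar>t - s\<bar> * \<bar>t - s\<bar>" by (simp add: power2_eq_square)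
    ultimately show ?thesis using that by (simp add: abs_divide pos_divide_le_eq)
  qed
  then show "\<forall>\<^sub>F t in at s. norm (((max 0 t)\<^sup>2 - (max 0 s)\<^sup>2) / (t - s) - 2 * max 0 s) \<le> \<bar>t - s\<bar>"
    by (auto simp: eventually_at_filter)
  show "((\<lambda>t. \<bar>t - s\<bar>) \<longlongrightarrow> 0) (at s)"
    by (rule tendsto_eq_intros refl | simp)+
qed

lemma ramp_C1:
  assumes f: "C1 f" and n: "0 \<le> n" shows "C1 (\<lambda>x. ramp n (f x))"
proof (rule C1_compose_real[OF f])
  fix s
  have pos: "1 + n * (max 0 s)\<^sup>2 \<noteq> 0" using n by (smt (verit) mult_nonneg_nonneg zero_le_power2)
  show "(ramp n has_real_derivative (n * (2 * max 0 s) * (1 + n * (max 0 s)\<^sup>2) - n * (max 0 s)\<^sup>2 * (n * (2 * max 0 s)))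
      / ((1 + n * (max 0 s)\<^sup>2) * (1 + n * (max 0 s)\<^sup>2))) (at s)"
  proof -
    have 1: "((\<lambda>s. n * (max 0 s)\<^sup>2) has_real_derivative n * (2 * max 0 s)) (at s)"
      by (rule DERIV_cmult[OF max0_sq_derivative])
    have 2: "((\<lambda>s. 1 + n * (max 0 s)\<^sup>2) has_real_derivative n * (2 * max 0 s)) (at s)"
      using DERIV_add[OF DERIV_const[of 1] 1] by simp
    show ?thesis unfolding ramp_def[abs_def] by (rule DERIV_divide[OF 1 2 pos])
  qed
next
  have "1 + n * (max 0 s)\<^sup>2 \<noteq> 0" for s using n by (smt (verit) mult_nonneg_nonneg zero_le_power2)
  then show "continuous_on UNIV (\<lambda>s. (n * (2 * max 0 s) * (1 + n * (max 0 s)\<^sup>2) - n * (max 0 s)\<^sup>2 * (n * (2 * max 0 s)))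
      / ((1 + n * (max 0 s)\<^sup>2) * (1 + n * (max 0 s)\<^sup>2)))"
    by (intro continuous_intros) auto
qed

lemma ramp_bounds: "0 \<le> n \<Longrightarrow> 0 \<le> ramp n s \<and> ramp n s \<le> 1"
proof -
  assume "0 \<le> n"
  then have "0 \<le> n * (max 0 s)\<^sup>2" by simp
  then show ?thesis by (simp add: ramp_def divide_simps del: mult_eq_0_iff)
qed

lemma ramp_nonpos: "s \<le> 0 \<Longrightarrow> ramp n s = 0" by (simp add: ramp_def)

lemma ramp_tendsto:
  assumes "0 < s" shows "(\<lambda>n. ramp (real n) s) \<longlonglongrightarrow> 1"
proof -
  have "(\<lambda>n. 1 - inverse (1 + real n * s\<^sup>2)) \<longlonglongrightarrow> 1 - 0"
    using assms by (intro tendsto_intros tendsto_inverse_0_at_top filterlim_tendsto_add_at_top[OF tendsto_const]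
        filterlim_at_top_mult_tendsto_pos[OF tendsto_const _ filterlim_real_sequentially]) auto
  moreover have "1 - inverse (1 + real n * s\<^sup>2) = ramp (real n) s" for n
  proof -
    have "0 \<le> real n * s\<^sup>2" by simp
    then have "1 + real n * s\<^sup>2 \<noteq> 0" by linarith
    then show ?thesis using assms by (simp add: ramp_def max_def field_simps)
  qed
  ultimately show ?thesis by simp
qed

text \<open>
  A product of four ramps, one for each side, which tends to the indicator of the open box.
\<close>

definition bump :: "real^2 \<Rightarrow> real^2 \<Rightarrow> nat \<Rightarrow> real^2 \<Rightarrow> real" where
  "bump a b n x = (ramp n (x $ 1 - a $ 1) * ramp n (- 1 *\<^sub>R (x $ 1 - b $ 1)))
    * (ramp n (x $ 2 - a $ 2) * ramp n (- 1 *\<^sub>R (x $ 2 - b $ 2)))"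

lemma mem_box_2: "x \<in> box a b \<longleftrightarrow> a $ 1 < x $ 1 \<and> x $ 1 < b $ 1 \<and> a $ 2 < x $ 2 \<and> x $ 2 < b $ 2"
  for x :: "real^2"
  by (auto simp: mem_box_cart forall_2)

lemma bump_outside: "x \<notin> box a b \<Longrightarrow> bump a b n x = 0"
  unfolding mem_box_2 bump_def by (auto simp: ramp_nonpos not_less)

lemma bump_C1_0: "cbox a b \<subseteq> \<Omega> \<Longrightarrow> bump a b n \<in> C1_0 \<Omega>"
  unfolding C1_0_iff
proof
  show "C1 (bump a b n)" unfolding bump_def[abs_def]
    by (intro C1_mult ramp_C1 C1_scaleR C1_coordinate) auto
  assume "cbox a b \<subseteq> \<Omega>"
  then show "supported_in \<Omega> (bump a b n)"
    unfolding supported_in_def using bump_outside[of _ a b n] box_subset_cbox[of a b]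
    by (intro exI[of _ "cbox a b"]) (auto simp: compact_cbox simp del: box_subset_cbox)
qed

lemma bump_bounds: "0 \<le> bump a b n x \<and> bump a b n x \<le> 1"
  unfolding bump_def by (auto intro!: mult_nonneg_nonneg mult_le_one simp: ramp_bounds)

lemma bump_tendsto: "(\<lambda>n. bump a b n x) \<longlonglongrightarrow> indicator (box a b) x"
proof (cases "x \<in> box a b")
  case True
  have "(\<lambda>n. bump a b n x) \<longlonglongrightarrow> (1 * 1) * (1 * 1)"
    unfolding bump_def using True by (intro tendsto_intros ramp_tendsto) (auto simp: mem_box_2)
  then show ?thesis using True by simp
qed (simp add: bump_outside)

text \<open>
  Testing with bumps shows that \<open>w\<close> has integral \<open>0\<close> over every box whose closure lies in \<open>\<Omega>\<close>. Inside
  such a box this covers all smaller boxes, so \<open>w\<close> vanishes there, and countably many such boxes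
  exhaust \<open>\<Omega>\<close>.
\<close>

lemma fundamental_lemma:
  fixes w :: "real^2 \<Rightarrow> real"
  assumes "open \<Omega>" and w: "sqint w"
    and zero: "\<And>\<phi>. \<phi> \<in> C1_0 \<Omega> \<Longrightarrow> (\<integral>x. w x * \<phi> x \<partial>lebesgue) = 0"
  shows "AE x in lebesgue. x \<in> \<Omega> \<longrightarrow> w x = 0"
proof -
  obtain v where v: "v \<in> borel_measurable lborel" "AE x in lborel. w x = v x"
    using completion_ex_borel_measurable_real[OF sqint_measurable[OF w]] by blast
  have wv: "AE x in lebesgue. w x = v x" by (rule AE_completion[OF v(2)])
  have vm: "v \<in> borel_measurable lebesgue" using v(1) by (rule measurable_completion)
  have vs: "sqint v" by (rule sqint_AE_cong[OF w vm wv])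
  have ind_sq: "sqint (indicator (cbox a b) :: real^2 \<Rightarrow> real)" for a b
  proof -
    have "cbox a b \<in> sets lebesgue" "emeasure lebesgue (cbox a b) < \<infinity>"
      using lmeasurable_cbox[of a b] unfolding fmeasurable_def by auto
    then have "integrable lebesgue (indicator (cbox a b) :: real^2 \<Rightarrow> real)"
      by (rule integrable_real_indicator)
    moreover have "(\<lambda>x. (indicator (cbox a b) x)\<^sup>2) = (indicator (cbox a b) :: real^2 \<Rightarrow> real)"
      by (auto simp: indicator_def)
    ultimately show ?thesis unfolding sqint_def by (simp add: borel_measurable_integrable)
  qed
  have box_int: "integrable lborel (\<lambda>x. indicator (box a b) x * v x)" for a b
  proof -
    have "integrable lebesgue (\<lambda>x. indicator (cbox a b) x * v x)"
      by (rule sqint_mult_integrable[OF ind_sq vs])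
    then have "integrable lborel (\<lambda>x. indicator (cbox a b) x * v x)"
      using v(1) by (subst (asm) integrable_completion) auto
    then have "integrable lborel (\<lambda>x. indicator (box a b) x *\<^sub>R (indicator (cbox a b) x * v x))"
      by (intro integrable_mult_indicator) simp
    moreover have "(\<lambda>x. indicator (box a b) x *\<^sub>R (indicator (cbox a b) x * v x)) = (\<lambda>x. indicator (box a b) x * v x)"
      using box_subset_cbox[of a b] by (auto simp: indicator_def fun_eq_iff)
    ultimately show ?thesis by (simp only:)
  qed
  have box_zero: "(\<integral>x. indicator (box a b) x * v x \<partial>lborel) = 0" if ab: "cbox a b \<subseteq> \<Omega>" for a b
  proof -
    have "(\<lambda>n. \<integral>x. v x * bump a b n x \<partial>lebesgue) \<longlonglongrightarrow> (\<integral>x. v x * indicator (box a b) x \<partial>lebesgue)"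
    proof (rule integral_dominated_convergence)
      show "integrable lebesgue (\<lambda>x. \<bar>indicator (cbox a b) x * v x\<bar>)"
        by (intro integrable_abs sqint_mult_integrable ind_sq vs)
      show "AE x in lebesgue. (\<lambda>n. v x * bump a b n x) \<longlonglongrightarrow> v x * indicator (box a b) x"
        by (intro AE_I2 tendsto_intros bump_tendsto)
      have "\<bar>v x * bump a b n x\<bar> \<le> \<bar>indicator (cbox a b) x * v x\<bar>" for n x
      proof (cases "x \<in> box a b")
        case True
        then show ?thesis using bump_bounds[of a b n x] box_subset_cbox[of a b]
          by (auto simp: abs_mult indicator_def intro!: mult_left_le)
      qed (simp add: bump_outside)
      then show "AE x in lebesgue. norm (v x * bump a b n x) \<le> \<bar>indicator (cbox a b) x * v x\<bar>" for n by simp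
      show "(\<lambda>x. v x * bump a b n x) \<in> borel_measurable lebesgue" for n
        using sqint_measurable[OF C1_0_sqint[OF bump_C1_0[OF ab]]] vm by (intro borel_measurable_times)
      show "(\<lambda>x. v x * indicator (box a b) x) \<in> borel_measurable lebesgue"
        using vm by (intro borel_measurable_times borel_measurable_indicator) auto
    qed
    moreover have "(\<integral>x. v x * bump a b n x \<partial>lebesgue) = 0" for n
    proof -
      have "(\<integral>x. v x * bump a b n x \<partial>lebesgue) = (\<integral>x. w x * bump a b n x \<partial>lebesgue)"
        using wv sqint_measurable[OF C1_0_sqint[OF bump_C1_0[OF ab]]] vm sqint_measurable[OF w]
        by (intro integral_cong_AE borel_measurable_times) auto
      then show ?thesis using zero[OF bump_C1_0[OF ab]] by simp
    qed
    ultimately have "(\<integral>x. v x * indicator (box a b) x \<partial>lebesgue) = 0" by (simp add: LIMSEQ_const_iff)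
    then have "(\<integral>x. v x * indicator (box a b) x \<partial>lborel) = 0"
      using v(1) by (subst (asm) integral_completion) auto
    then show ?thesis by (simp add: mult.commute)
  qed
  have cbox_AE: "AE x in lborel. x \<in> cbox a b \<longrightarrow> v x = 0" if ab: "cbox a b \<subseteq> \<Omega>" for a b
  proof -
    have "AE x in lborel. indicator (box a b) x * v x = 0"
    proof (rule AE_zero_if_integral_boxes_zero[OF box_int])
      fix c d :: "real^2"
      obtain p q where pq: "box a b \<inter> box c d = box p q" using box_Int_box by blast
      have *: "indicator (box c d) x * (indicator (box a b) x * v x) = indicator (box p q) x * v x" for x
        unfolding pq[symmetric] by (auto simp: indicator_def)
      show "(\<integral>x. indicator (box c d) x * (indicator (box a b) x * v x) \<partial>lborel) = 0"
      proof (cases "box p q = {}")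
        case True
        then show ?thesis unfolding * by simp
      next
        case False
        then have "cbox p q = closure (box p q)" by (simp add: closure_box)
        also have "\<dots> \<subseteq> closure (cbox a b)" using pq box_subset_cbox by (intro closure_mono) blast
        also have "\<dots> \<subseteq> \<Omega>" using ab by (simp add: closure_closed)
        finally show ?thesis unfolding * by (rule box_zero)
      qed
    qed
    moreover have "AE x in lborel. x \<notin> cbox a b - box a b"
    proof -
      have "emeasure lborel (cbox a b - box a b) = 0"
        using negligible_frontier_interval[of a b] by (simp add: negligible_iff_emeasure0 emeasure_completion)
      then show ?thesis by (intro AE_not_in) (auto simp: null_sets_def)
    qed
    ultimately show ?thesis by eventually_elim (auto simp: indicator_def)
  qed
  obtain D where D: "countable D" "\<And>X. X \<in> D \<Longrightarrow> \<exists>a b. X = cbox a b" "\<Union>D = \<Omega>"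
    using open_countable_Union_open_cbox[OF \<open>open \<Omega>\<close>] by metis
  have "AE x in lborel. \<forall>X\<in>D. x \<in> X \<longrightarrow> v x = 0"
    unfolding AE_ball_countable[OF D(1)]
  proof
    fix X assume "X \<in> D"
    then show "AE x in lborel. x \<in> X \<longrightarrow> v x = 0"
      using D(2)[of X] D(3) cbox_AE by blast
  qed
  then have "AE x in lebesgue. \<forall>X\<in>D. x \<in> X \<longrightarrow> v x = 0" by (rule AE_completion)
  with wv show ?thesis by eventually_elim (use D(3) in auto)
qed

section \<open>Flows in the space of functions on an open set\<close>

lemma uminus_rep_eq: "AE x in lebesgue. rep_lsq (- U) x = - rep_lsq U x"
  using rep_scaleR[of "- 1" U] by simp

lemma norm_abs_mono:
  assumes "sqint f" "sqint g" "AE x in lebesgue. \<bar>f x\<bar> \<le> \<bar>g x\<bar>"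
  shows "norm (abs_lsq f) \<le> norm (abs_lsq g)"
proof -
  have "(\<integral>x. f x * f x \<partial>lebesgue) \<le> (\<integral>x. g x * g x \<partial>lebesgue)"
  proof (rule integral_mono_AE)
    show "AE x in lebesgue. f x * f x \<le> g x * g x"
      using assms(3) by eventually_elim (simp add: abs_le_square_iff power2_eq_square[symmetric])
  qed (intro sqint_mult_integrable assms)+
  then show ?thesis using assms(1,2) by (simp add: norm_eq_sqrt_inner inner_abs)
qed

locale open_domain =
  fixes \<Omega> :: "(real^2) set"
  assumes open_Omega: "open \<Omega>"
begin

text \<open>
  Extension by zero, an isometry of \<open>L\<^sup>2(\<Omega>)\<close> into \<open>L\<^sup>2\<close> of the plane.
\<close>

definition zero_ext :: "(real^2 \<Rightarrow> real) \<Rightarrow> (real^2) lsq" where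
  "zero_ext u = abs_lsq (\<lambda>x. indicator \<Omega> x * u x)"

lemma Omega_sets: "\<Omega> \<in> sets lebesgue"
  using open_Omega by simp

lemma L2_iff: "u \<in> L2 \<Omega> \<longleftrightarrow> sqint (\<lambda>x. indicator \<Omega> x * u x)"
proof -
  have "integrable (lebesgue_on \<Omega>) (\<lambda>x. (u x)\<^sup>2) \<longleftrightarrow> integrable lebesgue (\<lambda>x. (indicator \<Omega> x * u x)\<^sup>2)"
  proof -
    have "(\<lambda>x. indicator \<Omega> x *\<^sub>R (u x)\<^sup>2) = (\<lambda>x. (indicator \<Omega> x * u x)\<^sup>2)"
      by (auto simp: indicator_def)
    then show ?thesis using Omega_sets by (subst integrable_restrict_space) simp_all
  qed
  then show ?thesis unfolding L2_def sqint_def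
    using Omega_sets by (simp add: borel_measurable_restrict_space_iff)
qed

lemma L2_sqint: "u \<in> L2 \<Omega> \<Longrightarrow> sqint (\<lambda>x. indicator \<Omega> x * u x)"
  by (simp add: L2_iff)

lemma sqint_indicator:
  assumes "sqint f" shows "sqint (\<lambda>x. indicator \<Omega> x * f x)"
proof -
  have "integrable lebesgue (\<lambda>x. indicator \<Omega> x *\<^sub>R (f x)\<^sup>2)"
    using Omega_sets sqint_integrable[OF assms] by (rule integrable_mult_indicator)
  moreover have "(\<lambda>x. indicator \<Omega> x *\<^sub>R (f x)\<^sup>2) = (\<lambda>x. (indicator \<Omega> x * f x)\<^sup>2)"
    by (auto simp: indicator_def)
  moreover have "(\<lambda>x. indicator \<Omega> x * f x) \<in> borel_measurable lebesgue"
    using Omega_sets sqint_measurable[OF assms] by (intro borel_measurable_times borel_measurable_indicator)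
  ultimately show ?thesis by (simp add: sqint_def)
qed

lemma sqint_L2: "sqint f \<Longrightarrow> f \<in> L2 \<Omega>"
  by (simp add: L2_iff sqint_indicator)

lemma rep_L2: "rep_lsq U \<in> L2 \<Omega>"
  by (rule sqint_L2[OF sqint_rep])

lemma L2_diff: "u \<in> L2 \<Omega> \<Longrightarrow> v \<in> L2 \<Omega> \<Longrightarrow> (\<lambda>x. u x - v x) \<in> L2 \<Omega>"
  using sqint_diff[of "\<lambda>x. indicator \<Omega> x * u x" "\<lambda>x. indicator \<Omega> x * v x"]
  by (simp add: L2_iff right_diff_distrib)

lemma L2_add: "u \<in> L2 \<Omega> \<Longrightarrow> v \<in> L2 \<Omega> \<Longrightarrow> (\<lambda>x. u x + v x) \<in> L2 \<Omega>"
  using sqint_add[of "\<lambda>x. indicator \<Omega> x * u x" "\<lambda>x. indicator \<Omega> x * v x"]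
  by (simp add: L2_iff distrib_left)

lemma L2_scale: "u \<in> L2 \<Omega> \<Longrightarrow> (\<lambda>x. c * u x) \<in> L2 \<Omega>"
  using sqint_scale[of "\<lambda>x. indicator \<Omega> x * u x" c]
  by (simp add: L2_iff mult.left_commute)

lemma zero_ext_diff: "u \<in> L2 \<Omega> \<Longrightarrow> v \<in> L2 \<Omega> \<Longrightarrow> zero_ext (\<lambda>x. u x - v x) = zero_ext u - zero_ext v"
  unfolding zero_ext_def by (simp add: abs_diff L2_sqint right_diff_distrib)

lemma zero_ext_add: "u \<in> L2 \<Omega> \<Longrightarrow> v \<in> L2 \<Omega> \<Longrightarrow> zero_ext (\<lambda>x. u x + v x) = zero_ext u + zero_ext v"
  unfolding zero_ext_def by (simp add: abs_add L2_sqint distrib_left)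

lemma zero_ext_scale: "u \<in> L2 \<Omega> \<Longrightarrow> zero_ext (\<lambda>x. c * u x) = c *\<^sub>R zero_ext u"
  unfolding zero_ext_def by (simp add: abs_scaleR L2_sqint mult.left_commute)

lemma integral_on: "(\<integral>x. f x \<partial>lebesgue_on \<Omega>) = (\<integral>x. indicator \<Omega> x * f x \<partial>lebesgue)"
  for f :: "real^2 \<Rightarrow> real"
  using Omega_sets by (subst integral_restrict_space) auto

lemma L2_eq_iff: "L2_eq \<Omega> u v \<longleftrightarrow> (AE x in lebesgue. x \<in> \<Omega> \<longrightarrow> u x = v x)"
  unfolding L2_eq_def using Omega_sets by (subst AE_restrict_space_iff) auto

lemma L2_inner_zero_ext: "u \<in> L2 \<Omega> \<Longrightarrow> v \<in> L2 \<Omega> \<Longrightarrow> L2_inner \<Omega> u v = zero_ext u \<bullet> zero_ext v"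
  unfolding L2_inner_def integral_on zero_ext_def inner_abs[OF L2_sqint L2_sqint]
  by (intro Bochner_Integration.integral_cong) (auto simp: indicator_def)

lemma L2_norm_zero_ext: "u \<in> L2 \<Omega> \<Longrightarrow> L2_norm \<Omega> u = norm (zero_ext u)"
  by (simp add: L2_norm_def L2_inner_zero_ext norm_eq_sqrt_inner)

lemma zero_ext_eq_iff: "u \<in> L2 \<Omega> \<Longrightarrow> v \<in> L2 \<Omega> \<Longrightarrow> zero_ext u = zero_ext v \<longleftrightarrow> L2_eq \<Omega> u v"
  unfolding zero_ext_def L2_eq_iff abs_eq_iff[OF L2_sqint L2_sqint]
  by (intro AE_cong) (auto simp: indicator_def)

lemma rep_zero_ext:
  assumes "u \<in> L2 \<Omega>" shows "L2_eq \<Omega> (rep_lsq (zero_ext u)) u"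
  unfolding L2_eq_iff zero_ext_def using rep_abs[OF L2_sqint[OF assms]] by eventually_elim simp

lemma L2_eq_sym: "L2_eq \<Omega> u v \<Longrightarrow> L2_eq \<Omega> v u"
  unfolding L2_eq_iff by (auto elim!: eventually_mono)

lemma L2_eq_trans: "L2_eq \<Omega> u v \<Longrightarrow> L2_eq \<Omega> v w \<Longrightarrow> L2_eq \<Omega> u w"
  unfolding L2_eq_iff by (elim eventually_elim2) auto

lemma L2_norm_le: "sqint f \<Longrightarrow> L2_norm \<Omega> f \<le> norm (abs_lsq f)"
  unfolding L2_norm_zero_ext[OF sqint_L2] zero_ext_def
  by (intro norm_abs_mono sqint_indicator AE_I2) (auto simp: indicator_def)

lemma inner_zero_ext_left:
  assumes "w \<in> L2 \<Omega>" shows "zero_ext w \<bullet> V = L2_inner \<Omega> w (rep_lsq V)"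
proof -
  have "zero_ext w \<bullet> V = zero_ext w \<bullet> abs_lsq (rep_lsq V)" by (simp add: abs_rep)
  also have "\<dots> = (\<integral>x. (indicator \<Omega> x * w x) * rep_lsq V x \<partial>lebesgue)"
    unfolding zero_ext_def by (rule inner_abs[OF L2_sqint[OF assms] sqint_rep])
  finally show ?thesis by (simp add: L2_inner_def integral_on mult.assoc)
qed

lemma L2_inner_cong:
  assumes "w \<in> L2 \<Omega>" "u \<in> L2 \<Omega>" "v \<in> L2 \<Omega>" "L2_eq \<Omega> u v"
  shows "L2_inner \<Omega> w u = L2_inner \<Omega> w v"
  using assms by (simp add: L2_inner_zero_ext zero_ext_eq_iff[symmetric])

lemma L2_inner_diff:
  assumes "w \<in> L2 \<Omega>" "u \<in> L2 \<Omega>" "v \<in> L2 \<Omega>"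
  shows "L2_inner \<Omega> w (\<lambda>x. u x - v x) = L2_inner \<Omega> w u - L2_inner \<Omega> w v"
  using assms by (simp add: L2_inner_zero_ext L2_diff zero_ext_diff inner_diff_right)

lemma abs_difference_quotient:
  "abs_lsq (\<lambda>x. (rep_lsq X x - rep_lsq Z x) / h - rep_lsq W x) = (X - Z) /\<^sub>R h - W"
  "sqint (\<lambda>x. (rep_lsq X x - rep_lsq Z x) / h - rep_lsq W x)"
proof -
  have *: "sqint (\<lambda>x. rep_lsq X x - rep_lsq Z x)" by (intro sqint_diff sqint_rep)
  show "sqint (\<lambda>x. (rep_lsq X x - rep_lsq Z x) / h - rep_lsq W x)"
    using sqint_diff[OF sqint_scale[OF *, of "inverse h"] sqint_rep[of W]] by (simp add: divide_inverse mult.commute)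
  have "(X - Z) /\<^sub>R h = abs_lsq (\<lambda>x. inverse h * (rep_lsq X x - rep_lsq Z x))"
    using abs_scaleR[OF *, of "inverse h"] abs_diff[OF sqint_rep sqint_rep, of X Z] by (simp add: abs_rep)
  then have "(X - Z) /\<^sub>R h - W = abs_lsq (\<lambda>x. inverse h * (rep_lsq X x - rep_lsq Z x) - rep_lsq W x)"
    using abs_diff[OF sqint_scale[OF *, of "inverse h"] sqint_rep[of W]] by (simp add: abs_rep)
  then show "abs_lsq (\<lambda>x. (rep_lsq X x - rep_lsq Z x) / h - rep_lsq W x) = (X - Z) /\<^sub>R h - W"
    by (simp add: divide_inverse mult.commute)
qed

lemma zero_ext_difference_quotient:
  assumes "u \<in> L2 \<Omega>" "v \<in> L2 \<Omega>" "d \<in> L2 \<Omega>"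
  shows "zero_ext (\<lambda>x. (u x - v x) / h - d x) = (zero_ext u - zero_ext v) /\<^sub>R h - zero_ext d"
    "(\<lambda>x. (u x - v x) / h - d x) \<in> L2 \<Omega>"
  using assms zero_ext_diff[OF L2_scale[OF L2_diff[OF assms(1,2)], of "inverse h"] assms(3)]
    L2_diff[OF L2_scale[OF L2_diff[OF assms(1,2)], of "inverse h"] assms(3)]
  by (simp_all add: zero_ext_scale L2_diff zero_ext_diff divide_inverse mult.commute)

end

text \<open>
  A functional on \<open>L\<^sup>2(\<Omega>)\<close> becomes one on \<open>L\<^sup>2\<close> of the plane by restriction to \<open>\<Omega>\<close>, and the flow is
  constructed for the latter.
\<close>

locale L2_energy = open_domain +
  fixes F :: "(real^2 \<Rightarrow> real) \<Rightarrow> ereal"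
  assumes F_nonneg: "0 \<le> F u"
    and F_cong: "u \<in> L2 \<Omega> \<Longrightarrow> v \<in> L2 \<Omega> \<Longrightarrow> L2_eq \<Omega> u v \<Longrightarrow> F u = F v"
    and F_energy: "convex_energy {U. F (rep_lsq U) < \<infinity>} (\<lambda>U. real_of_ereal (F (rep_lsq U)))"
begin

abbreviation "D \<equiv> {U. F (rep_lsq U) < \<infinity>}"
abbreviation "f \<equiv> \<lambda>U. real_of_ereal (F (rep_lsq U))"

sublocale flow: convex_energy D f by (rule F_energy)

lemma F_real: "F u < \<infinity> \<Longrightarrow> F u = ereal (real_of_ereal (F u))"
  using F_nonneg[of u] by (cases "F u") auto

text \<open>
  A competitor \<open>v\<close> on \<open>\<Omega>\<close> is extended to the plane by the values of \<open>U\<close>, so that the two subgradient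
  inequalities are about the same increment.
\<close>

lemma subdiff_of_subgradient:
  assumes W: "W \<in> subgradients D f U"
  shows "rep_lsq W \<in> subdiff \<Omega> F (rep_lsq U)"
proof -
  have U: "F (rep_lsq U) < \<infinity>" using W by (simp add: subgradients_def)
  have "F (rep_lsq U) + ereal (L2_inner \<Omega> (rep_lsq W) (\<lambda>x. v x - rep_lsq U x)) \<le> F v"
    if v: "v \<in> L2 \<Omega>" for v
  proof (cases "F v < \<infinity>")
    case True
    \<comment> \<open>equal to \<open>v\<close> on \<open>\<Omega>\<close> and to \<open>U\<close> outside\<close>
    define V where "V = U + zero_ext (\<lambda>x. v x - rep_lsq U x)"
    have diff: "(\<lambda>x. v x - rep_lsq U x) \<in> L2 \<Omega>" by (rule L2_diff[OF v rep_L2])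
    have "L2_eq \<Omega> (rep_lsq V) v"
      using rep_add[of U "zero_ext (\<lambda>x. v x - rep_lsq U x)"] rep_zero_ext[OF diff]
      unfolding L2_eq_iff V_def by eventually_elim auto
    then have FV: "F (rep_lsq V) = F v" by (rule F_cong[OF rep_L2 v])
    then have "V \<in> D" using True by simp
    then have "f U + W \<bullet> (V - U) \<le> f V" using W unfolding subgradients_def by blast
    moreover have "W \<bullet> (V - U) = L2_inner \<Omega> (rep_lsq W) (\<lambda>x. v x - rep_lsq U x)"
      unfolding V_def using inner_zero_ext_left[OF diff, of W]
      by (simp add: inner_commute[of W] L2_inner_def mult.commute)
    ultimately have "ereal (f U + L2_inner \<Omega> (rep_lsq W) (\<lambda>x. v x - rep_lsq U x)) \<le> ereal (f V)"
      by (simp only: ereal_less_eq(3))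
    then show ?thesis using F_real[OF U] F_real[OF True] FV by (metis plus_ereal.simps(1))
  qed (simp add: not_less top_unique)
  then show ?thesis using U rep_L2 by (simp add: subdiff_def)
qed

text \<open>
  \<open>U\<close> may have any values outside \<open>\<Omega>\<close>: the functional does not see them, and \<open>zero_ext w\<close> is
  orthogonal to whatever happens there.
\<close>

lemma subgradient_of_subdiff:
  assumes w: "w \<in> subdiff \<Omega> F u" and U: "L2_eq \<Omega> u (rep_lsq U)"
  shows "zero_ext w \<in> subgradients D f U"
  unfolding subgradients_def
proof (intro CollectI conjI ballI)
  have wL: "w \<in> L2 \<Omega>" and uL: "u \<in> L2 \<Omega>" and Fu: "F u < \<infinity>" using w by (auto simp: subdiff_def)
  have FU: "F (rep_lsq U) = F u" by (rule F_cong[OF rep_L2 uL L2_eq_sym[OF U]])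
  then show "F (rep_lsq U) < \<infinity>" using Fu by simp
  fix V assume V: "V \<in> D"
  have "F u + ereal (L2_inner \<Omega> w (\<lambda>x. rep_lsq V x - u x)) \<le> F (rep_lsq V)"
    using w rep_L2[of V] by (auto simp: subdiff_def)
  moreover have "L2_inner \<Omega> w (\<lambda>x. rep_lsq V x - u x) = zero_ext w \<bullet> (V - U)"
    using L2_inner_diff[OF wL rep_L2[of V] uL] L2_inner_cong[OF wL uL rep_L2 U]
    by (simp add: inner_diff_right inner_zero_ext_left[OF wL])
  ultimately have "ereal (f U + zero_ext w \<bullet> (V - U)) \<le> ereal (f V)"
    using F_real[OF Fu] F_real[of "rep_lsq V"] V FU by (metis mem_Collect_eq plus_ereal.simps(1))
  then show "f U + zero_ext w \<bullet> (V - U) \<le> f V" by (simp only: ereal_less_eq(3))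
qed

text \<open>
  Extension by zero turns any solution on \<open>\<Omega>\<close> into a flow of the subgradients in the plane, to which
  uniqueness in the Hilbert space applies.
\<close>

lemma solution_lift:
  assumes v: "is_solution \<Omega> (subdiff \<Omega> F) u0 v"
  shows "continuous_on {0..} (\<lambda>t. zero_ext (v t))"
    and "\<And>t. 0 < t \<Longrightarrow> \<exists>a\<in>subgradients D f (zero_ext (v t)).
      ((\<lambda>h. (zero_ext (v (t + h)) - zero_ext (v t)) /\<^sub>R h) \<longlongrightarrow> - a) (at_right 0)"
proof -
  have vL: "v t \<in> L2 \<Omega>" if "0 \<le> t" for t using v that by (simp add: is_solution_def)
  show "continuous_on {0..} (\<lambda>t. zero_ext (v t))"
    unfolding continuous_on_def
  proof
    fix t :: real assume t: "t \<in> {0..}"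
    have "((\<lambda>s. L2_norm \<Omega> (\<lambda>x. v s x - v t x)) \<longlongrightarrow> 0) (at t within {0..})"
      using v t by (simp add: is_solution_def)
    moreover have "\<forall>\<^sub>F s in at t within {0..}. L2_norm \<Omega> (\<lambda>x. v s x - v t x) = norm (zero_ext (v s) - zero_ext (v t))"
      unfolding eventually_at_filter using t
      by (intro always_eventually) (auto simp: L2_norm_zero_ext L2_diff zero_ext_diff vL)
    ultimately have "((\<lambda>s. norm (zero_ext (v s) - zero_ext (v t))) \<longlongrightarrow> 0) (at t within {0..})"
      by (rule Lim_transform_eventually)
    then show "((\<lambda>s. zero_ext (v s)) \<longlongrightarrow> zero_ext (v t)) (at t within {0..})"
      by (rule LIM_zero_cancel[OF tendsto_norm_zero_cancel])
  qed
  fix t :: real assume t: "0 < t"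
  obtain d a where d: "has_right_deriv_L2 \<Omega> v d t" and a: "a \<in> subdiff \<Omega> F (v t)"
    and da: "L2_eq \<Omega> (\<lambda>x. d x + a x) (\<lambda>x. 0)"
    using v t unfolding is_solution_def by blast
  have dL: "d \<in> L2 \<Omega>" using d by (simp add: has_right_deriv_L2_def)
  have aL: "a \<in> L2 \<Omega>" using a by (simp add: subdiff_def)
  have "zero_ext (\<lambda>x. d x + a x) = zero_ext (\<lambda>x. 0)"
    using da zero_ext_eq_iff[OF L2_add[OF dL aL] sqint_L2[OF sqint_zero]] by simp
  also have "\<dots> = 0" by (simp add: zero_ext_def zero_lsq.abs_eq)
  finally have "zero_ext d = - zero_ext a" by (simp add: zero_ext_add dL aL eq_neg_iff_add_eq_0)
  moreover have "((\<lambda>h. (zero_ext (v (t + h)) - zero_ext (v t)) /\<^sub>R h) \<longlongrightarrow> zero_ext d) (at_right 0)"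
  proof (rule LIM_zero_cancel, rule tendsto_norm_zero_cancel)
    have "((\<lambda>h. L2_norm \<Omega> (\<lambda>x. (v (t + h) x - v t x) / h - d x)) \<longlongrightarrow> 0) (at_right 0)"
      using d by (simp add: has_right_deriv_L2_def)
    moreover have "\<forall>\<^sub>F h in at_right 0. L2_norm \<Omega> (\<lambda>x. (v (t + h) x - v t x) / h - d x)
        = norm ((zero_ext (v (t + h)) - zero_ext (v t)) /\<^sub>R h - zero_ext d)"
      unfolding eventually_at_right_field
      using t by (auto intro!: exI[of _ 1] simp: L2_norm_zero_ext zero_ext_difference_quotient vL dL)
    ultimately show "((\<lambda>h. norm ((zero_ext (v (t + h)) - zero_ext (v t)) /\<^sub>R h - zero_ext d)) \<longlongrightarrow> 0) (at_right 0)"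
      by (rule Lim_transform_eventually)
  qed
  moreover have "zero_ext a \<in> subgradients D f (zero_ext (v t))"
    using t vL by (intro subgradient_of_subdiff[OF a] L2_eq_sym[OF rep_zero_ext]) auto
  ultimately show "\<exists>a\<in>subgradients D f (zero_ext (v t)).
      ((\<lambda>h. (zero_ext (v (t + h)) - zero_ext (v t)) /\<^sub>R h) \<longlongrightarrow> - a) (at_right 0)" by auto
qed

theorem well_posed:
  assumes u0: "u0 \<in> L2 \<Omega>" and A: "A = subdiff \<Omega> F"
  shows "\<exists>u. is_solution \<Omega> A u0 u \<and>
             (\<forall>v. is_solution \<Omega> A u0 v \<longrightarrow> (\<forall>t\<ge>0. L2_eq \<Omega> (v t) (u t))) \<and>
             (\<forall>t>0. u t \<in> op_domain \<Omega> A \<and>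
                    (\<exists>d. has_right_deriv_L2 \<Omega> u d t \<and>
                         (\<exists>a\<in>minimal_section \<Omega> A (u t). L2_eq \<Omega> (\<lambda>x. d x + a x) (\<lambda>x. 0))))"
proof -
  obtain U where U0: "U 0 = zero_ext u0" and U_cont: "continuous_on {0..} U"
    and U_lip: "\<And>\<delta>. 0 < \<delta> \<Longrightarrow> \<exists>L. \<forall>s\<ge>\<delta>. \<forall>t\<ge>\<delta>. norm (U s - U t) \<le> L * \<bar>s - t\<bar>"
    and U_flow: "\<And>t. 0 < t \<Longrightarrow> \<exists>a\<in>subgradients D f (U t). (\<forall>w\<in>subgradients D f (U t). norm a \<le> norm w) \<and>
       ((\<lambda>h. (U (t + h) - U t) /\<^sub>R h) \<longlongrightarrow> - a) (at_right 0)"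
    using flow.generation[OF flow.S_in_domain, of "zero_ext u0"] by blast
  define u where "u t = rep_lsq (U t)" for t
  have uL: "u t \<in> L2 \<Omega>" for t unfolding u_def by (rule rep_L2)
  have u_dist: "L2_norm \<Omega> (\<lambda>x. u s x - u t x) \<le> norm (U s - U t)" for s t
    using L2_norm_le[OF sqint_diff[OF sqint_rep sqint_rep], of "U s" "U t"]
      abs_diff[OF sqint_rep sqint_rep, of "U s" "U t"] by (simp add: abs_rep u_def)
  have norm_nonneg: "0 \<le> L2_norm \<Omega> g" if "g \<in> L2 \<Omega>" for g
    using that by (simp add: L2_norm_zero_ext)
  have flow: "\<exists>d. has_right_deriv_L2 \<Omega> u d t \<and>
      (\<exists>a\<in>minimal_section \<Omega> A (u t). L2_eq \<Omega> (\<lambda>x. d x + a x) (\<lambda>x. 0))" if t: "0 < t" for t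
  proof -
    obtain a where a: "a \<in> subgradients D f (U t)" and min: "\<And>w. w \<in> subgradients D f (U t) \<Longrightarrow> norm a \<le> norm w"
      and der: "((\<lambda>h. (U (t + h) - U t) /\<^sub>R h) \<longlongrightarrow> - a) (at_right 0)"
      using U_flow[OF t] by blast
    have "has_right_deriv_L2 \<Omega> u (rep_lsq (- a)) t"
      unfolding has_right_deriv_L2_def
    proof
      show "rep_lsq (- a) \<in> L2 \<Omega>" by (rule rep_L2)
      have "((\<lambda>h. norm ((U (t + h) - U t) /\<^sub>R h - - a)) \<longlongrightarrow> 0) (at_right 0)"
        using der by (intro tendsto_norm_zero LIM_zero)
      then show "((\<lambda>h. L2_norm \<Omega> (\<lambda>x. (u (t + h) x - u t x) / h - rep_lsq (- a) x)) \<longlongrightarrow> 0) (at_right 0)"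
      proof (rule Lim_null_comparison[rotated], intro always_eventually allI)
        fix h
        show "norm (L2_norm \<Omega> (\<lambda>x. (u (t + h) x - u t x) / h - rep_lsq (- a) x))
            \<le> norm ((U (t + h) - U t) /\<^sub>R h - - a)"
          using L2_norm_le[OF abs_difference_quotient(2)[of "U (t + h)" "U t" h "- a"]]
            norm_nonneg[OF sqint_L2[OF abs_difference_quotient(2)[of "U (t + h)" "U t" h "- a"]]]
          unfolding abs_difference_quotient(1) u_def by simp
      qed
    qed
    moreover have "rep_lsq a \<in> minimal_section \<Omega> A (u t)"
      unfolding minimal_section_def
    proof (intro CollectI conjI ballI)
      show "rep_lsq a \<in> A (u t)" unfolding A u_def by (rule subdiff_of_subgradient[OF a])
      fix w assume w: "w \<in> A (u t)"
      then have "zero_ext w \<in> subgradients D f (U t)"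
        unfolding A by (rule subgradient_of_subdiff) (simp add: u_def L2_eq_def)
      then have "norm a \<le> L2_norm \<Omega> w"
        using min w by (auto simp: A subdiff_def L2_norm_zero_ext)
      moreover have "L2_norm \<Omega> (rep_lsq a) \<le> norm a"
        using L2_norm_le[OF sqint_rep, of a] by (simp add: abs_rep)
      ultimately show "L2_norm \<Omega> (rep_lsq a) \<le> L2_norm \<Omega> w" by simp
    qed
    moreover have "L2_eq \<Omega> (\<lambda>x. rep_lsq (- a) x + rep_lsq a x) (\<lambda>x. 0)"
      unfolding L2_eq_iff using uminus_rep_eq[of a] by eventually_elim simp
    ultimately show ?thesis by blast
  qed
  have sol: "is_solution \<Omega> A u0 u"
    unfolding is_solution_def
  proof (intro conjI allI impI)
    show "u t \<in> L2 \<Omega>" for t by (rule uL)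
    fix t :: real assume t: "0 \<le> t"
    have "(U \<longlongrightarrow> U t) (at t within {0..})" using U_cont t by (simp add: continuous_on_def)
    then have "((\<lambda>s. norm (U s - U t)) \<longlongrightarrow> 0) (at t within {0..})"
      by (intro tendsto_norm_zero LIM_zero)
    then show "((\<lambda>s. L2_norm \<Omega> (\<lambda>x. u s x - u t x)) \<longlongrightarrow> 0) (at t within {0..})"
      by (rule Lim_null_comparison[rotated])
         (use u_dist norm_nonneg[OF L2_diff[OF uL uL]] in auto)
  next
    fix \<delta> :: real assume "0 < \<delta>"
    then obtain L where "\<forall>s\<ge>\<delta>. \<forall>t\<ge>\<delta>. norm (U s - U t) \<le> L * \<bar>s - t\<bar>" using U_lip by blast
    then show "\<exists>L. \<forall>s\<ge>\<delta>. \<forall>t\<ge>\<delta>. L2_norm \<Omega> (\<lambda>x. u s x - u t x) \<le> L * \<bar>s - t\<bar>"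
      using u_dist order_trans by blast
  next
    fix t :: real assume t: "0 < t"
    show "\<exists>d. has_right_deriv_L2 \<Omega> u d t \<and> (\<exists>a\<in>A (u t). L2_eq \<Omega> (\<lambda>x. d x + a x) (\<lambda>x. 0))"
      using flow[OF t] by (auto simp: minimal_section_def)
  next
    show "L2_eq \<Omega> (u 0) u0" unfolding u_def U0 by (rule rep_zero_ext[OF u0])
  qed
  have unique: "L2_eq \<Omega> (v t) (u t)" if v: "is_solution \<Omega> A u0 v" and t: "0 \<le> t" for v t
  proof -
    have v0: "v 0 \<in> L2 \<Omega>" "L2_eq \<Omega> (v 0) u0" and vt: "v t \<in> L2 \<Omega>"
      using v t by (auto simp: is_solution_def)
    have "zero_ext (v t) = U t"
    proof (rule flow.flow_unique[OF _ U_cont _ _ _ t])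
      show "continuous_on {0..} (\<lambda>t. zero_ext (v t))" using solution_lift(1) v A by blast
      show "zero_ext (v 0) = U 0" using U0 v0 u0 by (simp add: zero_ext_eq_iff)
      show "\<exists>a\<in>subgradients D f (zero_ext (v s)).
          ((\<lambda>h. (zero_ext (v (s + h)) - zero_ext (v s)) /\<^sub>R h) \<longlongrightarrow> - a) (at_right 0)" if "0 < s" for s
        using solution_lift(2) v A that by blast
      show "\<exists>a\<in>subgradients D f (U s). ((\<lambda>h. (U (s + h) - U s) /\<^sub>R h) \<longlongrightarrow> - a) (at_right 0)" if "0 < s" for s
        using U_flow[OF that] by blast
    qed
    then show ?thesis unfolding u_def using L2_eq_sym[OF rep_zero_ext[OF vt]] by simp
  qed
  show ?thesis
  proof (intro exI[of _ u] conjI allI impI)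
    show "u t \<in> op_domain \<Omega> A" if "0 < t" for t
      using flow[OF that] uL by (auto simp: op_domain_def minimal_section_def)
  qed (use sol unique flow in blast)+
qed

end

section \<open>The two functionals\<close>

lemma norm_midpoint:
  fixes a b x :: "'h::real_inner"
  shows "(norm ((1/2) *\<^sub>R (a + b) - x))\<^sup>2 = ((norm (a - x))\<^sup>2 + (norm (b - x))\<^sup>2) / 2 - (norm (a - b))\<^sup>2 / 4"
proof -
  define p q where "p = a - x" and "q = b - x"
  have "(1/2) *\<^sub>R (a + b) - x = (1/2) *\<^sub>R (p + q)"
    by (simp add: p_def q_def scaleR_add_right scaleR_diff_right field_simps flip: scaleR_add_left)
  moreover have "a - b = p - q" by (simp add: p_def q_def)
  moreover have "(norm ((1/2) *\<^sub>R (p + q)))\<^sup>2 = ((norm p)\<^sup>2 + (norm q)\<^sup>2) / 2 - (norm (p - q))\<^sup>2 / 4"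
    unfolding power2_norm_eq_inner
    by (simp add: inner_add_left inner_add_right inner_diff_left inner_diff_right inner_commute field_simps)
  ultimately show ?thesis by (simp only: p_def[symmetric] q_def[symmetric])
qed

lemma prox_midpoint:
  fixes a b x :: "'h::real_inner"
  assumes "0 < l"
  shows "(norm ((1/2) *\<^sub>R (a + b) - x))\<^sup>2 / (2 * l)
    = ((norm (a - x))\<^sup>2 / (2 * l) + (norm (b - x))\<^sup>2 / (2 * l)) / 2 - (1 / (8 * l)) * (norm (a - b))\<^sup>2"
  unfolding norm_midpoint using assms by (simp add: field_simps)

text \<open>
  The projection onto the closure of \<open>T\<close> is a proximal point of the zero functional on it, and the
  subgradient inequality makes the projection error orthogonal to \<open>T\<close>.
\<close>

lemma dense_if_orthogonal_trivial:
  fixes T :: "'h::{real_inner, complete_space} set"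
  assumes T: "subspace T" and orth: "\<And>w. (\<And>t. t \<in> T \<Longrightarrow> w \<bullet> t = 0) \<Longrightarrow> w = 0"
  shows "closure T = UNIV"
proof -
  have "x \<in> closure T" for x
  proof -
    have cv: "convex (closure T)" using T by (intro convex_closure subspace_imp_convex)
    have "\<exists>y\<in>closure T. \<forall>v\<in>closure T. (norm (y - x))\<^sup>2 / (2 * 1) + 0 \<le> (norm (v - x))\<^sup>2 / (2 * 1) + 0"
    proof (rule minimiser_exists[where c = "1/8"])
      show "closure T \<noteq> {}" using subspace_0[OF T] by auto
      show "(1/2) *\<^sub>R (a + b) \<in> closure T" if "a \<in> closure T" "b \<in> closure T" for a b
        using convexD[OF cv that, of "1/2" "1/2"] by (simp add: scaleR_add_right)
      show "(norm ((1/2) *\<^sub>R (a + b) - x))\<^sup>2 / (2 * 1)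
          \<le> ((norm (a - x))\<^sup>2 / (2 * 1) + (norm (b - x))\<^sup>2 / (2 * 1)) / 2 - 1 / 8 * (norm (a - b))\<^sup>2" for a b
        using prox_midpoint[of 1 a b x] by simp
      show "closed {x \<in> closure T. (0::real) \<le> r}" for r
        by (cases "0 \<le> r") auto
    qed (auto intro!: continuous_intros)
    then obtain y where y: "y \<in> closure T"
      and min: "\<And>v. v \<in> closure T \<Longrightarrow> (norm (y - x))\<^sup>2 / (2 * 1) \<le> (norm (v - x))\<^sup>2 / (2 * 1)" by auto
    have "convex_on (closure T) (\<lambda>_. 0::real)" using cv by (simp add: convex_on_def)
    from subgradient_of_minimiser[OF this zero_less_one y, of x] min
    have w: "(x - y) \<bullet> (v - y) \<le> 0" if "v \<in> closure T" for v
      using that by (simp add: subgradients_def)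
    have shift: "y + t \<in> closure T" if t: "t \<in> T" for t
    proof -
      obtain z where z: "\<And>n. z n \<in> T" "z \<longlonglongrightarrow> y" using y by (auto simp: closure_sequential)
      have "(\<lambda>n. z n + t) \<longlonglongrightarrow> y + t" by (intro tendsto_intros z)
      moreover have "z n + t \<in> T" for n using z(1) t T by (simp add: subspace_add)
      ultimately show ?thesis unfolding closure_sequential by (intro exI[of _ "\<lambda>n. z n + t"]) simp
    qed
    have "(x - y) \<bullet> t = 0" if "t \<in> T" for t
      using w[OF shift[OF that]] w[OF shift[OF subspace_neg[OF T that]]] by simp
    then have "x - y = 0" by (rule orth)
    then show ?thesis using y by simp
  qed
  then show ?thesis by auto
qed

text \<open>
  A supremum of continuous linear functionals has closed convex sublevel sets, being intersections of
  half-spaces, so the proximal problems are solvable.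
\<close>

lemma support_function_energy:
  fixes G :: "'h::{real_inner, complete_space} set" and \<Psi> :: "'h \<Rightarrow> ereal"
  assumes \<Psi>: "\<And>U. \<Psi> U = (SUP g\<in>G. ereal (U \<bullet> g))" and "0 \<in> G" and dense: "closure {U. \<Psi> U < \<infinity>} = UNIV"
  shows "convex_energy {U. \<Psi> U < \<infinity>} (\<lambda>U. real_of_ereal (\<Psi> U))"
proof -
  define D f where "D = {U. \<Psi> U < \<infinity>}" and "f U = real_of_ereal (\<Psi> U)" for U
  have le_iff: "\<Psi> U \<le> ereal r \<longleftrightarrow> (\<forall>g\<in>G. U \<bullet> g \<le> r)" for U r
    unfolding \<Psi> by (simp add: SUP_le_iff)
  have nonneg: "0 \<le> \<Psi> U" for U
    unfolding \<Psi> by (rule SUP_upper2[OF \<open>0 \<in> G\<close>]) (simp add: zero_ereal_def)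
  have \<Psi>_f: "\<Psi> U = ereal (f U)" if "U \<in> D" for U
    using nonneg[of U] that by (cases "\<Psi> U") (auto simp: D_def f_def)
  have f_le: "U \<in> D \<and> f U \<le> r \<longleftrightarrow> (\<forall>g\<in>G. U \<bullet> g \<le> r)" for U r
  proof
    assume "U \<in> D \<and> f U \<le> r"
    then have "\<Psi> U \<le> ereal r" using \<Psi>_f by simp
    then show "\<forall>g\<in>G. U \<bullet> g \<le> r" by (simp add: le_iff)
  next
    assume "\<forall>g\<in>G. U \<bullet> g \<le> r"
    then have *: "\<Psi> U \<le> ereal r" by (simp add: le_iff)
    then have "U \<in> D" by (auto simp: D_def)
    with * show "U \<in> D \<and> f U \<le> r" using \<Psi>_f by simp
  qed
  have inner_le: "U \<bullet> g \<le> f U" if "U \<in> D" "g \<in> G" for U g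
    using f_le[of U "f U"] that by simp
  have comb: "a *\<^sub>R U + b *\<^sub>R V \<in> D \<and> f (a *\<^sub>R U + b *\<^sub>R V) \<le> a * f U + b * f V"
    if "U \<in> D" "V \<in> D" "0 \<le> a" "0 \<le> b" for U V a b
    unfolding f_le using that inner_le
    by (auto simp: inner_add_left intro!: add_mono mult_left_mono)
  have conv: "convex_on D f"
    unfolding convex_on_def convex_def using comb by blast
  have f_nonneg: "0 \<le> f U" if "U \<in> D" for U using inner_le[OF that \<open>0 \<in> G\<close>] by simp
  have "0 \<in> D" using f_le[of 0 0] by simp
  have "convex_energy D f"
  proof
    show "convex_on D f" by (rule conv)
    show "0 \<le> f U" if "U \<in> D" for U by (rule f_nonneg[OF that])
    show "closure D = UNIV" using dense by (simp add: D_def)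
    fix l :: real and x :: 'h assume l: "0 < l"
    have "\<exists>y\<in>D. \<forall>v\<in>D. (norm (y - x))\<^sup>2 / (2 * l) + f y \<le> (norm (v - x))\<^sup>2 / (2 * l) + f v"
    proof (rule minimiser_exists[where c = "1 / (8 * l)"])
      show "D \<noteq> {}" using \<open>0 \<in> D\<close> by auto
      fix a b assume "a \<in> D" "b \<in> D"
      then show "(1/2) *\<^sub>R (a + b) \<in> D" "f ((1/2) *\<^sub>R (a + b)) \<le> (f a + f b) / 2"
        using comb[of a b "1/2" "1/2"] by (simp_all add: scaleR_add_right)
    next
      show "(norm ((1/2) *\<^sub>R (a + b) - x))\<^sup>2 / (2 * l)
          \<le> ((norm (a - x))\<^sup>2 / (2 * l) + (norm (b - x))\<^sup>2 / (2 * l)) / 2 - 1 / (8 * l) * (norm (a - b))\<^sup>2" for a b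
        using prox_midpoint[OF l, of a b x] by simp
      have "closed {U. U \<bullet> g \<le> r}" for g and r :: real
        by (intro closed_Collect_le continuous_intros)
      then have "closed (\<Inter>g\<in>G. {U. U \<bullet> g \<le> r})" for r by blast
      moreover have "{x \<in> D. f x \<le> r} = (\<Inter>g\<in>G. {U. U \<bullet> g \<le> r})" for r
        using f_le by auto
      ultimately show "closed {x \<in> D. f x \<le> r}" for r by simp
    qed (use l f_nonneg in \<open>auto intro!: continuous_intros\<close>)
    then show "\<exists>y\<in>D. \<forall>v\<in>D. f y + (norm (y - x))\<^sup>2 / (2 * l) \<le> f v + (norm (v - x))\<^sup>2 / (2 * l)"
      by (simp add: add.commute)
  qed
  then show ?thesis by (simp add: D_def f_def[abs_def])
qed

context open_domain
begin

lemma L2_integral_test: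
  assumes "u \<in> L2 \<Omega>" "sqint \<phi>"
  shows "(\<integral>x. u x * \<phi> x \<partial>lebesgue_on \<Omega>) = zero_ext u \<bullet> abs_lsq \<phi>"
  unfolding integral_on zero_ext_def inner_abs[OF L2_sqint[OF assms(1)] assms(2)] by (simp add: mult.assoc)

lemma zero_ext_rep_inner:
  assumes "sqint \<phi>" "\<And>x. x \<notin> \<Omega> \<Longrightarrow> \<phi> x = 0"
  shows "zero_ext (rep_lsq U) \<bullet> abs_lsq \<phi> = U \<bullet> abs_lsq \<phi>"
proof -
  have "U \<bullet> abs_lsq \<phi> = abs_lsq (rep_lsq U) \<bullet> abs_lsq \<phi>" by (simp add: abs_rep)
  then show ?thesis
    unfolding zero_ext_def inner_abs[OF sqint_indicator[OF sqint_rep] assms(1)] inner_abs[OF sqint_rep assms(1)]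
    using assms(2) by (auto simp: indicator_def intro!: Bochner_Integration.integral_cong)
qed

text \<open>
  Only the restriction to \<open>\<Omega>\<close> is required to be a test function, in line with functionals that look at
  nothing else.
\<close>

definition tests :: "(real^2) lsq set" where
  "tests = {U. \<exists>\<phi>\<in>C1_0 \<Omega>. L2_eq \<Omega> (rep_lsq U) \<phi>}"

lemma tests_I: "\<phi> \<in> C1_0 \<Omega> \<Longrightarrow> AE x in lebesgue. x \<in> \<Omega> \<longrightarrow> rep_lsq U x = \<phi> x \<Longrightarrow> U \<in> tests"
  unfolding tests_def L2_eq_iff by blast

lemma abs_test:
  assumes \<phi>: "\<phi> \<in> C1_0 \<Omega>" shows "abs_lsq \<phi> \<in> tests"
  using rep_abs[OF C1_0_sqint[OF \<phi>]] by (intro tests_I[OF \<phi>]) (auto elim!: eventually_mono)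

text \<open>
  An element orthogonal to \<open>tests\<close> vanishes on \<open>\<Omega>\<close> by the fundamental lemma. It then belongs to
  \<open>tests\<close> itself, as its restriction to \<open>\<Omega>\<close> is the zero function, and so is orthogonal to itself.
\<close>

lemma tests_dense: "closure tests = UNIV"
proof (rule dense_if_orthogonal_trivial)
  show "subspace tests"
    unfolding subspace_def
  proof (intro conjI ballI allI)
    have "AE x in lebesgue. rep_lsq (0 :: (real^2) lsq) x = 0"
      using rep_abs[OF sqint_zero] by (simp add: zero_lsq.abs_eq)
    then show "0 \<in> tests"
      by (intro tests_I[OF C1_0_zero]) (auto elim!: eventually_mono)
    fix U assume "U \<in> tests"
    then obtain \<phi> where \<phi>: "\<phi> \<in> C1_0 \<Omega>" "AE x in lebesgue. x \<in> \<Omega> \<longrightarrow> rep_lsq U x = \<phi> x"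
      unfolding tests_def L2_eq_iff by blast
    {
      fix V assume "V \<in> tests"
      then obtain \<psi> where \<psi>: "\<psi> \<in> C1_0 \<Omega>" "AE x in lebesgue. x \<in> \<Omega> \<longrightarrow> rep_lsq V x = \<psi> x"
        unfolding tests_def L2_eq_iff by blast
      from \<phi>(2) \<psi>(2) rep_add[of U V]
      have "AE x in lebesgue. x \<in> \<Omega> \<longrightarrow> rep_lsq (U + V) x = \<phi> x + \<psi> x" by eventually_elim auto
      then show "U + V \<in> tests" by (rule tests_I[OF C1_0_add[OF \<phi>(1) \<psi>(1)]])
    next
      fix c :: real
      from \<phi>(2) rep_scaleR[of c U]
      have "AE x in lebesgue. x \<in> \<Omega> \<longrightarrow> rep_lsq (c *\<^sub>R U) x = c *\<^sub>R \<phi> x" by eventually_elim auto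
      then show "c *\<^sub>R U \<in> tests" by (rule tests_I[OF C1_0_scaleR[OF \<phi>(1)]])
    }
  qed
  fix W assume W: "\<And>t. t \<in> tests \<Longrightarrow> W \<bullet> t = 0"
  have "AE x in lebesgue. x \<in> \<Omega> \<longrightarrow> rep_lsq W x = 0"
  proof (rule fundamental_lemma[OF open_Omega sqint_rep])
    fix \<phi> :: "real^2 \<Rightarrow> real" assume \<phi>: "\<phi> \<in> C1_0 \<Omega>"
    have "W \<bullet> abs_lsq \<phi> = 0" by (rule W[OF abs_test[OF \<phi>]])
    then show "(\<integral>x. rep_lsq W x * \<phi> x \<partial>lebesgue) = 0"
      using inner_abs[OF sqint_rep C1_0_sqint[OF \<phi>], of W] by (simp add: abs_rep)
  qed
  then have "W \<in> tests"
    by (rule tests_I[OF C1_0_zero])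
  then show "W = 0" using W[of W] by simp
qed

subsection \<open>The anisotropic total variation\<close>

lemma divergence_eq: "z \<in> C1_0 \<Omega> \<Longrightarrow> divergence z x = (\<Sum>k\<in>UNIV. partial_deriv k (\<lambda>x. z x $ k) x)"
  unfolding divergence_def by (simp add: C1_0_iff partial_deriv_component)

lemma divergence_sqint:
  assumes "z \<in> C1_0 \<Omega>" shows "sqint (divergence z)"
proof -
  have "divergence z = (\<lambda>x. partial_deriv 1 (\<lambda>x. z x $ 1) x + partial_deriv 2 (\<lambda>x. z x $ 2) x)"
    using divergence_eq[OF assms] by (auto simp: sum_2)
  then show ?thesis using C1_0_component[OF assms] by (auto intro!: sqint_add partial_deriv_sqint)
qed

lemma divergence_outside:
  assumes "z \<in> C1_0 \<Omega>" "x \<notin> \<Omega>" shows "divergence z x = 0"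
proof -
  have "partial_deriv k (\<lambda>x. z x $ k) x = 0" for k
    using partial_deriv_supported[OF C1_0_component[OF assms(1)]] supported_in_outside assms(2) by blast
  then show ?thesis by (simp add: divergence_eq[OF assms(1)])
qed

definition test_fields :: "(real^2 \<Rightarrow> real^2) set" where
  "test_fields = {z \<in> C1_0 \<Omega>. \<forall>x\<in>\<Omega>. max \<bar>z x $ 1\<bar> \<bar>z x $ 2\<bar> \<le> 1}"

lemma aniso_TV_eq:
  assumes "u \<in> L2 \<Omega>"
  shows "aniso_TV \<Omega> u = (SUP z\<in>test_fields. ereal (zero_ext u \<bullet> abs_lsq (divergence z)))"
  unfolding aniso_TV_def test_fields_def
  by (intro SUP_cong refl) (auto simp: L2_integral_test[OF assms divergence_sqint])

lemma aniso_TV_rep: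
  "aniso_TV \<Omega> (rep_lsq U) = (SUP g\<in>(\<lambda>z. abs_lsq (divergence z)) ` test_fields. ereal (U \<bullet> g))"
  unfolding aniso_TV_eq[OF rep_L2] image_image
  by (intro SUP_cong refl)
     (auto simp: test_fields_def zero_ext_rep_inner divergence_sqint divergence_outside)

lemma zero_field: "(\<lambda>_. 0) \<in> test_fields"
  by (simp add: test_fields_def C1_0_zero)

lemma divergence_zero: "divergence (\<lambda>_. 0) = (\<lambda>_. 0)"
proof
  fix x :: "real^2"
  have "partial_deriv k (\<lambda>_. 0 :: real^2) x = 0" for k
    by (rule partial_deriv_eq[OF has_derivative_const])
  then show "divergence (\<lambda>_. 0) x = 0" by (simp add: divergence_def)
qed

lemma aniso_TV_nonneg: "0 \<le> aniso_TV \<Omega> u"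
proof -
  show ?thesis unfolding aniso_TV_def test_fields_def[symmetric]
    by (intro SUP_upper2[OF zero_field]) (simp add: zero_ereal_def divergence_zero)
qed

text \<open>
  Integration by parts moves the derivatives from the field, which is bounded by \<open>1\<close>, to \<open>\<phi>\<close>.
\<close>

lemma aniso_TV_finite:
  assumes \<phi>: "\<phi> \<in> C1_0 \<Omega>"
  shows "aniso_TV \<Omega> \<phi> < \<infinity>"
proof -
  define c where "c = (\<Sum>k\<in>UNIV. \<integral>x. \<bar>partial_deriv k \<phi> x\<bar> \<partial>lebesgue)"
  have int_abs: "integrable lebesgue (\<lambda>x. \<bar>partial_deriv k \<phi> x\<bar>)" for k
    using supported_continuous_sqint(2) partial_deriv_supported[OF \<phi>] by blast
  have \<phi>L: "\<phi> \<in> L2 \<Omega>" by (rule sqint_L2[OF C1_0_sqint[OF \<phi>]])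
  have "(\<integral>x. \<phi> x * divergence z x \<partial>lebesgue_on \<Omega>) \<le> c" if z: "z \<in> test_fields" for z
  proof -
    have zC: "z \<in> C1_0 \<Omega>" using z by (simp add: test_fields_def)
    have z1: "\<bar>z x $ k\<bar> \<le> 1" for x k
    proof (cases "x \<in> \<Omega>")
      case True
      then show ?thesis using z exhaust_2[of k] by (auto simp: test_fields_def)
    next
      case False
      then show ?thesis using zC supported_in_outside[of \<Omega> z x] by (simp add: C1_0_iff)
    qed
    note zk = C1_0_component[OF zC]
    have int: "integrable lebesgue (\<lambda>x. \<phi> x * partial_deriv k (\<lambda>x. z x $ k) x)" for k
      by (intro sqint_mult_integrable C1_0_sqint[OF \<phi>] partial_deriv_sqint[OF zk])
    have "(\<integral>x. \<phi> x * divergence z x \<partial>lebesgue_on \<Omega>) = (\<integral>x. \<phi> x * divergence z x \<partial>lebesgue)"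
      unfolding integral_on using divergence_outside[OF zC]
      by (intro Bochner_Integration.integral_cong) (auto simp: indicator_def)
    also have "\<dots> = (\<Sum>k\<in>UNIV. \<integral>x. \<phi> x * partial_deriv k (\<lambda>x. z x $ k) x \<partial>lebesgue)"
      unfolding divergence_eq[OF zC] sum_distrib_left by (rule Bochner_Integration.integral_sum[OF int])
    also have "\<dots> = (\<Sum>k\<in>UNIV. - (\<integral>x. partial_deriv k \<phi> x * z x $ k \<partial>lebesgue))"
      by (intro sum.cong refl integration_by_parts[OF \<phi> zk])
    also have "\<dots> \<le> c"
      unfolding c_def
    proof (rule sum_mono)
      fix k :: 2
      have "\<bar>\<integral>x. partial_deriv k \<phi> x * z x $ k \<partial>lebesgue\<bar> \<le> (\<integral>x. \<bar>partial_deriv k \<phi> x * z x $ k\<bar> \<partial>lebesgue)"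
        by (rule integral_abs_bound)
      also have "\<dots> \<le> (\<integral>x. \<bar>partial_deriv k \<phi> x\<bar> \<partial>lebesgue)"
        using z1 by (intro integral_mono int_abs integrable_abs sqint_mult_integrable partial_deriv_sqint[OF \<phi>]
            C1_0_sqint[OF zk]) (auto simp: abs_mult intro!: mult_left_le)
      finally show "- (\<integral>x. partial_deriv k \<phi> x * z x $ k \<partial>lebesgue) \<le> (\<integral>x. \<bar>partial_deriv k \<phi> x\<bar> \<partial>lebesgue)"
        by linarith
    qed
    finally show ?thesis .
  qed
  then have "aniso_TV \<Omega> \<phi> \<le> ereal c"
    unfolding aniso_TV_def test_fields_def[symmetric] by (intro SUP_least) simp
  then show ?thesis by auto
qed

lemma Phi0_L2_energy: "L2_energy \<Omega> (Phi0 \<Omega>)"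
proof (rule L2_energy.intro[OF open_domain_axioms], rule L2_energy_axioms.intro)
  have Phi0: "Phi0 \<Omega> = aniso_TV \<Omega>" by (auto simp: Phi0_def fun_eq_iff)
  show "0 \<le> Phi0 \<Omega> u" for u by (simp add: Phi0 aniso_TV_nonneg)
  show cong: "Phi0 \<Omega> u = Phi0 \<Omega> v" if "u \<in> L2 \<Omega>" "v \<in> L2 \<Omega>" "L2_eq \<Omega> u v" for u v
    using that zero_ext_eq_iff[OF that(1,2)] by (simp add: Phi0 aniso_TV_eq)
  show "convex_energy {U. Phi0 \<Omega> (rep_lsq U) < \<infinity>} (\<lambda>U. real_of_ereal (Phi0 \<Omega> (rep_lsq U)))"
  proof (rule support_function_energy)
    show "Phi0 \<Omega> (rep_lsq U) = (SUP g\<in>(\<lambda>z. abs_lsq (divergence z)) ` test_fields. ereal (U \<bullet> g))" for U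
      unfolding Phi0 by (rule aniso_TV_rep)
    have "abs_lsq (divergence (\<lambda>_. 0 :: real^2)) = 0" by (simp add: zero_lsq.abs_eq divergence_zero)
    then show "0 \<in> (\<lambda>z. abs_lsq (divergence z)) ` test_fields" using zero_field by (metis imageI)
    have "tests \<subseteq> {U. Phi0 \<Omega> (rep_lsq U) < \<infinity>}"
    proof
      fix U assume "U \<in> tests"
      then obtain \<phi> where \<phi>: "\<phi> \<in> C1_0 \<Omega>" "L2_eq \<Omega> (rep_lsq U) \<phi>" by (auto simp: tests_def)
      then have "Phi0 \<Omega> (rep_lsq U) = aniso_TV \<Omega> \<phi>"
        using cong[OF rep_L2 sqint_L2[OF C1_0_sqint[OF \<phi>(1)]] \<phi>(2)] by (simp add: Phi0)
      then show "U \<in> {U. Phi0 \<Omega> (rep_lsq U) < \<infinity>}" using aniso_TV_finite[OF \<phi>(1)] by simp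
    qed
    then show "closure {U. Phi0 \<Omega> (rep_lsq U) < \<infinity>} = UNIV"
      using closure_mono tests_dense by blast
  qed
qed

end

subsection \<open>The functional with the Dirichlet term\<close>

text \<open>
  The integrand of \<open>\<Phi>\<^sub>1\<close> as a function of the gradient. For \<open>\<gamma> = 0\<close> only the \<open>L\<^sup>1\<close> part is left.
\<close>

definition integrand :: "real \<Rightarrow> real^2 \<Rightarrow> real" where
  "integrand \<gamma> y = \<gamma> / 2 * ((y $ 1)\<^sup>2 + (y $ 2)\<^sup>2) + (\<bar>y $ 1\<bar> + \<bar>y $ 2\<bar>)"

definition rep_vec :: "((real^2) lsq)^2 \<Rightarrow> real^2 \<Rightarrow> real^2" where
  "rep_vec P x = (\<chi> k. rep_lsq (P $ k) x)"

definition energy :: "real \<Rightarrow> ((real^2) lsq)^2 \<Rightarrow> ennreal" where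
  "energy \<gamma> P = (\<integral>\<^sup>+x. ennreal (integrand \<gamma> (rep_vec P x)) \<partial>lebesgue)"

lemma integrand_norm: "\<gamma> / 2 * (norm y)\<^sup>2 + \<bar>y $ 1\<bar> + \<bar>y $ 2\<bar> = integrand \<gamma> y"
proof -
  have "(norm y)\<^sup>2 = (y $ 1)\<^sup>2 + (y $ 2)\<^sup>2"
    unfolding power2_norm_eq_inner by (simp add: inner_vec_def sum_2 power2_eq_square)
  then show ?thesis by (simp add: integrand_def)
qed

lemma integrand_nonneg: "0 \<le> \<gamma> \<Longrightarrow> 0 \<le> integrand \<gamma> y"
  by (simp add: integrand_def)

lemma integrand_rep_vec:
  "integrand \<gamma> (rep_vec P x) = \<gamma> / 2 * ((rep_lsq (P $ 1) x)\<^sup>2 + (rep_lsq (P $ 2) x)\<^sup>2)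
    + (\<bar>rep_lsq (P $ 1) x\<bar> + \<bar>rep_lsq (P $ 2) x\<bar>)"
  by (simp add: integrand_def rep_vec_def)

lemma integrand_convex:
  assumes "0 \<le> \<gamma>" "0 \<le> a" "0 \<le> b" "a + b = 1"
  shows "integrand \<gamma> (a *\<^sub>R y + b *\<^sub>R z) \<le> a * integrand \<gamma> y + b * integrand \<gamma> z"
proof -
  have sq: "(a * p + b * q)\<^sup>2 \<le> a * p\<^sup>2 + b * q\<^sup>2" for p q :: real
  proof -
    have "a * p\<^sup>2 + b * q\<^sup>2 - (a * p + b * q)\<^sup>2 = a * b * (p - q)\<^sup>2"
      using assms(4)[symmetric, THEN arg_cong, of "\<lambda>t. t * (a * p\<^sup>2 + b * q\<^sup>2)"]
      by (simp add: power2_eq_square algebra_simps)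
    moreover have "0 \<le> a * b * (p - q)\<^sup>2" using assms by simp
    ultimately show ?thesis by linarith
  qed
  have ab: "\<bar>a * p + b * q\<bar> \<le> a * \<bar>p\<bar> + b * \<bar>q\<bar>" for p q :: real
    using abs_triangle_ineq[of "a * p" "b * q"] assms by (simp add: abs_mult)
  have "integrand \<gamma> (a *\<^sub>R y + b *\<^sub>R z)
      \<le> \<gamma> / 2 * ((a * (y $ 1)\<^sup>2 + b * (z $ 1)\<^sup>2) + (a * (y $ 2)\<^sup>2 + b * (z $ 2)\<^sup>2))
        + ((a * \<bar>y $ 1\<bar> + b * \<bar>z $ 1\<bar>) + (a * \<bar>y $ 2\<bar> + b * \<bar>z $ 2\<bar>))"
    unfolding integrand_def vector_add_component vector_scaleR_component real_scaleR_def
    using assms(1) by (intro add_mono mult_left_mono sq ab) simp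
  also have "\<dots> = a * integrand \<gamma> y + b * integrand \<gamma> z"
    by (simp add: integrand_def algebra_simps)
  finally show ?thesis .
qed

lemma rep_measurable: "rep_lsq U \<in> borel_measurable lebesgue"
  by (rule sqint_measurable[OF sqint_rep])

lemma integrand_measurable: "(\<lambda>x. ennreal (integrand \<gamma> (rep_vec P x))) \<in> borel_measurable lebesgue"
proof -
  have "(\<lambda>x. integrand \<gamma> (rep_vec P x)) \<in> borel_measurable lebesgue"
    unfolding integrand_rep_vec
    by (intro borel_measurable_add borel_measurable_times borel_measurable_const borel_measurable_power
        borel_measurable_abs rep_measurable)
  then show ?thesis by simp
qed

lemma norm_lsq_vec: "(norm P)\<^sup>2 = (norm (P $ 1))\<^sup>2 + (norm (P $ 2))\<^sup>2" for P :: "((real^2) lsq)^2"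
  by (simp add: power2_norm_eq_inner inner_vec_def sum_2)

lemma energy_split:
  assumes "0 \<le> \<gamma>"
  shows "energy \<gamma> P = ennreal (\<gamma> / 2 * (norm P)\<^sup>2) + energy 0 P"
proof -
  have m: "(\<lambda>x. ennreal ((rep_lsq (P $ k) x)\<^sup>2)) \<in> borel_measurable lebesgue" for k
    using borel_measurable_power[OF rep_measurable, of "P $ k" 2] by simp
  have "energy \<gamma> P = (\<integral>\<^sup>+x. ennreal (\<gamma> / 2) * (ennreal ((rep_lsq (P $ 1) x)\<^sup>2) + ennreal ((rep_lsq (P $ 2) x)\<^sup>2))
      + ennreal (integrand 0 (rep_vec P x)) \<partial>lebesgue)"
    unfolding energy_def integrand_rep_vec using assms
    by (intro nn_integral_cong) (simp add: ennreal_plus[symmetric] ennreal_mult[symmetric] del: ennreal_plus)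
  also have "\<dots> = (\<integral>\<^sup>+x. ennreal (\<gamma> / 2) * (ennreal ((rep_lsq (P $ 1) x)\<^sup>2) + ennreal ((rep_lsq (P $ 2) x)\<^sup>2)) \<partial>lebesgue)
      + energy 0 P"
    unfolding energy_def by (intro nn_integral_add borel_measurable_times_ennreal borel_measurable_const
        borel_measurable_add m integrand_measurable)
  also have "(\<integral>\<^sup>+x. ennreal (\<gamma> / 2) * (ennreal ((rep_lsq (P $ 1) x)\<^sup>2) + ennreal ((rep_lsq (P $ 2) x)\<^sup>2)) \<partial>lebesgue)
      = ennreal (\<gamma> / 2) * (ennreal ((norm (P $ 1))\<^sup>2) + ennreal ((norm (P $ 2))\<^sup>2))"
    using nn_integral_square[OF sqint_rep, of "P $ 1"] nn_integral_square[OF sqint_rep, of "P $ 2"] m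
    by (subst nn_integral_cmult) (auto simp: nn_integral_add abs_rep)
  also have "\<dots> = ennreal (\<gamma> / 2 * (norm P)\<^sup>2)"
    unfolding norm_lsq_vec using assms by (simp add: ennreal_plus[symmetric] ennreal_mult[symmetric] del: ennreal_plus)
  finally show ?thesis .
qed

lemma energy_convex:
  assumes "0 \<le> \<gamma>" "0 \<le> a" "0 \<le> b" "a + b = 1"
  shows "energy \<gamma> (a *\<^sub>R P + b *\<^sub>R R) \<le> ennreal a * energy \<gamma> P + ennreal b * energy \<gamma> R"
proof -
  have AE_k: "AE x in lebesgue. rep_lsq ((a *\<^sub>R P + b *\<^sub>R R) $ k) x = a * rep_lsq (P $ k) x + b * rep_lsq (R $ k) x" for k
    using rep_add[of "a *\<^sub>R P $ k" "b *\<^sub>R R $ k"] rep_scaleR[of a "P $ k"] rep_scaleR[of b "R $ k"]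
    by eventually_elim simp
  have "AE x in lebesgue. rep_vec (a *\<^sub>R P + b *\<^sub>R R) x = a *\<^sub>R rep_vec P x + b *\<^sub>R rep_vec R x"
    using AE_k[of 1] AE_k[of 2] by eventually_elim (simp add: rep_vec_def vec_eq_iff forall_2)
  then have "AE x in lebesgue. ennreal (integrand \<gamma> (rep_vec (a *\<^sub>R P + b *\<^sub>R R) x))
      \<le> ennreal a * ennreal (integrand \<gamma> (rep_vec P x)) + ennreal b * ennreal (integrand \<gamma> (rep_vec R x))"
  proof eventually_elim
    case (elim x)
    have "ennreal (integrand \<gamma> (rep_vec (a *\<^sub>R P + b *\<^sub>R R) x))
        \<le> ennreal (a * integrand \<gamma> (rep_vec P x) + b * integrand \<gamma> (rep_vec R x))"
      unfolding elim by (intro ennreal_leI integrand_convex assms)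
    then show ?case using assms
      by (simp add: integrand_nonneg ennreal_plus ennreal_mult)
  qed
  then have "energy \<gamma> (a *\<^sub>R P + b *\<^sub>R R)
      \<le> (\<integral>\<^sup>+x. ennreal a * ennreal (integrand \<gamma> (rep_vec P x)) + ennreal b * ennreal (integrand \<gamma> (rep_vec R x)) \<partial>lebesgue)"
    unfolding energy_def by (rule nn_integral_mono_AE)
  also have "\<dots> = ennreal a * energy \<gamma> P + ennreal b * energy \<gamma> R"
    unfolding energy_def
    by (subst nn_integral_add)
       (auto intro!: borel_measurable_times_ennreal integrand_measurable simp: nn_integral_cmult integrand_measurable)
  finally show ?thesis .
qed

text \<open>
  Convergence in \<open>L\<^sup>2\<close> gives convergence almost everywhere along a subsequence, chosen first for one
  component and then for the other, and Fatou's lemma applies.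
\<close>

lemma closed_energy_0: "closed {P. energy 0 P \<le> c}"
  unfolding closed_sequential_limits
proof (intro allI impI, elim conjE)
  fix X P assume X: "\<forall>n. X n \<in> {P. energy 0 P \<le> c}" and lim: "X \<longlonglongrightarrow> P"
  obtain r where r: "strict_mono r" "AE x in lebesgue. (\<lambda>n. rep_lsq (X (r n) $ 1) x) \<longlonglongrightarrow> rep_lsq (P $ 1) x"
    using tendsto_AE_subseq[OF tendsto_vec_nth[OF lim, of 1]] by blast
  have "(\<lambda>n. X (r n) $ 2) \<longlonglongrightarrow> P $ 2"
    using LIMSEQ_subseq_LIMSEQ[OF tendsto_vec_nth[OF lim, of 2] r(1)] by (simp add: o_def)
  from tendsto_AE_subseq[OF this] obtain s where s: "strict_mono s"
    "AE x in lebesgue. (\<lambda>n. rep_lsq (X (r (s n)) $ 2) x) \<longlonglongrightarrow> rep_lsq (P $ 2) x" by blast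
  have lim_AE: "AE x in lebesgue. (\<lambda>n. ennreal (integrand 0 (rep_vec (X (r (s n))) x))) \<longlonglongrightarrow> ennreal (integrand 0 (rep_vec P x))"
    using r(2) s(2)
  proof eventually_elim
    case (elim x)
    have "(\<lambda>n. rep_lsq (X (r (s n)) $ 1) x) \<longlonglongrightarrow> rep_lsq (P $ 1) x"
      using LIMSEQ_subseq_LIMSEQ[OF elim(1) s(1)] by (simp add: o_def)
    then show ?case unfolding integrand_rep_vec by (intro tendsto_ennrealI tendsto_intros elim(2))
  qed
  have "energy 0 P = (\<integral>\<^sup>+x. liminf (\<lambda>n. ennreal (integrand 0 (rep_vec (X (r (s n))) x))) \<partial>lebesgue)"
    unfolding energy_def
  proof (rule nn_integral_cong_AE)
    show "AE x in lebesgue. ennreal (integrand 0 (rep_vec P x)) = liminf (\<lambda>n. ennreal (integrand 0 (rep_vec (X (r (s n))) x)))"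
      using lim_AE by eventually_elim (rule lim_imp_Liminf[OF trivial_limit_sequentially, symmetric])
  qed
  also have "\<dots> \<le> liminf (\<lambda>n. energy 0 (X (r (s n))))"
    unfolding energy_def by (rule nn_integral_liminf[OF integrand_measurable])
  also have "\<dots> \<le> c"
  proof (rule order_trans[OF Liminf_le_Limsup], simp, rule Limsup_bounded)
    show "\<forall>\<^sub>F n in sequentially. energy 0 (X (r (s n))) \<le> c" using X by simp
  qed
  finally show "P \<in> {P. energy 0 P \<le> c}" by simp
qed

context open_domain
begin

text \<open>
  The weak gradient as a relation in the Hilbert space, where it is visibly linear and closed. It
  leaves \<open>P\<close> unrestricted outside \<open>\<Omega>\<close>.
\<close>

definition weak_grad :: "(real^2) lsq \<Rightarrow> ((real^2) lsq)^2 \<Rightarrow> bool" where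
  "weak_grad U P \<longleftrightarrow> (\<forall>k. \<forall>\<phi>\<in>C1_0 \<Omega>. U \<bullet> abs_lsq (partial_deriv k \<phi>) = - (P $ k \<bullet> abs_lsq \<phi>))"

lemma is_weak_gradient_iff:
  assumes "u \<in> L2 \<Omega>"
  shows "is_weak_gradient \<Omega> u g \<longleftrightarrow> (\<forall>k. (\<lambda>x. g x $ k) \<in> L2 \<Omega>) \<and> weak_grad (zero_ext u) (\<chi> k. zero_ext (\<lambda>x. g x $ k))"
proof -
  have "(\<integral>x. u x * partial_deriv k \<phi> x \<partial>lebesgue_on \<Omega>) = zero_ext u \<bullet> abs_lsq (partial_deriv k \<phi>)"
    if "\<phi> \<in> C1_0 \<Omega>" for k \<phi>
    by (rule L2_integral_test[OF assms partial_deriv_sqint[OF that]])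
  moreover have "(\<integral>x. g x $ k * \<phi> x \<partial>lebesgue_on \<Omega>) = zero_ext (\<lambda>x. g x $ k) \<bullet> abs_lsq \<phi>"
    if "\<phi> \<in> C1_0 \<Omega>" "(\<lambda>x. g x $ k) \<in> L2 \<Omega>" for k \<phi>
    by (rule L2_integral_test[OF that(2) C1_0_sqint[OF that(1)]])
  ultimately show ?thesis unfolding is_weak_gradient_def weak_grad_def by (auto simp: all_conj_distrib)
qed

lemma partial_deriv_outside: "\<phi> \<in> C1_0 \<Omega> \<Longrightarrow> x \<notin> \<Omega> \<Longrightarrow> partial_deriv k \<phi> x = 0"
  using partial_deriv_supported supported_in_outside by blast

lemma weak_grad_ext: "weak_grad (zero_ext (rep_lsq U)) P \<longleftrightarrow> weak_grad U P"
  unfolding weak_grad_def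
  by (intro all_cong1 ball_cong refl) (simp add: zero_ext_rep_inner partial_deriv_sqint partial_deriv_outside)

lemma rep_vec_weak_gradient:
  assumes "weak_grad U P" shows "is_weak_gradient \<Omega> (rep_lsq U) (rep_vec P)"
proof -
  have "zero_ext (rep_lsq (P $ k)) \<bullet> abs_lsq \<phi> = P $ k \<bullet> abs_lsq \<phi>" if "\<phi> \<in> C1_0 \<Omega>" for k \<phi>
    using that supported_in_outside by (intro zero_ext_rep_inner C1_0_sqint[OF that]) (auto simp: C1_0_iff)
  then have "weak_grad U (\<chi> k. zero_ext (rep_lsq (P $ k)))" using assms unfolding weak_grad_def by simp
  then show ?thesis
    unfolding is_weak_gradient_iff[OF rep_L2] weak_grad_ext by (simp add: rep_vec_def rep_L2)
qed

lemma weak_gradient_unique: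
  assumes u: "u \<in> L2 \<Omega>" and g: "is_weak_gradient \<Omega> u g" and h: "is_weak_gradient \<Omega> u h"
  shows "AE x in lebesgue. x \<in> \<Omega> \<longrightarrow> g x = h x"
proof -
  have "AE x in lebesgue. x \<in> \<Omega> \<longrightarrow> g x $ k = h x $ k" for k
  proof -
    have gL: "(\<lambda>x. g x $ k) \<in> L2 \<Omega>" and hL: "(\<lambda>x. h x $ k) \<in> L2 \<Omega>"
      using g h by (auto simp: is_weak_gradient_def)
    \<comment> \<open>cut off to be square-integrable on the plane\<close>
    define w where "w x = indicator \<Omega> x * g x $ k - indicator \<Omega> x * h x $ k" for x
    have w: "sqint w" unfolding w_def by (intro sqint_diff L2_sqint gL hL)
    have w_abs: "abs_lsq w = zero_ext (\<lambda>x. g x $ k) - zero_ext (\<lambda>x. h x $ k)"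
      unfolding w_def zero_ext_def by (rule abs_diff[OF L2_sqint[OF gL] L2_sqint[OF hL], symmetric])
    have "AE x in lebesgue. x \<in> \<Omega> \<longrightarrow> w x = 0"
    proof (rule fundamental_lemma[OF open_Omega w])
      fix \<phi> :: "real^2 \<Rightarrow> real" assume \<phi>: "\<phi> \<in> C1_0 \<Omega>"
      have "zero_ext (\<lambda>x. g x $ k) \<bullet> abs_lsq \<phi> = zero_ext (\<lambda>x. h x $ k) \<bullet> abs_lsq \<phi>"
        using g h \<phi> unfolding is_weak_gradient_iff[OF u] weak_grad_def by (metis (no_types, lifting) neg_equal_iff_equal vec_lambda_beta)
      then show "(\<integral>x. w x * \<phi> x \<partial>lebesgue) = 0"
        using inner_abs[OF w C1_0_sqint[OF \<phi>]] by (simp add: w_abs inner_diff_left)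
    qed
    then show ?thesis by eventually_elim (simp add: w_def)
  qed
  from this[of 1] this[of 2] show ?thesis by eventually_elim (auto simp: vec_eq_iff forall_2)
qed

lemma nn_integral_on: "(\<integral>\<^sup>+x. h x \<partial>lebesgue_on \<Omega>) = (\<integral>\<^sup>+x. h x * indicator \<Omega> x \<partial>lebesgue)"
  using Omega_sets by (intro nn_integral_restrict_space) simp

lemma Phi1_weak_gradient:
  assumes u: "u \<in> L2 \<Omega>" and g: "is_weak_gradient \<Omega> u g"
  shows "Phi1 \<Omega> \<gamma> u = enn2ereal (\<integral>\<^sup>+x. ennreal (integrand \<gamma> (g x)) * indicator \<Omega> x \<partial>lebesgue)"
proof -
  have "is_weak_gradient \<Omega> u (weak_gradient \<Omega> u)"
    unfolding weak_gradient_def by (rule someI[of _ g]) (rule g)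
  then have "AE x in lebesgue. x \<in> \<Omega> \<longrightarrow> weak_gradient \<Omega> u x = g x"
    by (rule weak_gradient_unique[OF u _ g])
  then have "(\<integral>\<^sup>+x. ennreal (integrand \<gamma> (weak_gradient \<Omega> u x)) * indicator \<Omega> x \<partial>lebesgue)
      = (\<integral>\<^sup>+x. ennreal (integrand \<gamma> (g x)) * indicator \<Omega> x \<partial>lebesgue)"
    by (intro nn_integral_cong_AE) (auto elim!: eventually_mono simp: indicator_def)
  moreover have "u \<in> H1 \<Omega>" using u g by (auto simp: H1_def)
  ultimately show ?thesis unfolding Phi1_def integrand_norm nn_integral_on by simp
qed

text \<open>
  Equality can fail, as \<open>P\<close> may be nonzero outside \<open>\<Omega>\<close>. Extending a weak gradient by zero
  attains equality, which is \<open>Phi1_energy_eq\<close>; together they reduce \<open>\<Phi>\<^sub>1\<close> to \<open>energy\<close>.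
\<close>

lemma Phi1_le_energy:
  assumes "weak_grad U P" shows "Phi1 \<Omega> \<gamma> (rep_lsq U) \<le> enn2ereal (energy \<gamma> P)"
  unfolding Phi1_weak_gradient[OF rep_L2 rep_vec_weak_gradient[OF assms]] energy_def less_eq_ennreal.rep_eq[symmetric]
  by (intro nn_integral_mono) (auto simp: indicator_def)

lemma Phi1_energy_eq:
  assumes "Phi1 \<Omega> \<gamma> (rep_lsq U) < \<infinity>"
  shows "\<exists>P. weak_grad U P \<and> Phi1 \<Omega> \<gamma> (rep_lsq U) = enn2ereal (energy \<gamma> P)"
proof -
  have "rep_lsq U \<in> H1 \<Omega>" using assms unfolding Phi1_def by (auto split: if_splits)
  then obtain g where g: "is_weak_gradient \<Omega> (rep_lsq U) g" by (auto simp: H1_def)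
  define P where "P = (\<chi> k. zero_ext (\<lambda>x. g x $ k))"
  have gL: "(\<lambda>x. g x $ k) \<in> L2 \<Omega>" for k using g by (simp add: is_weak_gradient_def)
  have "weak_grad U P" using g unfolding is_weak_gradient_iff[OF rep_L2] weak_grad_ext P_def by simp
  moreover have "energy \<gamma> P = (\<integral>\<^sup>+x. ennreal (integrand \<gamma> (g x)) * indicator \<Omega> x \<partial>lebesgue)"
    unfolding energy_def
  proof (rule nn_integral_cong_AE)
    have k: "AE x in lebesgue. rep_lsq (P $ k) x = indicator \<Omega> x * g x $ k" for k
      unfolding P_def zero_ext_def using rep_abs[OF L2_sqint[OF gL]] by simp
    show "AE x in lebesgue. ennreal (integrand \<gamma> (rep_vec P x)) = ennreal (integrand \<gamma> (g x)) * indicator \<Omega> x"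
      using k[of 1] k[of 2] by eventually_elim (auto simp: integrand_def rep_vec_def indicator_def)
  qed
  ultimately show ?thesis using Phi1_weak_gradient[OF rep_L2 g] by metis
qed

lemma weak_grad_combination:
  "weak_grad U P \<Longrightarrow> weak_grad V R \<Longrightarrow> weak_grad (a *\<^sub>R U + b *\<^sub>R V) (a *\<^sub>R P + b *\<^sub>R R)"
  unfolding weak_grad_def by (simp add: inner_add_left)

lemma weak_grad_test:
  assumes \<phi>: "\<phi> \<in> C1_0 \<Omega>"
  shows "weak_grad (abs_lsq \<phi>) (\<chi> k. abs_lsq (partial_deriv k \<phi>))"
  unfolding weak_grad_def
proof (intro allI ballI)
  fix k and \<psi> :: "real^2 \<Rightarrow> real" assume \<psi>: "\<psi> \<in> C1_0 \<Omega>"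
  show "abs_lsq \<phi> \<bullet> abs_lsq (partial_deriv k \<psi>) = - ((\<chi> k. abs_lsq (partial_deriv k \<phi>)) $ k \<bullet> abs_lsq \<psi>)"
    using integration_by_parts[OF \<phi> \<psi>]
    by (simp add: inner_abs C1_0_sqint[OF \<phi>] C1_0_sqint[OF \<psi>] partial_deriv_sqint[OF \<phi>] partial_deriv_sqint[OF \<psi>])
qed

lemma energy_test_finite:
  assumes \<phi>: "\<phi> \<in> C1_0 \<Omega>" and "0 \<le> \<gamma>"
  shows "energy \<gamma> (\<chi> k. abs_lsq (partial_deriv k \<phi>)) < \<infinity>"
proof -
  define P where "P = (\<chi> k. abs_lsq (partial_deriv k \<phi>))"
  have "integrable lebesgue (\<lambda>x. \<bar>partial_deriv 1 \<phi> x\<bar> + \<bar>partial_deriv 2 \<phi> x\<bar>)"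
    using supported_continuous_sqint(2) partial_deriv_supported[OF \<phi>]
    by (intro Bochner_Integration.integrable_add integrable_abs) blast+
  then have "(\<integral>\<^sup>+x. ennreal (norm (\<bar>partial_deriv 1 \<phi> x\<bar> + \<bar>partial_deriv 2 \<phi> x\<bar>)) \<partial>lebesgue) < \<infinity>"
    by (simp only: integrable_iff_bounded)
  moreover have "energy 0 P = (\<integral>\<^sup>+x. ennreal (norm (\<bar>partial_deriv 1 \<phi> x\<bar> + \<bar>partial_deriv 2 \<phi> x\<bar>)) \<partial>lebesgue)"
    unfolding energy_def
  proof (rule nn_integral_cong_AE)
    have k: "AE x in lebesgue. rep_lsq (P $ k) x = partial_deriv k \<phi> x" for k
      unfolding P_def using rep_abs[OF partial_deriv_sqint[OF \<phi>]] by simp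
    show "AE x in lebesgue. ennreal (integrand 0 (rep_vec P x)) = ennreal (norm (\<bar>partial_deriv 1 \<phi> x\<bar> + \<bar>partial_deriv 2 \<phi> x\<bar>))"
      using k[of 1] k[of 2] by eventually_elim (simp add: integrand_rep_vec)
  qed
  ultimately show ?thesis
    using energy_split[OF assms(2), of P] by (simp add: P_def[symmetric])
qed

lemma closed_weak_grad: "closed {z. weak_grad (fst z) (snd z)}"
proof -
  have "closed {z :: (real^2) lsq \<times> (((real^2) lsq)^2). fst z \<bullet> abs_lsq (partial_deriv k \<phi>) = - (snd z $ k \<bullet> abs_lsq \<phi>)}"
    for k \<phi>
    by (intro closed_Collect_eq continuous_intros)
  then have "closed (\<Inter>k. \<Inter>\<phi>\<in>C1_0 \<Omega>. {z :: (real^2) lsq \<times> (((real^2) lsq)^2).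
      fst z \<bullet> abs_lsq (partial_deriv k \<phi>) = - (snd z $ k \<bullet> abs_lsq \<phi>)})" by blast
  also have "(\<Inter>k. \<Inter>\<phi>\<in>C1_0 \<Omega>. {z :: (real^2) lsq \<times> (((real^2) lsq)^2).
      fst z \<bullet> abs_lsq (partial_deriv k \<phi>) = - (snd z $ k \<bullet> abs_lsq \<phi>)}) = {z. weak_grad (fst z) (snd z)}"
    by (auto simp: weak_grad_def)
  finally show ?thesis .
qed

text \<open>
  The proximal problem of \<open>\<Phi>\<^sub>1\<close>, posed for pairs of a function and its weak gradient. The two squared
  norms make it uniformly convex in the pair, with the smaller of the two moduli.
\<close>

lemma Phi1_minimiser:
  fixes x :: "(real^2) lsq"
  assumes \<gamma>: "0 < \<gamma>" and l: "0 < l"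
  shows "\<exists>Y P. weak_grad Y P \<and> energy 0 P < \<infinity> \<and> (\<forall>V R. weak_grad V R \<longrightarrow> energy 0 R < \<infinity> \<longrightarrow>
    (norm (Y - x))\<^sup>2 / (2 * l) + \<gamma> / 2 * (norm P)\<^sup>2 + enn2real (energy 0 P)
    \<le> (norm (V - x))\<^sup>2 / (2 * l) + \<gamma> / 2 * (norm R)\<^sup>2 + enn2real (energy 0 R))"
proof -
  define C where "C = {z :: (real^2) lsq \<times> (((real^2) lsq)^2). weak_grad (fst z) (snd z) \<and> energy 0 (snd z) < \<infinity>}"
  define Q where "Q z = (norm (fst z - x))\<^sup>2 / (2 * l) + \<gamma> / 2 * (norm (snd z))\<^sup>2"
    for z :: "(real^2) lsq \<times> (((real^2) lsq)^2)"
  define N where "N z = enn2real (energy 0 (snd z))" for z :: "(real^2) lsq \<times> (((real^2) lsq)^2)"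
  define c where "c = min (1 / (8 * l)) (\<gamma> / 8)"
  have "\<exists>z\<in>C. \<forall>y\<in>C. Q z + N z \<le> Q y + N y"
  proof (rule minimiser_exists[where c = c])
    have "energy 0 0 = 0"
    proof -
      have "AE x in lebesgue. rep_lsq (0 :: (real^2) lsq) x = 0"
        using rep_abs[OF sqint_zero] by (simp add: zero_lsq.abs_eq)
      then have "AE x in lebesgue. ennreal (integrand 0 (rep_vec 0 x)) = 0"
        by eventually_elim (simp add: integrand_rep_vec)
      then show ?thesis unfolding energy_def by (simp cong: nn_integral_cong_AE)
    qed
    then have "(0, 0) \<in> C" by (simp add: C_def weak_grad_def)
    then show "C \<noteq> {}" by auto
    fix a b assume ab: "a \<in> C" "b \<in> C"
    define ta tb where "ta = energy 0 (snd a)" and "tb = energy 0 (snd b)"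
    have fin: "ta < \<infinity>" "tb < \<infinity>" using ab by (auto simp: C_def ta_def tb_def)
    have "energy 0 (snd ((1/2) *\<^sub>R (a + b))) \<le> ennreal (1/2) * ta + ennreal (1/2) * tb"
      using energy_convex[of 0 "1/2" "1/2" "snd a" "snd b"] by (simp add: ta_def tb_def scaleR_add_right)
    also have "\<dots> = ennreal ((enn2real ta + enn2real tb) / 2)"
    proof -
      have "ta = ennreal (enn2real ta)" "tb = ennreal (enn2real tb)" using fin by auto
      then have "ennreal (1/2) * ta + ennreal (1/2) * tb
          = ennreal (1/2) * ennreal (enn2real ta) + ennreal (1/2) * ennreal (enn2real tb)" by simp
      also have "\<dots> = ennreal ((enn2real ta + enn2real tb) / 2)"
      proof -
        have "(enn2real ta + enn2real tb) / 2 = 1/2 * enn2real ta + 1/2 * enn2real tb" by simp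
        also have "ennreal \<dots> = ennreal (1/2) * ennreal (enn2real ta) + ennreal (1/2) * ennreal (enn2real tb)"
          by (simp only: ennreal_plus ennreal_mult enn2real_nonneg mult_nonneg_nonneg zero_le_divide_1_iff zero_le_numeral)
        finally show ?thesis by (rule sym)
      qed
      finally show ?thesis .
    qed
    finally have t: "energy 0 (snd ((1/2) *\<^sub>R (a + b))) \<le> ennreal ((enn2real ta + enn2real tb) / 2)" .
    then show "N ((1/2) *\<^sub>R (a + b)) \<le> (N a + N b) / 2"
      unfolding N_def ta_def tb_def by (intro enn2real_leI) auto
    have "weak_grad (fst ((1/2) *\<^sub>R (a + b))) (snd ((1/2) *\<^sub>R (a + b)))"
      using weak_grad_combination[of "fst a" "snd a" "fst b" "snd b" "1/2" "1/2"] ab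
      by (simp add: C_def scaleR_add_right)
    then show "(1/2) *\<^sub>R (a + b) \<in> C"
      unfolding C_def using order_le_less_trans[OF t ennreal_less_top] by simp
  next
    fix a b :: "(real^2) lsq \<times> (((real^2) lsq)^2)"
    have e2: "(norm ((1/2) *\<^sub>R (snd a + snd b)))\<^sup>2
        = ((norm (snd a))\<^sup>2 + (norm (snd b))\<^sup>2) / 2 - (norm (snd a - snd b))\<^sup>2 / 4"
      using norm_midpoint[of "snd a" "snd b" 0] by (simp only: diff_0_right)
    have "Q ((1/2) *\<^sub>R (a + b)) = (Q a + Q b) / 2 - (1 / (8 * l)) * (norm (fst a - fst b))\<^sup>2
        - \<gamma> / 8 * (norm (snd a - snd b))\<^sup>2"
      unfolding Q_def fst_scaleR snd_scaleR fst_add snd_add prox_midpoint[OF l] e2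
      by (simp add: algebra_simps add_divide_distrib diff_divide_distrib)
    moreover have "c * (norm (a - b))\<^sup>2 \<le> (1 / (8 * l)) * (norm (fst a - fst b))\<^sup>2 + \<gamma> / 8 * (norm (snd a - snd b))\<^sup>2"
    proof -
      have "c * (norm (a - b))\<^sup>2 = c * (norm (fst a - fst b))\<^sup>2 + c * (norm (snd a - snd b))\<^sup>2"
        by (simp add: norm_prod_def distrib_left)
      also have "\<dots> \<le> (1 / (8 * l)) * (norm (fst a - fst b))\<^sup>2 + \<gamma> / 8 * (norm (snd a - snd b))\<^sup>2"
        unfolding c_def by (intro add_mono mult_right_mono) auto
      finally show ?thesis .
    qed
    ultimately show "Q ((1/2) *\<^sub>R (a + b)) \<le> (Q a + Q b) / 2 - c * (norm (a - b))\<^sup>2" by linarith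
  next
    show "0 < c" using l \<gamma> by (simp add: c_def)
    show "continuous_on UNIV Q" unfolding Q_def by (intro continuous_intros) (use l in auto)
    show "0 \<le> N z" for z by (simp add: N_def)
    show "0 \<le> Q z" for z using l \<gamma> by (simp add: Q_def)
    fix r
    show "closed {z \<in> C. N z \<le> r}"
    proof (cases "0 \<le> r")
      case True
      have "{z \<in> C. N z \<le> r} = {z. weak_grad (fst z) (snd z)} \<inter> (snd -` {P. energy 0 P \<le> ennreal r})"
      proof -
        have "(t < \<infinity> \<and> enn2real t \<le> r) \<longleftrightarrow> t \<le> ennreal r" for t
          using True by (cases t) (auto simp: top_unique)
        then show ?thesis by (auto simp: C_def N_def)
      qed
      moreover have "closed (snd -` {P. energy 0 P \<le> ennreal r} :: ((real^2) lsq \<times> (((real^2) lsq)^2)) set)"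
        by (rule closed_vimage[OF closed_energy_0]) (intro continuous_intros)
      ultimately show ?thesis using closed_weak_grad by auto
    next
      case False
      have "0 \<le> N z" for z by (simp add: N_def)
      then have "{z \<in> C. N z \<le> r} = {}" using False by (auto intro: order_trans)
      then show ?thesis by (simp only: closed_empty)
    qed
  qed
  then obtain z where "z \<in> C" "\<And>y. y \<in> C \<Longrightarrow> Q z + N z \<le> Q y + N y" by blast
  then show ?thesis
    by (intro exI[of _ "fst z"] exI[of _ "snd z"]) (fastforce simp: C_def Q_def N_def)
qed

lemma Phi1_L2_energy:
  assumes \<gamma>: "0 < \<gamma>"
  shows "L2_energy \<Omega> (Phi1 \<Omega> \<gamma>)"
proof (rule L2_energy.intro[OF open_domain_axioms], rule L2_energy_axioms.intro)
  show nonneg: "0 \<le> Phi1 \<Omega> \<gamma> u" for u by (simp add: Phi1_def)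
  show cong: "Phi1 \<Omega> \<gamma> u = Phi1 \<Omega> \<gamma> v" if "u \<in> L2 \<Omega>" "v \<in> L2 \<Omega>" "L2_eq \<Omega> u v" for u v
  proof -
    have "is_weak_gradient \<Omega> u = is_weak_gradient \<Omega> v"
      using that zero_ext_eq_iff[OF that(1,2)] by (auto simp: fun_eq_iff is_weak_gradient_iff)
    then have "weak_gradient \<Omega> u = weak_gradient \<Omega> v" "u \<in> H1 \<Omega> \<longleftrightarrow> v \<in> H1 \<Omega>"
      using that by (simp_all only: weak_gradient_def H1_def mem_Collect_eq)
    then show ?thesis by (simp only: Phi1_def)
  qed
  define D f where "D = {U. Phi1 \<Omega> \<gamma> (rep_lsq U) < \<infinity>}" and "f U = real_of_ereal (Phi1 \<Omega> \<gamma> (rep_lsq U))" for U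
  have le: "U \<in> D \<and> f U \<le> enn2real t" if t: "weak_grad U P" "energy \<gamma> P \<le> t" "t < \<infinity>" for U P t
  proof -
    obtain r where r: "t = ennreal r" "0 \<le> r" using t(3) by (cases t) auto
    have "Phi1 \<Omega> \<gamma> (rep_lsq U) \<le> enn2ereal t"
      using Phi1_le_energy[OF t(1)] t(2) unfolding less_eq_ennreal.rep_eq by (rule order_trans)
    then have "Phi1 \<Omega> \<gamma> (rep_lsq U) \<le> ereal r" using r by (simp add: enn2ereal_ennreal)
    then show ?thesis using nonneg[of "rep_lsq U"] r
      by (cases "Phi1 \<Omega> \<gamma> (rep_lsq U)") (auto simp: D_def f_def)
  qed
  have rep: "\<exists>P. weak_grad U P \<and> energy \<gamma> P < \<infinity> \<and> f U = enn2real (energy \<gamma> P)" if U: "U \<in> D" for U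
  proof -
    obtain P where P: "weak_grad U P" "Phi1 \<Omega> \<gamma> (rep_lsq U) = enn2ereal (energy \<gamma> P)"
      using Phi1_energy_eq U by (auto simp: D_def)
    have "energy \<gamma> P < \<infinity>" using U P(2) by (cases "energy \<gamma> P") (auto simp: D_def)
    moreover have "f U = enn2real (energy \<gamma> P)" unfolding f_def P(2) enn2real_def by simp
    ultimately show ?thesis using P(1) by blast
  qed
  have comb: "a *\<^sub>R U + b *\<^sub>R V \<in> D \<and> f (a *\<^sub>R U + b *\<^sub>R V) \<le> a * f U + b * f V"
    if "U \<in> D" "V \<in> D" and ab: "0 \<le> a" "0 \<le> b" "a + b = 1" for U V a b
  proof -
    obtain P R where P: "weak_grad U P" "energy \<gamma> P < \<infinity>" "f U = enn2real (energy \<gamma> P)"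
      and R: "weak_grad V R" "energy \<gamma> R < \<infinity>" "f V = enn2real (energy \<gamma> R)"
      using rep \<open>U \<in> D\<close> \<open>V \<in> D\<close> by metis
    have nn: "0 \<le> f U" "0 \<le> f V" by (auto simp: P(3) R(3))
    have "energy \<gamma> (a *\<^sub>R P + b *\<^sub>R R) \<le> ennreal a * energy \<gamma> P + ennreal b * energy \<gamma> R"
      using \<gamma> ab by (intro energy_convex) auto
    also have "\<dots> = ennreal a * ennreal (f U) + ennreal b * ennreal (f V)"
      using P(2,3) R(2,3) by simp
    also have "\<dots> = ennreal (a * f U + b * f V)"
      using ab nn by (simp add: ennreal_mult ennreal_plus)
    finally have "energy \<gamma> (a *\<^sub>R P + b *\<^sub>R R) \<le> ennreal (a * f U + b * f V)" .
    moreover have "ennreal (a * f U + b * f V) < \<infinity>" unfolding infinity_ennreal_def by (rule ennreal_less_top)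
    ultimately have "a *\<^sub>R U + b *\<^sub>R V \<in> D \<and> f (a *\<^sub>R U + b *\<^sub>R V) \<le> enn2real (ennreal (a * f U + b * f V))"
      by (rule le[OF weak_grad_combination[OF P(1) R(1)]])
    then show ?thesis using ab nn by (simp only: enn2real_ennreal[OF add_nonneg_nonneg[OF mult_nonneg_nonneg mult_nonneg_nonneg]])
  qed
  have "convex_energy D f"
  proof
    show "convex_on D f" unfolding convex_on_def convex_def using comb by blast
    show "0 \<le> f U" if "U \<in> D" for U using rep[OF that] by auto
    have "tests \<subseteq> D"
    proof
      fix U assume "U \<in> tests"
      then obtain \<phi> where \<phi>: "\<phi> \<in> C1_0 \<Omega>" "L2_eq \<Omega> (rep_lsq U) \<phi>" by (auto simp: tests_def)
      have "L2_eq \<Omega> (rep_lsq (abs_lsq \<phi>)) \<phi>"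
        unfolding L2_eq_iff using rep_abs[OF C1_0_sqint[OF \<phi>(1)]] by eventually_elim simp
      then have "Phi1 \<Omega> \<gamma> (rep_lsq U) = Phi1 \<Omega> \<gamma> (rep_lsq (abs_lsq \<phi>))"
        using \<phi>(2) L2_eq_trans L2_eq_sym by (intro cong rep_L2) blast
      moreover have "abs_lsq \<phi> \<in> D"
        using le[OF weak_grad_test[OF \<phi>(1)] order_refl energy_test_finite[OF \<phi>(1)]] \<gamma> by simp
      ultimately show "U \<in> D" by (simp add: D_def)
    qed
    then show "closure D = UNIV" using closure_mono tests_dense by blast
    fix l :: real and x :: "(real^2) lsq" assume l: "0 < l"
    obtain Y P where Y: "weak_grad Y P" "energy 0 P < \<infinity>" and min: "\<And>V R. weak_grad V R \<Longrightarrow> energy 0 R < \<infinity> \<Longrightarrow>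
        (norm (Y - x))\<^sup>2 / (2 * l) + \<gamma> / 2 * (norm P)\<^sup>2 + enn2real (energy 0 P)
        \<le> (norm (V - x))\<^sup>2 / (2 * l) + \<gamma> / 2 * (norm R)\<^sup>2 + enn2real (energy 0 R)"
      using Phi1_minimiser[OF \<gamma> l, of x] by blast
    have tot: "energy \<gamma> R < \<infinity> \<longleftrightarrow> energy 0 R < \<infinity>"
      "energy 0 R < \<infinity> \<Longrightarrow> enn2real (energy \<gamma> R) = \<gamma> / 2 * (norm R)\<^sup>2 + enn2real (energy 0 R)" for R
      unfolding energy_split[OF less_imp_le[OF \<gamma>], of R] using \<gamma>
      by (auto simp: enn2real_plus)
    have "Y \<in> D" and fY: "f Y \<le> enn2real (energy \<gamma> P)" using le[OF Y(1) order_refl] Y(2) tot(1) by blast+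
    moreover have "f Y + (norm (Y - x))\<^sup>2 / (2 * l) \<le> f v + (norm (v - x))\<^sup>2 / (2 * l)" if v: "v \<in> D" for v
    proof -
      obtain R where R: "weak_grad v R" "energy \<gamma> R < \<infinity>" "f v = enn2real (energy \<gamma> R)" using rep[OF v] by blast
      then have fin: "energy 0 R < \<infinity>" using tot(1) by blast
      show ?thesis
        using min[OF R(1) fin] fY tot(2)[OF fin] tot(2)[OF Y(2)] R(3) by linarith
    qed
    ultimately show "\<exists>y\<in>D. \<forall>v\<in>D. f y + (norm (y - x))\<^sup>2 / (2 * l) \<le> f v + (norm (v - x))\<^sup>2 / (2 * l)"
      by blast
  qed
  then show "convex_energy {U. Phi1 \<Omega> \<gamma> (rep_lsq U) < \<infinity>} (\<lambda>U. real_of_ereal (Phi1 \<Omega> \<gamma> (rep_lsq U)))"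
    by (simp add: D_def f_def[abs_def])
qed

end

section \<open>Well-posedness of both flows\<close>

theorem theorem2p2:
  fixes \<Omega> :: "(real^2) set" and \<gamma> :: real and i :: nat and u0 :: "real^2 \<Rightarrow> real"
    and A :: "(real^2 \<Rightarrow> real) \<Rightarrow> (real^2 \<Rightarrow> real) set"
  assumes "open \<Omega>" and "\<gamma> > 0" and "i \<in> {0, 1}"
    and "A = subdiff \<Omega> (Phi \<Omega> \<gamma> i)"
    and "u0 \<in> L2 \<Omega>"
  shows "\<exists>u. is_solution \<Omega> A u0 u \<and>
             (\<forall>v. is_solution \<Omega> A u0 v \<longrightarrow> (\<forall>t\<ge>0. L2_eq \<Omega> (v t) (u t))) \<and>
             (\<forall>t>0. u t \<in> op_domain \<Omega> A \<and>
                    (\<exists>d. has_right_deriv_L2 \<Omega> u d t \<and>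
                         (\<exists>a\<in>minimal_section \<Omega> A (u t). L2_eq \<Omega> (\<lambda>x. d x + a x) (\<lambda>x. 0))))"
proof -
  interpret open_domain \<Omega> by standard (rule assms(1))
  have "L2_energy \<Omega> (Phi \<Omega> \<gamma> i)"
    using Phi0_L2_energy Phi1_L2_energy[OF assms(2)] by (simp add: Phi_def)
  then show ?thesis using assms(4,5) by (intro L2_energy.well_posed)
qed

end
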